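(* Let $n\ge1$, let $\mathfrak A$ be a Banach algebra, let $\mathcal A$ and $\mathcal B$ be unital Banach algebras which are commutative Banach $\mathfrak A$-modules, and let $\mathcal M$ be a unital Banach $\mathcal A,\mathcal B$-module which is a commutative Banach $\mathfrak A$-module. Let $\mathcal T=\begin{bmatrix}\mathcal A&\mathcal M\\&\mathcal B\end{bmatrix}$. Then: (i) $ZR_{\mathfrak A,\mathcal A,\mathcal B}(\mathcal M,\mathcal M^{(2n)})\subseteq \mathrm{Hom}_{\mathfrak A,\mathcal A,\mathcal B}(\mathcal M,\mathcal M^{(2n)})$. (ii) If $\Omega\in \mathrm{Hom}_{\mathfrak T,\mathcal A,\mathcal B}\left(\begin{bmatrix}0&\mathcal M\\&0\end{bmatrix},\begin{bmatrix}0&\mathcal M^{(2n)}\\&0\end{bmatrix}\right)$, then the map $$\Delta_\Omega\begin{bmatrix}a&m\\&b\end{bmatrix}=\Omega\left(\begin{bmatrix}0&m\\&0\end{bmatrix}\right)=\begin{bmatrix}0&\Omega_{\mathcal M}(m)\\&0\end{bmatrix}$$ belongs to $\mathcal Z^1_{\mathfrak T}(\mathcal T,\mathcal T^{(2n)})$, where $\Omega_{\mathcal M}\in\mathrm{Hom}_{\mathfrak A,\mathcal A,\mathcal B}(\mathcal M,\mathcal M^{(2n)})$. Furthermore, $\Delta_\Omega$ is inner if and only if $\Omega$ is a central Rosenblum operator on $\mathcal M$ with coefficients in $\mathcal M^{(2n)}$. (iii) If $\mathcal A$ and $\mathcal B$ are $(2n)$-weakly module amenable (as $\mathfrak A$-modules),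 then $$\mathcal H^1_{\mathfrak T}(\mathcal T,\mathcal T^{(2n)})\simeq \mathrm{Hom}_{\mathfrak T,\mathcal A,\mathcal B}\left(\begin{bmatrix}0&\mathcal M\\&0\end{bmatrix},\begin{bmatrix}0&\mathcal M^{(2n)}\\&0\end{bmatrix}\right)\Big/ ZR_{\mathfrak T,\mathcal A,\mathcal B}\left(\begin{bmatrix}0&\mathcal M\\&0\end{bmatrix},\begin{bmatrix}0&\mathcal M^{(2n)}\\&0\end{bmatrix}\right);$$ in other words, $$\mathcal H^1_{\mathfrak T}(\mathcal T,\mathcal T^{(2n)})\simeq \mathrm{Hom}_{\mathfrak A,\mathcal A,\mathcal B}(\mathcal M,\mathcal M^{(2n)})\big/ZR_{\mathfrak A,\mathcal A,\mathcal B}(\mathcal M,\mathcal M^{(2n)}).$$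
   Context: A Banach algebra $\mathcal A$ is a Banach $\mathfrak A$-module (with compatible actions) if it is a Banach $\mathfrak A$-bimodule with $\alpha\cdot(ab)=(\alpha\cdot a)b$, $(ab)\cdot\alpha=a(b\cdot\alpha)$. A Banach $\mathfrak A$-bimodule $X$ is commutative if $\alpha\cdot x=x\cdot\alpha$ for all $\alpha,x$. A Banach $\mathcal A,\mathcal B$-module $\mathcal M$ is a left Banach $\mathcal A$-module and right Banach $\mathcal B$-module with $(a\cdot m)\cdot b=a\cdot(m\cdot b)$, unital if $1_{\mathcal A}\cdot m=m=m\cdot1_{\mathcal B}$; it is also a Banach $\mathfrak A$-bimodule with compatible actions $\alpha\cdot(a\cdot m)=(\alpha\cdot a)\cdot m$, $(\alpha\cdot m)\cdot b=\alpha\cdot(m\cdot b)$, $m\cdot(b\cdot\alpha)=(m\cdot b)\cdot\alpha$, $(a\cdot m)\cdot\alpha=a\cdot(m\cdot\alpha)$. $\mathcal T=\left\{\begin{bmatrix}a&m\\&b\end{bmatrix}\right\}$ has the usual $2\times2$ matrix operations and norm $\|a\|+\|m\|+\|b\|$; $\mathfrak T=\left\{\begin{bmatrix}\alpha&\\&\alpha\end{bmatrix}:\alpha\in\mathfrak A\right\}$ acts entrywise on both sides. $X^{(k)}$ denotes the $k$-th dual with iterated dual actions ($\langle f\cdot a,x\rangle=\langle f,a\cdot x\rangle$, $\langle a\cdot f,x\rangle=\langle f,x\cdot a\rangle$, likewise for $\mathfrak A$). As a Banach space $\mathcal T^{(2n)}\simeq\mathcal A^{(2n)}\oplus\mathcal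 M^{(2n)}\oplus\mathcal B^{(2n)}$, written as matrices, with $$\begin{bmatrix}a&m\\&b\end{bmatrix}\cdot\begin{bmatrix}\lambda&\gamma\\&\mu\end{bmatrix}=\begin{bmatrix}a\lambda&a\gamma+m\mu\\&b\mu\end{bmatrix},\quad \begin{bmatrix}\lambda&\gamma\\&\mu\end{bmatrix}\cdot\begin{bmatrix}a&m\\&b\end{bmatrix}=\begin{bmatrix}\lambda a&\lambda m+\gamma b\\&\mu b\end{bmatrix}.$$ Here for $\lambda\in\mathcal A^{(2k)},\mu\in\mathcal B^{(2k)}$, $m\in\mathcal M$ the elements $\lambda m,m\mu\in\mathcal M^{(2k)}$ are defined inductively (starting from the module actions at $k=0$) by $\langle\lambda m,\varphi\rangle=\langle\lambda,m\varphi\rangle$, $\langle m\mu,\varphi\rangle=\langle\mu,\varphi m\rangle$ for $\varphi\in\mathcal M^{(2k-1)}$, where $m\varphi\in\mathcal A^{(2k-1)}$, $\varphi m\in\mathcal B^{(2k-1)}$ are given by $\langle m\varphi,\lambda'\rangle=\langle\varphi,\lambda' m\rangle$, $\langle\varphi m,\mu'\rangle=\langle\varphi,m\mu'\rangle$ for $\lambda'\in\mathcal A^{(2k-2)}$, $\mu'\in\mathcal B^{(2k-2)}$. An $\mathfrak A$-module map is an additive map commuting with the left and right $\mathfrak A$-actions (not necessarily $\mathbb C$-linear). A module derivation $D:\mathcal A\to X$ is a bounded $\mathfrak A$-module map ($\|D(a)\|\le M\|a\|$) with $D(ab)=D(a)\cdot b+a\cdot D(b)$; it is inner if $D(a)=a\cdot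 x-x\cdot a$ for some $x\in X$. $\mathcal Z^1_{\mathfrak A}(\mathcal A,X)$, $\mathcal N^1_{\mathfrak A}(\mathcal A,X)$ are the spaces of module derivations and inner ones, and $\mathcal H^1_{\mathfrak A}=\mathcal Z^1_{\mathfrak A}/\mathcal N^1_{\mathfrak A}$; similarly for $\mathcal T$ and $\mathfrak T$. $\simeq$ denotes isomorphism of vector spaces. $\mathcal A$ is $k$-weakly module amenable (as an $\mathfrak A$-module) if $(\mathcal A/J)^{(k)}$ is a commutative $\mathcal A$-$\mathfrak A$-module and every module derivation $\mathcal A\to(\mathcal A/J)^{(k)}$ is inner, $J$ being the closed ideal generated by the elements $(a\cdot\alpha)b-a(\alpha\cdot b)$. For $\mathcal A$ a commutative $\mathfrak A$-module, $J=\{0\}$ and $\mathcal A^{(k)}$ is automatically a commutative $\mathcal A$-$\mathfrak A$-module, so this says that every module derivation $\mathcal A\to\mathcal A^{(k)}$ is inner. $Z_{\mathcal A}(\mathcal A^{(2n)})=\{x\in\mathcal A^{(2n)}:x\cdot a=a\cdot x\ \forall a\in\mathcal A\}$, and similarly $Z_{\mathcal B}(\mathcal B^{(2n)})$. For $x\in Z_{\mathcal A}(\mathcal A^{(2n)})$, $z\in Z_{\mathcal B}(\mathcal B^{(2n)})$ let $\rho_{x,z}:\mathcal M\to\mathcal M^{(2n)}$, $\rho_{x,z}(m)=x\cdot m-m\cdot z$ (an $\mathfrak A$-module map). $ZR_{\mathfrak A,\mathcal A,\mathcal B}(\mathcal M,\mathcal M^{(2n)})$ is the set of all such $\rho_{x,z}$,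 called central Rosenblum operators on $\mathcal M$ with coefficients in $\mathcal M^{(2n)}$. $\mathrm{Hom}_{\mathfrak A,\mathcal A,\mathcal B}(\mathcal M,\mathcal M^{(2n)})$ is the set of continuous additive maps $\varphi:\mathcal M\to\mathcal M^{(2n)}$ with $\varphi(a\cdot m)=a\cdot\varphi(m)$, $\varphi(m\cdot b)=\varphi(m)\cdot b$, $\varphi(\alpha\cdot m)=\alpha\cdot\varphi(m)$, $\varphi(m\cdot\alpha)=\varphi(m)\cdot\alpha$ for all $\alpha\in\mathfrak A,a\in\mathcal A,m\in\mathcal M,b\in\mathcal B$. The matrix versions $\mathrm{Hom}_{\mathfrak T,\mathcal A,\mathcal B}$ and $ZR_{\mathfrak T,\mathcal A,\mathcal B}$ are the sets of maps $\Omega:\begin{bmatrix}0&m\\&0\end{bmatrix}\mapsto\begin{bmatrix}0&\Omega_{\mathcal M}(m)\\&0\end{bmatrix}$ with $\Omega_{\mathcal M}$ in $\mathrm{Hom}_{\mathfrak A,\mathcal A,\mathcal B}(\mathcal M,\mathcal M^{(2n)})$, respectively in $ZR_{\mathfrak A,\mathcal A,\mathcal B}(\mathcal M,\mathcal M^{(2n)})$; $\Omega$ is called a central Rosenblum operator when $\Omega_{\mathcal M}$ is one. *)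

theory Defs
  imports
    Complex_Main
    "HOL-Library.Function_Algebras"
    "HOL-Library.Product_Plus"
    "HOL-Library.Set_Algebras"
begin

section \<open>Complex vector spaces and Banach spaces\<close>

class complex_vector = ab_group_add +
  fixes scaleC :: "complex \<Rightarrow> 'a \<Rightarrow> 'a"  (infixr "*\<^sub>C" 75)
  assumes scaleC_add_right: "c *\<^sub>C (x + y) = c *\<^sub>C x + c *\<^sub>C y"
    and scaleC_add_left: "(c + d) *\<^sub>C x = c *\<^sub>C x + d *\<^sub>C x"
    and scaleC_scaleC: "c *\<^sub>C d *\<^sub>C x = (c * d) *\<^sub>C x"
    and scaleC_one: "1 *\<^sub>C x = x"

interpretation cvec: vector_space "scaleC :: complex \<Rightarrow> 'a::complex_vector \<Rightarrow> 'a"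
  by unfold_locales
    (auto simp: scaleC_add_right scaleC_add_left scaleC_scaleC scaleC_one)

abbreviation csubspace :: "'a::complex_vector set \<Rightarrow> bool"
  where "csubspace \<equiv> module.subspace scaleC"

instantiation prod :: (complex_vector, complex_vector) complex_vector
begin
definition scaleC_prod :: "complex \<Rightarrow> 'a \<times> 'b \<Rightarrow> 'a \<times> 'b"
  where "c *\<^sub>C p = (c *\<^sub>C fst p, c *\<^sub>C snd p)"
instance
  by standard
    (auto simp: scaleC_prod_def scaleC_add_right scaleC_add_left scaleC_scaleC scaleC_one)
end

instantiation "fun" :: (type, complex_vector) complex_vector
begin
definition scaleC_fun :: "complex \<Rightarrow> ('a \<Rightarrow> 'b) \<Rightarrow> 'a \<Rightarrow> 'b"
  where "c *\<^sub>C f = (\<lambda>x. c *\<^sub>C f x)"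
instance
  by standard
    (auto simp: scaleC_fun_def scaleC_add_right scaleC_add_left scaleC_scaleC scaleC_one fun_eq_iff)
end

text \<open>A normed space is given by a carrier inside an ambient complex vector space, together with a
  norm on that carrier. Carriers, rather than whole types, are needed because a space and
  its iterated duals, up to an order that is a variable, have to inhabit one type.\<close>

record 'x nspace =
  pts :: "'x set"
  nrm :: "'x \<Rightarrow> real"

definition banach_space :: "'x::complex_vector nspace \<Rightarrow> bool" where
  "banach_space X \<longleftrightarrow>
     csubspace (pts X) \<and>
     (\<forall>x\<in>pts X. 0 \<le> nrm X x \<and> (nrm X x = 0 \<longleftrightarrow> x = 0)) \<and>
     (\<forall>x\<in>pts X. \<forall>y\<in>pts X. nrm X (x + y) \<le> nrm X x + nrm X y) \<and>
     (\<forall>c. \<forall>x\<in>pts X. nrm X (c *\<^sub>C x) = cmod c * nrm X x) \<and>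
     (\<forall>s::nat \<Rightarrow> 'x. (\<forall>i. s i \<in> pts X) \<and>
         (\<forall>e>0. \<exists>N. \<forall>i\<ge>N. \<forall>j\<ge>N. nrm X (s i - s j) < e) \<longrightarrow>
         (\<exists>x\<in>pts X. (\<lambda>i. nrm X (s i - x)) \<longlonglongrightarrow> 0))"

definition additive_on :: "'x::plus set \<Rightarrow> ('x \<Rightarrow> 'y::plus) \<Rightarrow> bool" where
  "additive_on S f \<longleftrightarrow> (\<forall>x\<in>S. \<forall>y\<in>S. f (x + y) = f x + f y)"

definition bounded_bilinear_op ::
    "'x::complex_vector nspace \<Rightarrow> 'y::complex_vector nspace \<Rightarrow> 'z::complex_vector nspace
      \<Rightarrow> ('x \<Rightarrow> 'y \<Rightarrow> 'z) \<Rightarrow> bool" where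
  "bounded_bilinear_op X Y Z f \<longleftrightarrow>
     (\<forall>x\<in>pts X. \<forall>y\<in>pts Y. f x y \<in> pts Z) \<and>
     (\<forall>x\<in>pts X. additive_on (pts Y) (f x)) \<and>
     (\<forall>y\<in>pts Y. additive_on (pts X) (\<lambda>x. f x y)) \<and>
     (\<forall>c. \<forall>x\<in>pts X. \<forall>y\<in>pts Y. f (c *\<^sub>C x) y = c *\<^sub>C f x y \<and> f x (c *\<^sub>C y) = c *\<^sub>C f x y) \<and>
     (\<exists>K. \<forall>x\<in>pts X. \<forall>y\<in>pts Y. nrm Z (f x y) \<le> K * nrm X x * nrm Y y)"


section \<open>Iterated duals\<close>

definition bounded_functional :: "'x::complex_vector nspace \<Rightarrow> ('x \<Rightarrow> complex) \<Rightarrow> bool" where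
  "bounded_functional X f \<longleftrightarrow>
     additive_on (pts X) f \<and>
     (\<forall>c. \<forall>x\<in>pts X. f (c *\<^sub>C x) = c * f x) \<and>
     (\<exists>K. \<forall>x\<in>pts X. cmod (f x) \<le> K * nrm X x)"

definition dual_norm :: "'x nspace \<Rightarrow> ('x \<Rightarrow> complex) \<Rightarrow> real" where
  "dual_norm X f = Sup {cmod (f x) | x. x \<in> pts X \<and> nrm X x \<le> 1}"

text \<open>\<open>is_dual X Y p\<close>: the pairing \<open>p y x\<close> identifies \<open>Y\<close>, linearly and isometrically, with the
  Banach space of all bounded linear functionals on \<open>X\<close>.\<close>

definition is_dual :: "'x::complex_vector nspace \<Rightarrow> 'x nspace \<Rightarrow> ('x \<Rightarrow> 'x \<Rightarrow> complex) \<Rightarrow> bool" where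
  "is_dual X Y p \<longleftrightarrow>
     csubspace (pts Y) \<and>
     (\<forall>y\<in>pts Y. bounded_functional X (p y)) \<and>
     (\<forall>x\<in>pts X. additive_on (pts Y) (\<lambda>y. p y x)) \<and>
     (\<forall>c. \<forall>y\<in>pts Y. \<forall>x\<in>pts X. p (c *\<^sub>C y) x = c * p y x) \<and>
     (\<forall>f. bounded_functional X f \<longrightarrow> (\<exists>!y. y \<in> pts Y \<and> (\<forall>x\<in>pts X. p y x = f x))) \<and>
     (\<forall>y\<in>pts Y. nrm Y y = dual_norm X (p y))"

text \<open>\<open>dual X k\<close> is the \<open>k\<close>-th dual of the space \<open>dual X 0\<close>, and \<open>pairing X k\<close> pairs \<open>dual X (k + 1)\<close>
  with \<open>dual X k\<close>. No single type can contain all iterated duals of a given space, so they are not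
  constructed; \<open>dual_tower N X\<close> says that \<open>X\<close> is a realisation of the duals up to order \<open>N\<close>. For
  each \<open>N\<close> there is one over a large enough type, and it is unique up to isometric isomorphism.\<close>

record 'x dspace =
  dual :: "nat \<Rightarrow> 'x nspace"
  pairing :: "nat \<Rightarrow> 'x \<Rightarrow> 'x \<Rightarrow> complex"

abbreviation dpts :: "('x, 'z) dspace_scheme \<Rightarrow> nat \<Rightarrow> 'x set"
  where "dpts X k \<equiv> pts (dual X k)"

abbreviation carr :: "('x, 'z) dspace_scheme \<Rightarrow> 'x set"
  where "carr X \<equiv> pts (dual X 0)"

definition dual_tower :: "nat \<Rightarrow> ('x::complex_vector, 'z) dspace_scheme \<Rightarrow> bool" where
  "dual_tower N X \<longleftrightarrow> (\<forall>k<N. is_dual (dual X k) (dual X (Suc k)) (pairing X k))"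

text \<open>The element of the \<open>(k + 1)\<close>-st dual that represents a functional on the \<open>k\<close>-th dual.\<close>

definition dual_elt :: "('x, 'z) dspace_scheme \<Rightarrow> nat \<Rightarrow> ('x \<Rightarrow> complex) \<Rightarrow> 'x" where
  "dual_elt X k f = (THE y. y \<in> dpts X (Suc k) \<and> (\<forall>x\<in>dpts X k. pairing X k y x = f x))"

text \<open>The \<open>k\<close>-fold adjoint of an operator. If \<open>T\<close> is left multiplication \<open>x \<mapsto> a x\<close>, then its adjoint
  \<open>f \<mapsto> f a\<close> is right multiplication on the dual, where \<open>\<langle>f a, x\<rangle> = \<langle>f, a x\<rangle>\<close>; its second adjoint
  \<open>F \<mapsto> a F\<close> is again left multiplication, where \<open>\<langle>a F, f\<rangle> = \<langle>F, f a\<rangle>\<close>, and so on. The roles of left and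
  right are exchanged if \<open>T\<close> is right multiplication. Hence the \<open>2n\<close>-fold adjoints of the left and right
  multiplications are the iterated dual actions on the \<open>2n\<close>-th dual.\<close>

primrec dual_op :: "('x, 'z) dspace_scheme \<Rightarrow> nat \<Rightarrow> ('x \<Rightarrow> 'x) \<Rightarrow> 'x \<Rightarrow> 'x" where
  "dual_op X 0 T = T"
| "dual_op X (Suc k) T = (\<lambda>f. dual_elt X k (\<lambda>x. pairing X k f (dual_op X k T x)))"

definition dual_left ::
    "('x, 'z) dspace_scheme \<Rightarrow> nat \<Rightarrow> ('s \<Rightarrow> 'x \<Rightarrow> 'x) \<Rightarrow> 's \<Rightarrow> 'x \<Rightarrow> 'x" where
  "dual_left X n l s F = dual_op X (2 * n) (l s) F"

definition dual_right ::
    "('x, 'z) dspace_scheme \<Rightarrow> nat \<Rightarrow> ('x \<Rightarrow> 's \<Rightarrow> 'x) \<Rightarrow> 'x \<Rightarrow> 's \<Rightarrow> 'x" where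
  "dual_right X n r F s = dual_op X (2 * n) (\<lambda>x. r x s) F"


section \<open>Banach algebras and modules\<close>

definition banach_algebra :: "'x::complex_vector nspace \<Rightarrow> ('x \<Rightarrow> 'x \<Rightarrow> 'x) \<Rightarrow> bool" where
  "banach_algebra X m \<longleftrightarrow>
     banach_space X \<and> bounded_bilinear_op X X X m \<and>
     (\<forall>x\<in>pts X. \<forall>y\<in>pts X. \<forall>z\<in>pts X. m (m x y) z = m x (m y z)) \<and>
     (\<forall>x\<in>pts X. \<forall>y\<in>pts X. nrm X (m x y) \<le> nrm X x * nrm X y)"

text \<open>\<open>X\<close> is a left Banach module over the algebra \<open>(S, mS)\<close> and a right Banach module over the
  algebra \<open>(U, mU)\<close>, and the two actions commute.\<close>

definition banach_bimodule ::
    "'s::complex_vector nspace \<Rightarrow> ('s \<Rightarrow> 's \<Rightarrow> 's) \<Rightarrow> 'u::complex_vector nspace \<Rightarrow> ('u \<Rightarrow> 'u \<Rightarrow> 'u)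
      \<Rightarrow> 'x::complex_vector nspace \<Rightarrow> ('s \<Rightarrow> 'x \<Rightarrow> 'x) \<Rightarrow> ('x \<Rightarrow> 'u \<Rightarrow> 'x) \<Rightarrow> bool" where
  "banach_bimodule S mS U mU X l r \<longleftrightarrow>
     banach_space X \<and>
     bounded_bilinear_op S X X l \<and> bounded_bilinear_op X U X r \<and>
     (\<forall>s\<in>pts S. \<forall>t\<in>pts S. \<forall>x\<in>pts X. l (mS s t) x = l s (l t x)) \<and>
     (\<forall>u\<in>pts U. \<forall>v\<in>pts U. \<forall>x\<in>pts X. r x (mU u v) = r (r x u) v) \<and>
     (\<forall>s\<in>pts S. \<forall>u\<in>pts U. \<forall>x\<in>pts X. r (l s x) u = l s (r x u))"

text \<open>Below, \<open>'r\<close> is the type of the coefficient algebra, called \<open>\<AA>\<close> in the comments, with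
  actions \<open>lact\<close> and \<open>ract\<close>.\<close>

record ('r, 'x) amod = "'x dspace" +
  lact :: "'r \<Rightarrow> 'x \<Rightarrow> 'x"
  ract :: "'x \<Rightarrow> 'r \<Rightarrow> 'x"

record ('r, 'x) aalg = "('r, 'x) amod" +
  mul :: "'x \<Rightarrow> 'x \<Rightarrow> 'x"
  one :: "'x"

record ('r, 'a, 'b, 'm) abmod = "('r, 'm) amod" +
  lmod :: "'a \<Rightarrow> 'm \<Rightarrow> 'm"
  rmod :: "'m \<Rightarrow> 'b \<Rightarrow> 'm"

definition commutative_module :: "'r nspace \<Rightarrow> ('r, 'x, 'z) amod_scheme \<Rightarrow> bool" where
  "commutative_module R X \<longleftrightarrow> (\<forall>\<alpha>\<in>pts R. \<forall>x\<in>carr X. lact X \<alpha> x = ract X x \<alpha>)"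

definition unital_banach_algebra :: "('r, 'x::complex_vector, 'z) aalg_scheme \<Rightarrow> bool" where
  "unital_banach_algebra X \<longleftrightarrow>
     banach_algebra (dual X 0) (mul X) \<and> one X \<in> carr X \<and>
     (\<forall>x\<in>carr X. mul X (one X) x = x \<and> mul X x (one X) = x)"

text \<open>Banach \<open>\<AA>\<close>-bimodule structure on a Banach algebra, with compatible actions.\<close>

definition banach_algebra_module ::
    "'r::complex_vector nspace \<Rightarrow> ('r \<Rightarrow> 'r \<Rightarrow> 'r) \<Rightarrow> ('r, 'x::complex_vector, 'z) aalg_scheme \<Rightarrow> bool" where
  "banach_algebra_module R mR X \<longleftrightarrow>
     banach_bimodule R mR R mR (dual X 0) (lact X) (ract X) \<and>
     (\<forall>\<alpha>\<in>pts R. \<forall>a\<in>carr X. \<forall>b\<in>carr X.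
        lact X \<alpha> (mul X a b) = mul X (lact X \<alpha> a) b \<and>
        ract X (mul X a b) \<alpha> = mul X a (ract X b \<alpha>))"

definition unital_banach_AB_module ::
    "('r, 'a::complex_vector) aalg \<Rightarrow> ('r, 'b::complex_vector) aalg
      \<Rightarrow> ('r, 'a, 'b, 'm::complex_vector) abmod \<Rightarrow> bool" where
  "unital_banach_AB_module A B M \<longleftrightarrow>
     banach_bimodule (dual A 0) (mul A) (dual B 0) (mul B) (dual M 0) (lmod M) (rmod M) \<and>
     (\<forall>m\<in>carr M. lmod M (one A) m = m \<and> rmod M m (one B) = m)"

text \<open>Banach \<open>\<AA>\<close>-bimodule structure on an \<open>A,B\<close>-module, with compatible actions.\<close>

definition banach_AB_module_module ::
    "'r::complex_vector nspace \<Rightarrow> ('r \<Rightarrow> 'r \<Rightarrow> 'r)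
      \<Rightarrow> ('r, 'a::complex_vector) aalg \<Rightarrow> ('r, 'b::complex_vector) aalg
      \<Rightarrow> ('r, 'a, 'b, 'm::complex_vector) abmod \<Rightarrow> bool" where
  "banach_AB_module_module R mR A B M \<longleftrightarrow>
     banach_bimodule R mR R mR (dual M 0) (lact M) (ract M) \<and>
     (\<forall>\<alpha>\<in>pts R. \<forall>a\<in>carr A. \<forall>m\<in>carr M. \<forall>b\<in>carr B.
        lact M \<alpha> (lmod M a m) = lmod M (lact A \<alpha> a) m \<and>
        rmod M (lact M \<alpha> m) b = lact M \<alpha> (rmod M m b) \<and>
        rmod M m (ract B b \<alpha>) = ract M (rmod M m b) \<alpha> \<and>
        ract M (lmod M a m) \<alpha> = lmod M a (ract M m \<alpha>))"


section \<open>Module derivations into even duals\<close>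

text \<open>\<open>S\<close> is the set of coefficients: the points of \<open>\<AA>\<close>, or the scalar matrices over them.\<close>

definition module_derivation ::
    "'s set \<Rightarrow> ('s, 'x::complex_vector, 'z) aalg_scheme \<Rightarrow> nat \<Rightarrow> ('x \<Rightarrow> 'x) \<Rightarrow> bool" where
  "module_derivation S X n D \<longleftrightarrow>
     (\<forall>a\<in>carr X. D a \<in> dpts X (2 * n)) \<and>
     additive_on (carr X) D \<and>
     (\<forall>s\<in>S. \<forall>a\<in>carr X.
        D (lact X s a) = dual_left X n (lact X) s (D a) \<and>
        D (ract X a s) = dual_right X n (ract X) (D a) s) \<and>
     (\<exists>K. \<forall>a\<in>carr X. nrm (dual X (2 * n)) (D a) \<le> K * nrm (dual X 0) a) \<and>
     (\<forall>a\<in>carr X. \<forall>b\<in>carr X.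
        D (mul X a b) = dual_right X n (mul X) (D a) b + dual_left X n (mul X) a (D b))"

definition inner_derivation :: "('s, 'x::complex_vector, 'z) aalg_scheme \<Rightarrow> nat \<Rightarrow> ('x \<Rightarrow> 'x) \<Rightarrow> bool" where
  "inner_derivation X n D \<longleftrightarrow>
     (\<exists>F\<in>dpts X (2 * n). \<forall>a\<in>carr X.
        D a = dual_left X n (mul X) a F - dual_right X n (mul X) F a)"

text \<open>Maps defined on a carrier are represented by functions that vanish outside it, so that
  equality of maps is equality of functions and the vector space operations are pointwise.\<close>

definition vanishes_off :: "'x set \<Rightarrow> ('x \<Rightarrow> 'y::zero) \<Rightarrow> bool" where
  "vanishes_off S f \<longleftrightarrow> (\<forall>x. x \<notin> S \<longrightarrow> f x = 0)"

definition Z1 :: "'s set \<Rightarrow> ('s, 'x::complex_vector, 'z) aalg_scheme \<Rightarrow> nat \<Rightarrow> ('x \<Rightarrow> 'x) set" where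
  "Z1 S X n = {D. module_derivation S X n D \<and> vanishes_off (carr X) D}"

definition N1 :: "'s set \<Rightarrow> ('s, 'x::complex_vector, 'z) aalg_scheme \<Rightarrow> nat \<Rightarrow> ('x \<Rightarrow> 'x) set" where
  "N1 S X n = {D \<in> Z1 S X n. inner_derivation X n D}"

text \<open>\<open>(2n)\<close>-weak module amenability of an algebra that is a commutative \<open>\<AA>\<close>-module: then the
  ideal \<open>J\<close> generated by the elements \<open>(a \<cdot> \<alpha>) b - a (\<alpha> \<cdot> b)\<close> is zero, and the \<open>(2n)\<close>-th dual of
  \<open>A / J\<close> is that of \<open>A\<close> and is a commutative module.\<close>

definition even_weakly_module_amenable ::
    "'s set \<Rightarrow> ('s, 'x::complex_vector, 'z) aalg_scheme \<Rightarrow> nat \<Rightarrow> bool" where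
  "even_weakly_module_amenable S X n \<longleftrightarrow>
     (\<forall>D. module_derivation S X n D \<longrightarrow> inner_derivation X n D)"


section \<open>Triangular matrices\<close>

text \<open>The triple \<open>(a, m, b)\<close> stands for the upper triangular matrix with diagonal \<open>a, b\<close> and
  corner \<open>m\<close>, and \<open>Diag \<alpha>\<close> for the diagonal matrix with both entries \<open>\<alpha>\<close>. The \<open>k\<close>-th dual of the
  triangular algebra is written in matrices over the \<open>k\<close>-th duals of the entries, paired entrywise.
  Its norm is the dual norm, and the actions on it are the iterated dual actions for this pairing,
  as for every other space.\<close>

datatype 'r scalar_matrix = Diag 'r

abbreviation scalar_matrices :: "'r nspace \<Rightarrow> 'r scalar_matrix set"
  where "scalar_matrices R \<equiv> Diag ` pts R"

definition tri_pts ::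
    "('a, 'u) dspace_scheme \<Rightarrow> ('m, 'v) dspace_scheme \<Rightarrow> ('b, 'w) dspace_scheme
      \<Rightarrow> nat \<Rightarrow> ('a \<times> 'm \<times> 'b) set" where
  "tri_pts A M B k = dpts A k \<times> dpts M k \<times> dpts B k"

definition tri_pairing ::
    "('a, 'u) dspace_scheme \<Rightarrow> ('m, 'v) dspace_scheme \<Rightarrow> ('b, 'w) dspace_scheme
      \<Rightarrow> nat \<Rightarrow> 'a \<times> 'm \<times> 'b \<Rightarrow> 'a \<times> 'm \<times> 'b \<Rightarrow> complex" where
  "tri_pairing A M B k = (\<lambda>(f, g, h) (a, m, b).
     pairing A k f a + pairing M k g m + pairing B k h b)"

primrec tri_nspace ::
    "('a, 'u) dspace_scheme \<Rightarrow> ('m, 'v) dspace_scheme \<Rightarrow> ('b, 'w) dspace_scheme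
      \<Rightarrow> nat \<Rightarrow> ('a \<times> 'm \<times> 'b) nspace" where
  "tri_nspace A M B 0 =
     \<lparr>pts = tri_pts A M B 0,
      nrm = (\<lambda>(a, m, b). nrm (dual A 0) a + nrm (dual M 0) m + nrm (dual B 0) b)\<rparr>"
| "tri_nspace A M B (Suc k) =
     \<lparr>pts = tri_pts A M B (Suc k),
      nrm = (\<lambda>F. dual_norm (tri_nspace A M B k) (tri_pairing A M B k F))\<rparr>"

definition Tri ::
    "('r, 'a::complex_vector) aalg \<Rightarrow> ('r, 'a, 'b, 'm::complex_vector) abmod
      \<Rightarrow> ('r, 'b::complex_vector) aalg \<Rightarrow> ('r scalar_matrix, 'a \<times> 'm \<times> 'b) aalg" where
  "Tri A M B =
     \<lparr>dual = tri_nspace A M B,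
      pairing = tri_pairing A M B,
      lact = (\<lambda>s (a, m, b). case s of Diag \<alpha> \<Rightarrow> (lact A \<alpha> a, lact M \<alpha> m, lact B \<alpha> b)),
      ract = (\<lambda>(a, m, b) s. case s of Diag \<alpha> \<Rightarrow> (ract A a \<alpha>, ract M m \<alpha>, ract B b \<alpha>)),
      mul = (\<lambda>(a, m, b) (a', m', b'). (mul A a a', lmod M a m' + rmod M m b', mul B b b')),
      one = (one A, 0, one B)\<rparr>"

text \<open>The matrix description is not an additional convention: by \<open>dual_tower_Tri\<close> below, the matrices over
  the duals of the entries do form the iterated duals of the triangular algebra.\<close>

definition pre_normed :: "'x::complex_vector nspace \<Rightarrow> bool" where
  "pre_normed X \<longleftrightarrow> csubspace (pts X) \<and> nrm X 0 = 0 \<and> (\<forall>x\<in>pts X. 0 \<le> nrm X x)"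

lemma dual_norm_props:
  assumes X: "pre_normed X" and f: "bounded_functional X f"
  shows "bdd_above {cmod (f x) | x. x \<in> pts X \<and> nrm X x \<le> 1}"
    and "x \<in> pts X \<Longrightarrow> nrm X x \<le> 1 \<Longrightarrow> cmod (f x) \<le> dual_norm X f"
    and "0 \<le> dual_norm X f"
    and "(\<And>x. x \<in> pts X \<Longrightarrow> nrm X x \<le> 1 \<Longrightarrow> cmod (f x) \<le> c) \<Longrightarrow> dual_norm X f \<le> c"
proof -
  let ?S = "{cmod (f x) | x. x \<in> pts X \<and> nrm X x \<le> 1}"
  obtain K where K: "\<And>x. x \<in> pts X \<Longrightarrow> cmod (f x) \<le> K * nrm X x"
    using f by (auto simp: bounded_functional_def)
  have b: "cmod (f x) \<le> \<bar>K\<bar>" if "x \<in> pts X" "nrm X x \<le> 1" for x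
  proof -
    have "K * nrm X x \<le> \<bar>K\<bar> * 1"
      using X that by (intro mult_mono) (auto simp: pre_normed_def)
    then show ?thesis using K[OF that(1)] by simp
  qed
  show bdd: "bdd_above ?S" using b by (auto intro!: bdd_aboveI[where M = "\<bar>K\<bar>"])
  show le: "x \<in> pts X \<Longrightarrow> nrm X x \<le> 1 \<Longrightarrow> cmod (f x) \<le> dual_norm X f" for x
    unfolding dual_norm_def by (rule cSup_upper[OF _ bdd]) auto
  have z: "0 \<in> pts X" "nrm X 0 \<le> 1" using X by (auto simp: pre_normed_def cvec.subspace_0)
  show "0 \<le> dual_norm X f" using le[OF z] norm_ge_zero order_trans by blast
  show "dual_norm X f \<le> c" if "\<And>x. x \<in> pts X \<Longrightarrow> nrm X x \<le> 1 \<Longrightarrow> cmod (f x) \<le> c"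
    unfolding dual_norm_def using z that by (intro cSup_least) auto
qed

lemma pre_normed_dual:
  assumes X: "pre_normed X" and d: "is_dual X Y p"
  shows "pre_normed Y"
proof -
  have sub: "csubspace (pts Y)" using d by (simp add: is_dual_def)
  have 0: "0 \<in> pts Y" using sub by (rule cvec.subspace_0)
  have n: "nrm Y y = dual_norm X (p y)" "bounded_functional X (p y)" if "y \<in> pts Y" for y
    using d that by (auto simp: is_dual_def)
  have "p (0 *\<^sub>C 0) x = 0 * p 0 x" if "x \<in> pts X" for x
    using d 0 that unfolding is_dual_def by blast
  then have p0: "p 0 x = 0" if "x \<in> pts X" for x using that by simp
  have "dual_norm X (p 0) \<le> 0"
    by (rule dual_norm_props(4)[OF X n(2)[OF 0]]) (simp add: p0)
  then have "nrm Y 0 = 0" using n[OF 0] dual_norm_props(3)[OF X] by force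
  then show ?thesis using sub n dual_norm_props(3)[OF X] by (simp add: pre_normed_def)
qed

lemma pre_normed_tower:
  assumes "banach_space (dual X 0)" "dual_tower N X" "k \<le> N"
  shows "pre_normed (dual X k)"
  using assms(3)
proof (induction k)
  case 0
  then show ?case using assms(1) by (auto simp: pre_normed_def banach_space_def cvec.subspace_0)
next
  case (Suc k)
  then have "is_dual (dual X k) (dual X (Suc k)) (pairing X k)" "pre_normed (dual X k)"
    using assms(2) by (auto simp: dual_tower_def)
  then show ?case using pre_normed_dual by blast
qed

lemma pts_tri_nspace: "pts (tri_nspace A M B k) = tri_pts A M B k"
  by (cases k) auto

lemma bounded_functional_tri:
  assumes f: "bounded_functional (dual A k) f" and g: "bounded_functional (dual M k) g"
    and h: "bounded_functional (dual B k) h"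
    and le: "\<And>a m b. (a, m, b) \<in> tri_pts A M B k \<Longrightarrow>
      nrm (dual A k) a \<le> t (a, m, b) \<and> nrm (dual M k) m \<le> t (a, m, b) \<and> nrm (dual B k) b \<le> t (a, m, b)"
    and pn: "pre_normed (dual A k)" "pre_normed (dual M k)" "pre_normed (dual B k)"
  shows "bounded_functional \<lparr>pts = tri_pts A M B k, nrm = t\<rparr> (\<lambda>(a, m, b). f a + g m + h b)"
proof -
  obtain K1 K2 K3 where K: "\<And>x. x \<in> dpts A k \<Longrightarrow> cmod (f x) \<le> K1 * nrm (dual A k) x"
     "\<And>x. x \<in> dpts M k \<Longrightarrow> cmod (g x) \<le> K2 * nrm (dual M k) x"
     "\<And>x. x \<in> dpts B k \<Longrightarrow> cmod (h x) \<le> K3 * nrm (dual B k) x"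
    using f g h unfolding bounded_functional_def by metis
  have "cmod (f a + g m + h b) \<le> (\<bar>K1\<bar> + \<bar>K2\<bar> + \<bar>K3\<bar>) * t (a, m, b)"
    if abm: "(a, m, b) \<in> tri_pts A M B k" for a m b
  proof -
    have n0: "0 \<le> nrm (dual A k) a" "0 \<le> nrm (dual M k) m" "0 \<le> nrm (dual B k) b"
      using abm pn by (auto simp: tri_pts_def pre_normed_def)
    have "K1 * nrm (dual A k) a \<le> \<bar>K1\<bar> * t (a, m, b)"
      "K2 * nrm (dual M k) m \<le> \<bar>K2\<bar> * t (a, m, b)" "K3 * nrm (dual B k) b \<le> \<bar>K3\<bar> * t (a, m, b)"
      using le[OF abm] n0 by (auto intro!: mult_mono)
    moreover have "cmod (f a) \<le> K1 * nrm (dual A k) a" "cmod (g m) \<le> K2 * nrm (dual M k) m"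
      "cmod (h b) \<le> K3 * nrm (dual B k) b" using K abm by (auto simp: tri_pts_def)
    moreover have "cmod (f a + g m + h b) \<le> cmod (f a) + cmod (g m) + cmod (h b)"
      by (meson add_mono norm_triangle_ineq norm_triangle_le order_refl)
    ultimately show ?thesis by (simp add: algebra_simps)
  qed
  then have "\<exists>K. \<forall>x\<in>tri_pts A M B k. cmod ((\<lambda>(a, m, b). f a + g m + h b) x) \<le> K * t x"
    by (intro exI[of _ "\<bar>K1\<bar> + \<bar>K2\<bar> + \<bar>K3\<bar>"]) auto
  moreover have "additive_on (tri_pts A M B k) (\<lambda>(a, m, b). f a + g m + h b)"
    "\<forall>c. \<forall>x\<in>tri_pts A M B k. (\<lambda>(a, m, b). f a + g m + h b) (c *\<^sub>C x) =
      c * (\<lambda>(a, m, b). f a + g m + h b) x" using f g h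
    by (auto simp: bounded_functional_def additive_on_def tri_pts_def scaleC_prod_def algebra_simps)
  ultimately show ?thesis by (simp add: bounded_functional_def)
qed

lemma dual_tower_Tri:
  fixes A :: "('r, 'a::complex_vector) aalg" and B :: "('r, 'b::complex_vector) aalg"
    and M :: "('r, 'a, 'b, 'm::complex_vector) abmod"
  assumes bs: "banach_space (dual A 0)" "banach_space (dual M 0)" "banach_space (dual B 0)"
    and dt: "dual_tower N A" "dual_tower N M" "dual_tower N B"
  shows "dual_tower N (Tri A M B)"
proof -
  let ?T = "tri_nspace A M B" and ?p = "tri_pairing A M B"
  note pnA = pre_normed_tower[OF bs(1) dt(1)]
  note pnM = pre_normed_tower[OF bs(2) dt(2)]
  note pnB = pre_normed_tower[OF bs(3) dt(3)]
  have dA: "is_dual (dual A k) (dual A (Suc k)) (pairing A k)"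
   and dM: "is_dual (dual M k) (dual M (Suc k)) (pairing M k)"
   and dB: "is_dual (dual B k) (dual B (Suc k)) (pairing B k)" if "k < N" for k
    using dt that by (auto simp: dual_tower_def)
  have bf: "bounded_functional (?T k) (?p k (f, g, h))"
    if fgh: "(f, g, h) \<in> tri_pts A M B (Suc k)" and k: "k < N"
      and ih: "\<And>a m b. (a, m, b) \<in> tri_pts A M B k \<Longrightarrow>
        nrm (dual A k) a \<le> nrm (?T k) (a, m, b) \<and> nrm (dual M k) m \<le> nrm (?T k) (a, m, b) \<and>
        nrm (dual B k) b \<le> nrm (?T k) (a, m, b)" for f g h k
  proof -
    have "bounded_functional \<lparr>pts = tri_pts A M B k, nrm = nrm (?T k)\<rparr>
      (\<lambda>(a, m, b). pairing A k f a + pairing M k g m + pairing B k h b)"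
      using dA[OF k] dM[OF k] dB[OF k] fgh k ih pnA[of k] pnM[of k] pnB[of k]
      by (intro bounded_functional_tri) (auto simp: is_dual_def tri_pts_def)
    moreover have "\<lparr>pts = tri_pts A M B k, nrm = nrm (?T k)\<rparr> = ?T k"
      by (simp add: pts_tri_nspace[symmetric])
    ultimately show ?thesis by (simp add: tri_pairing_def)
  qed
  have est: "nrm (dual A k) a \<le> nrm (?T k) (a, m, b) \<and> nrm (dual M k) m \<le> nrm (?T k) (a, m, b) \<and>
      nrm (dual B k) b \<le> nrm (?T k) (a, m, b) \<and>
      nrm (?T k) (a, m, b) \<le> nrm (dual A k) a + nrm (dual M k) m + nrm (dual B k) b"
    if "(a, m, b) \<in> tri_pts A M B k" "k \<le> N" for k a m b
    using that
  proof (induction k arbitrary: a m b)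
    case 0
    then show ?case using pnA[of 0] pnM[of 0] pnB[of 0]
      by (auto simp: tri_pts_def pre_normed_def)
  next
    case (Suc k)
    then have k: "k < N" by simp
    have ih: "nrm (dual A k) x \<le> nrm (?T k) (x, y, z)" "nrm (dual M k) y \<le> nrm (?T k) (x, y, z)"
      "nrm (dual B k) z \<le> nrm (?T k) (x, y, z)"
      "nrm (?T k) (x, y, z) \<le> nrm (dual A k) x + nrm (dual M k) y + nrm (dual B k) z"
      if "x \<in> dpts A k" "y \<in> dpts M k" "z \<in> dpts B k" for x y z
      using Suc.IH[of x y z] that k by (auto simp: tri_pts_def)
    have pn: "pre_normed (dual A k)" "pre_normed (dual M k)" "pre_normed (dual B k)"
      using pnA pnM pnB k by auto
    have z0: "0 \<in> dpts A k" "0 \<in> dpts M k" "0 \<in> dpts B k"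
      "nrm (dual A k) 0 = 0" "nrm (dual M k) 0 = 0" "nrm (dual B k) 0 = 0"
      using pn by (auto simp: pre_normed_def cvec.subspace_0)
    have nn: "0 \<le> nrm (dual A k) x" if "x \<in> dpts A k" for x using pn that by (auto simp: pre_normed_def)
    have F: "bounded_functional (?T k) (?p k (a, m, b))"
      using bf[OF Suc.prems(1) k] Suc.IH k by auto
    have pT: "pre_normed (?T k)"
    proof -
      have "csubspace (pts (?T k))"
        using pn unfolding pts_tri_nspace tri_pts_def pre_normed_def
        by (auto simp: cvec.subspace_def scaleC_prod_def zero_prod_def)
      moreover have "nrm (?T k) 0 = 0" using ih[of 0 0 0] z0 by (auto simp: zero_prod_def)
      moreover have "0 \<le> nrm (?T k) x" if "x \<in> pts (?T k)" for x
        using that ih(1) nn by (cases x) (force simp: pts_tri_nspace tri_pts_def)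
      ultimately show ?thesis by (simp add: pre_normed_def)
    qed
    have bA: "bounded_functional (dual A k) (pairing A k a)" "nrm (dual A (Suc k)) a = dual_norm (dual A k) (pairing A k a)"
     and bM: "bounded_functional (dual M k) (pairing M k m)" "nrm (dual M (Suc k)) m = dual_norm (dual M k) (pairing M k m)"
     and bB: "bounded_functional (dual B k) (pairing B k b)" "nrm (dual B (Suc k)) b = dual_norm (dual B k) (pairing B k b)"
      using dA[OF k] dM[OF k] dB[OF k] Suc.prems by (auto simp: is_dual_def tri_pts_def)
    have lin0: "f 0 = 0" if "bounded_functional X f" "0 \<in> pts X" for X :: "'x::complex_vector nspace" and f
      using that by (auto simp: bounded_functional_def dest!: spec[of _ 0] bspec[of _ _ 0])
    note p0 = lin0[OF bA(1) z0(1)] lin0[OF bM(1) z0(2)] lin0[OF bB(1) z0(3)]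
    note TU = dual_norm_props(2)[OF pT F]
    have "nrm (dual A (Suc k)) a \<le> nrm (?T (Suc k)) (a, m, b)"
      unfolding bA(2) tri_nspace.simps nspace.simps
    proof (rule dual_norm_props(4)[OF pn(1) bA(1)])
      fix x assume x: "x \<in> dpts A k" "nrm (dual A k) x \<le> 1"
      have "cmod (?p k (a, m, b) (x, 0, 0)) \<le> dual_norm (?T k) (?p k (a, m, b))"
        using ih(4)[of x 0 0] x z0 by (intro TU) (auto simp: pts_tri_nspace tri_pts_def)
      then show "cmod (pairing A k a x) \<le> dual_norm (?T k) (?p k (a, m, b))"
        by (simp add: tri_pairing_def p0)
    qed
    moreover have "nrm (dual M (Suc k)) m \<le> nrm (?T (Suc k)) (a, m, b)"
      unfolding bM(2) tri_nspace.simps nspace.simps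
    proof (rule dual_norm_props(4)[OF pn(2) bM(1)])
      fix x assume x: "x \<in> dpts M k" "nrm (dual M k) x \<le> 1"
      have "cmod (?p k (a, m, b) (0, x, 0)) \<le> dual_norm (?T k) (?p k (a, m, b))"
        using ih(4)[of 0 x 0] x z0 by (intro TU) (auto simp: pts_tri_nspace tri_pts_def)
      then show "cmod (pairing M k m x) \<le> dual_norm (?T k) (?p k (a, m, b))"
        by (simp add: tri_pairing_def p0)
    qed
    moreover have "nrm (dual B (Suc k)) b \<le> nrm (?T (Suc k)) (a, m, b)"
      unfolding bB(2) tri_nspace.simps nspace.simps
    proof (rule dual_norm_props(4)[OF pn(3) bB(1)])
      fix x assume x: "x \<in> dpts B k" "nrm (dual B k) x \<le> 1"
      have "cmod (?p k (a, m, b) (0, 0, x)) \<le> dual_norm (?T k) (?p k (a, m, b))"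
        using ih(4)[of 0 0 x] x z0 by (intro TU) (auto simp: pts_tri_nspace tri_pts_def)
      then show "cmod (pairing B k b x) \<le> dual_norm (?T k) (?p k (a, m, b))"
        by (simp add: tri_pairing_def p0)
    qed
    moreover have "nrm (?T (Suc k)) (a, m, b) \<le>
        nrm (dual A (Suc k)) a + nrm (dual M (Suc k)) m + nrm (dual B (Suc k)) b"
      unfolding bA(2) bM(2) bB(2) tri_nspace.simps nspace.simps
    proof (rule dual_norm_props(4)[OF pT F])
      fix t assume t: "t \<in> pts (?T k)" "nrm (?T k) t \<le> 1"
      obtain x y z where [simp]: "t = (x, y, z)" by (cases t)
      have xyz: "x \<in> dpts A k" "y \<in> dpts M k" "z \<in> dpts B k"
        using t by (auto simp: pts_tri_nspace tri_pts_def)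
      have "cmod (pairing A k a x) \<le> dual_norm (dual A k) (pairing A k a)"
        "cmod (pairing M k m y) \<le> dual_norm (dual M k) (pairing M k m)"
        "cmod (pairing B k b z) \<le> dual_norm (dual B k) (pairing B k b)"
        using ih(1-3)[OF xyz] t xyz
        by (auto intro!: dual_norm_props(2)[OF pn(1) bA(1)] dual_norm_props(2)[OF pn(2) bM(1)]
            dual_norm_props(2)[OF pn(3) bB(1)])
      moreover have "cmod (?p k (a, m, b) t) \<le>
          cmod (pairing A k a x) + cmod (pairing M k m y) + cmod (pairing B k b z)"
        unfolding tri_pairing_def
        by simp (meson add_mono norm_triangle_ineq norm_triangle_le order_refl)
      ultimately show "cmod (?p k (a, m, b) t) \<le> dual_norm (dual A k) (pairing A k a) +
          dual_norm (dual M k) (pairing M k m) + dual_norm (dual B k) (pairing B k b)" by linarith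
    qed
    ultimately show ?case by blast
  qed
  have "is_dual (?T k) (?T (Suc k)) (?p k)" if k: "k < N" for k
    unfolding is_dual_def
  proof (intro conjI ballI allI impI)
    have pn: "pre_normed (dual A k)" "pre_normed (dual M k)" "pre_normed (dual B k)"
      using pnA pnM pnB k by auto
    have z0: "0 \<in> dpts A k" "0 \<in> dpts M k" "0 \<in> dpts B k"
      "nrm (dual A k) 0 = 0" "nrm (dual M k) 0 = 0" "nrm (dual B k) 0 = 0"
      using pn by (auto simp: pre_normed_def cvec.subspace_0)
    show "csubspace (pts (?T (Suc k)))"
      using dA[OF k] dM[OF k] dB[OF k] unfolding pts_tri_nspace tri_pts_def is_dual_def
      by (auto simp: cvec.subspace_def scaleC_prod_def zero_prod_def)
    show "bounded_functional (?T k) (?p k y)" if "y \<in> pts (?T (Suc k))" for y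
      using that bf k est by (cases y) (auto simp: pts_tri_nspace)
    show "additive_on (pts (?T (Suc k))) (\<lambda>y. ?p k y x)" if "x \<in> pts (?T k)" for x
      using that dA[OF k] dM[OF k] dB[OF k] unfolding pts_tri_nspace tri_pts_def is_dual_def
      by (auto simp: additive_on_def tri_pairing_def algebra_simps)
    show "?p k (c *\<^sub>C y) x = c * ?p k y x" if "y \<in> pts (?T (Suc k))" "x \<in> pts (?T k)" for c y x
      using that dA[OF k] dM[OF k] dB[OF k] unfolding pts_tri_nspace tri_pts_def is_dual_def
      by (auto simp: tri_pairing_def scaleC_prod_def algebra_simps)
    show "nrm (?T (Suc k)) y = dual_norm (?T k) (?p k y)" for y by simp
    fix F assume F: "bounded_functional (?T k) F"
    obtain K where K: "\<And>x. x \<in> tri_pts A M B k \<Longrightarrow> cmod (F x) \<le> K * nrm (?T k) x"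
      using F by (auto simp: bounded_functional_def pts_tri_nspace)
    have K': "cmod (F (x, y, z)) \<le> \<bar>K\<bar> * (nrm (dual A k) x + nrm (dual M k) y + nrm (dual B k) z)"
      if "x \<in> dpts A k" "y \<in> dpts M k" "z \<in> dpts B k" for x y z
    proof -
      have t: "(x, y, z) \<in> tri_pts A M B k" using that by (simp add: tri_pts_def)
      have e: "nrm (dual A k) x \<le> nrm (?T k) (x, y, z)"
        "nrm (?T k) (x, y, z) \<le> nrm (dual A k) x + nrm (dual M k) y + nrm (dual B k) z"
        using est[OF t] k by auto
      have "0 \<le> nrm (dual A k) x" using pn that by (auto simp: pre_normed_def)
      then have "K * nrm (?T k) (x, y, z) \<le>
          \<bar>K\<bar> * (nrm (dual A k) x + nrm (dual M k) y + nrm (dual B k) z)"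
        using e by (intro mult_mono) auto
      then show ?thesis using K[OF t] by linarith
    qed
    have Fadd: "F (x + y) = F x + F y" if "x \<in> tri_pts A M B k" "y \<in> tri_pts A M B k" for x y
      using F that by (auto simp: bounded_functional_def additive_on_def pts_tri_nspace)
    have Fsc: "F (c *\<^sub>C x) = c * F x" if "x \<in> tri_pts A M B k" for c x
      using F that by (auto simp: bounded_functional_def pts_tri_nspace)
    have t1: "(x, 0, 0) \<in> tri_pts A M B k" if "x \<in> dpts A k" for x using that z0 by (simp add: tri_pts_def)
    have t2: "(0, y, 0) \<in> tri_pts A M B k" if "y \<in> dpts M k" for y using that z0 by (simp add: tri_pts_def)
    have t3: "(0, 0, z) \<in> tri_pts A M B k" if "z \<in> dpts B k" for z using that z0 by (simp add: tri_pts_def)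
    have "bounded_functional (dual A k) (\<lambda>x. F (x, 0, 0))"
      unfolding bounded_functional_def additive_on_def
      using K'[where y = 0 and z = 0] z0 Fadd[OF t1 t1] Fsc[OF t1]
      by (auto simp: scaleC_prod_def intro!: exI[of _ "\<bar>K\<bar>"])
    moreover have "bounded_functional (dual M k) (\<lambda>x. F (0, x, 0))"
      unfolding bounded_functional_def additive_on_def
      using K'[where x = 0 and z = 0] z0 Fadd[OF t2 t2] Fsc[OF t2]
      by (auto simp: scaleC_prod_def intro!: exI[of _ "\<bar>K\<bar>"])
    moreover have "bounded_functional (dual B k) (\<lambda>x. F (0, 0, x))"
      unfolding bounded_functional_def additive_on_def
      using K'[where x = 0 and y = 0] z0 Fadd[OF t3 t3] Fsc[OF t3]
      by (auto simp: scaleC_prod_def intro!: exI[of _ "\<bar>K\<bar>"])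
    ultimately have ex: "\<exists>!f. f \<in> dpts A (Suc k) \<and> (\<forall>x\<in>dpts A k. pairing A k f x = F (x, 0, 0))"
        "\<exists>!g. g \<in> dpts M (Suc k) \<and> (\<forall>x\<in>dpts M k. pairing M k g x = F (0, x, 0))"
        "\<exists>!h. h \<in> dpts B (Suc k) \<and> (\<forall>x\<in>dpts B k. pairing B k h x = F (0, 0, x))"
      using dA[OF k] dM[OF k] dB[OF k] unfolding is_dual_def by simp_all
    then obtain f g h where fgh: "f \<in> dpts A (Suc k)" "g \<in> dpts M (Suc k)" "h \<in> dpts B (Suc k)"
      "\<And>x. x \<in> dpts A k \<Longrightarrow> pairing A k f x = F (x, 0, 0)"
      "\<And>x. x \<in> dpts M k \<Longrightarrow> pairing M k g x = F (0, x, 0)"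
      "\<And>x. x \<in> dpts B k \<Longrightarrow> pairing B k h x = F (0, 0, x)" by blast
    have zp: "pairing A k f' 0 = 0" if "f' \<in> dpts A (Suc k)" for f'
    proof -
      have "pairing A k f' (0 *\<^sub>C 0) = 0 * pairing A k f' 0"
        using dA[OF k] that z0(1) unfolding is_dual_def bounded_functional_def by blast
      then show ?thesis by simp
    qed
    have zq: "pairing M k f' 0 = 0" if "f' \<in> dpts M (Suc k)" for f'
    proof -
      have "pairing M k f' (0 *\<^sub>C 0) = 0 * pairing M k f' 0"
        using dM[OF k] that z0(2) unfolding is_dual_def bounded_functional_def by blast
      then show ?thesis by simp
    qed
    have zr: "pairing B k f' 0 = 0" if "f' \<in> dpts B (Suc k)" for f'
    proof -
      have "pairing B k f' (0 *\<^sub>C 0) = 0 * pairing B k f' 0"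
        using dB[OF k] that z0(3) unfolding is_dual_def bounded_functional_def by blast
      then show ?thesis by simp
    qed
    show "\<exists>!y. y \<in> pts (?T (Suc k)) \<and> (\<forall>x\<in>pts (?T k). ?p k y x = F x)"
    proof (rule ex1I[of _ "(f, g, h)"])
      have "F (x, y, z) = F (x, 0, 0) + F (0, y, 0) + F (0, 0, z)"
        if "x \<in> dpts A k" "y \<in> dpts M k" "z \<in> dpts B k" for x y z
      proof -
        have "(x, y, 0) \<in> tri_pts A M B k" using that z0 by (simp add: tri_pts_def)
        then show ?thesis
          using Fadd[OF t1[OF that(1)] t2[OF that(2)]] Fadd[OF _ t3[OF that(3)], of "(x, y, 0)"] by simp
      qed
      then show "(f, g, h) \<in> pts (?T (Suc k)) \<and> (\<forall>x\<in>pts (?T k). ?p k (f, g, h) x = F x)"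
        using fgh by (auto simp: pts_tri_nspace tri_pts_def tri_pairing_def)
    next
      fix y assume y: "y \<in> pts (?T (Suc k)) \<and> (\<forall>x\<in>pts (?T k). ?p k y x = F x)"
      obtain f' g' h' where [simp]: "y = (f', g', h')" by (cases y)
      have m: "f' \<in> dpts A (Suc k)" "g' \<in> dpts M (Suc k)" "h' \<in> dpts B (Suc k)"
        using y by (auto simp: pts_tri_nspace tri_pts_def)
      have e: "?p k (f', g', h') x = F x" if "x \<in> tri_pts A M B k" for x
        using y that by (simp add: pts_tri_nspace)
      have "f' = f" using ex(1) fgh m e[OF t1] zq zr by (auto simp: tri_pairing_def)
      moreover have "g' = g" using ex(2) fgh m e[OF t2] zp zr by (auto simp: tri_pairing_def)
      moreover have "h' = h" using ex(3) fgh m e[OF t3] zp zq by (auto simp: tri_pairing_def)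
      ultimately show "y = (f, g, h)" by simp
    qed
  qed
  then show ?thesis by (simp add: dual_tower_def Tri_def)
qed


section \<open>Module homomorphisms and central Rosenblum operators\<close>

text \<open>\<open>dual_lprod A M k \<lambda> m\<close> is \<open>\<lambda> m\<close>, for \<open>\<lambda>\<close> in the \<open>2k\<close>-th dual of \<open>A\<close> and \<open>m\<close> in \<open>M\<close>; it lies in the
  \<open>2k\<close>-th dual of \<open>M\<close>. The inner \<open>dual_elt\<close> is the element \<open>m \<phi>\<close>, given by
  \<open>\<langle>m \<phi>, \<lambda>'\<rangle> = \<langle>\<phi>, \<lambda>' m\<rangle>\<close>, and \<open>\<langle>\<lambda> m, \<phi>\<rangle> = \<langle>\<lambda>, m \<phi>\<rangle>\<close>. Similarly for \<open>m \<mu>\<close> and \<open>\<phi> m\<close>.\<close>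

primrec dual_lprod ::
    "('r, 'a) aalg \<Rightarrow> ('r, 'a, 'b, 'm) abmod \<Rightarrow> nat \<Rightarrow> 'a \<Rightarrow> 'm \<Rightarrow> 'm" where
  "dual_lprod A M 0 = lmod M"
| "dual_lprod A M (Suc k) = (\<lambda>l m. dual_elt M (2 * k + 1) (\<lambda>\<phi>.
     pairing A (2 * k + 1) l
       (dual_elt A (2 * k) (\<lambda>l'. pairing M (2 * k) \<phi> (dual_lprod A M k l' m)))))"

primrec dual_rprod ::
    "('r, 'b) aalg \<Rightarrow> ('r, 'a, 'b, 'm) abmod \<Rightarrow> nat \<Rightarrow> 'm \<Rightarrow> 'b \<Rightarrow> 'm" where
  "dual_rprod B M 0 = rmod M"
| "dual_rprod B M (Suc k) = (\<lambda>m u. dual_elt M (2 * k + 1) (\<lambda>\<phi>.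
     pairing B (2 * k + 1) u
       (dual_elt B (2 * k) (\<lambda>u'. pairing M (2 * k) \<phi> (dual_rprod B M k m u')))))"

definition dual_centre :: "('r, 'x) aalg \<Rightarrow> nat \<Rightarrow> 'x set" where
  "dual_centre X n =
     {F \<in> dpts X (2 * n). \<forall>a\<in>carr X. dual_right X n (mul X) F a = dual_left X n (mul X) a F}"

definition rosenblum ::
    "('r, 'a) aalg \<Rightarrow> ('r, 'b) aalg \<Rightarrow> ('r, 'a, 'b, 'm::complex_vector) abmod
      \<Rightarrow> nat \<Rightarrow> 'a \<Rightarrow> 'b \<Rightarrow> 'm \<Rightarrow> 'm" where
  "rosenblum A B M n x z =
     (\<lambda>m. if m \<in> carr M then dual_lprod A M n x m - dual_rprod B M n m z else 0)"

definition ZR ::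
    "('r, 'a) aalg \<Rightarrow> ('r, 'b) aalg \<Rightarrow> ('r, 'a, 'b, 'm::complex_vector) abmod
      \<Rightarrow> nat \<Rightarrow> ('m \<Rightarrow> 'm) set" where
  "ZR A B M n = {rosenblum A B M n x z | x z. x \<in> dual_centre A n \<and> z \<in> dual_centre B n}"

definition Hom ::
    "'r nspace \<Rightarrow> ('r, 'a) aalg \<Rightarrow> ('r, 'b) aalg \<Rightarrow> ('r, 'a, 'b, 'm::complex_vector) abmod
      \<Rightarrow> nat \<Rightarrow> ('m \<Rightarrow> 'm) set" where
  "Hom R A B M n = {\<phi>.
     (\<forall>m\<in>carr M. \<phi> m \<in> dpts M (2 * n)) \<and>
     additive_on (carr M) \<phi> \<and>
     (\<forall>m\<in>carr M. \<forall>e>0. \<exists>d>0. \<forall>m'\<in>carr M.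
        nrm (dual M 0) (m' - m) < d \<longrightarrow> nrm (dual M (2 * n)) (\<phi> m' - \<phi> m) < e) \<and>
     (\<forall>m\<in>carr M.
        (\<forall>a\<in>carr A. \<phi> (lmod M a m) = dual_left M n (lmod M) a (\<phi> m)) \<and>
        (\<forall>b\<in>carr B. \<phi> (rmod M m b) = dual_right M n (rmod M) (\<phi> m) b) \<and>
        (\<forall>\<alpha>\<in>pts R. \<phi> (lact M \<alpha> m) = dual_left M n (lact M) \<alpha> (\<phi> m) \<and>
                   \<phi> (ract M m \<alpha>) = dual_right M n (ract M) (\<phi> m) \<alpha>)) \<and>
     vanishes_off (carr M) \<phi>}"

text \<open>The map from corner matrices to corner matrices induced by a map on the corner entry.\<close>

definition corner_map :: "('m \<Rightarrow> 'm) \<Rightarrow> 'a::zero \<times> 'm::zero \<times> 'b::zero \<Rightarrow> 'a \<times> 'm \<times> 'b" where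
  "corner_map \<phi> = (\<lambda>(a, m, b). if a = 0 \<and> b = 0 then (0, \<phi> m, 0) else (0, 0, 0))"

definition Hom_mat ::
    "'r nspace \<Rightarrow> ('r, 'a::complex_vector) aalg \<Rightarrow> ('r, 'b::complex_vector) aalg
      \<Rightarrow> ('r, 'a, 'b, 'm::complex_vector) abmod \<Rightarrow> nat \<Rightarrow> ('a \<times> 'm \<times> 'b \<Rightarrow> 'a \<times> 'm \<times> 'b) set" where
  "Hom_mat R A B M n = corner_map ` Hom R A B M n"

definition ZR_mat ::
    "('r, 'a::complex_vector) aalg \<Rightarrow> ('r, 'b::complex_vector) aalg
      \<Rightarrow> ('r, 'a, 'b, 'm::complex_vector) abmod \<Rightarrow> nat \<Rightarrow> ('a \<times> 'm \<times> 'b \<Rightarrow> 'a \<times> 'm \<times> 'b) set" where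
  "ZR_mat A B M n = corner_map ` ZR A B M n"

definition Delta ::
    "('r, 'a::complex_vector) aalg \<Rightarrow> ('r, 'b::complex_vector) aalg
      \<Rightarrow> ('r, 'a, 'b, 'm::complex_vector) abmod
      \<Rightarrow> ('a \<times> 'm \<times> 'b \<Rightarrow> 'a \<times> 'm \<times> 'b) \<Rightarrow> 'a \<times> 'm \<times> 'b \<Rightarrow> 'a \<times> 'm \<times> 'b" where
  "Delta A B M \<Omega> = (\<lambda>(a, m, b). if (a, m, b) \<in> carr (Tri A M B) then \<Omega> (0, m, 0) else 0)"


section \<open>Quotient vector spaces\<close>

definition quotient_space :: "'v::ab_group_add set \<Rightarrow> 'v set \<Rightarrow> 'v set set" where
  "quotient_space V U = (\<lambda>v. v +o U) ` V"

text \<open>\<open>V / U\<close> and \<open>W / K\<close> are well-formed and isomorphic as complex vector spaces. Cosets are added as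
  sets; the scalar multiple of a coset \<open>C\<close> of \<open>U\<close> is \<open>c C + U\<close>, where the summand \<open>U\<close> is needed
  only for \<open>c = 0\<close>.\<close>

definition quotients_isomorphic ::
    "'v::complex_vector set \<Rightarrow> 'v set \<Rightarrow> 'w::complex_vector set \<Rightarrow> 'w set \<Rightarrow> bool" where
  "quotients_isomorphic V U W K \<longleftrightarrow>
     csubspace V \<and> csubspace U \<and> U \<subseteq> V \<and> csubspace W \<and> csubspace K \<and> K \<subseteq> W \<and>
     (\<exists>\<Phi>. bij_betw \<Phi> (quotient_space V U) (quotient_space W K) \<and>
        (\<forall>C\<in>quotient_space V U. \<forall>D\<in>quotient_space V U. \<Phi> (C + D) = \<Phi> C + \<Phi> D) \<and>
        (\<forall>c. \<forall>C\<in>quotient_space V U. \<Phi> (scaleC c ` C + U) = scaleC c ` \<Phi> C + K))"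

end

theory Submission
  imports Defs
begin

text \<open>Taking the \<open>2n\<close>-fold adjoint is an additive functor on bounded operators between the bottom
  spaces of two towers of duals. Every dual action and every mixed product \<open>\<lambda> m\<close>, \<open>m \<mu>\<close> is such an
  adjoint, so each law they satisfy is the image of a law in the algebras and the module, and an
  operator on the triangular algebra is computed entrywise. For a derivation \<open>D\<close>, the Leibniz rule at
  the diagonal idempotents gives \<open>D (a, m, b) = (d\<^sub>A a, a \<gamma> + d\<^sub>M m - \<gamma> b, d\<^sub>B b)\<close>. If the derivations
  \<open>d\<^sub>A\<close> and \<open>d\<^sub>B\<close> are induced by \<open>x\<close> and \<open>z\<close>, then subtracting the inner derivation of \<open>(x, \<gamma>, z)\<close>
  leaves the corner map \<open>d\<^sub>M m + x m - m z\<close>, which is a module homomorphism. A corner map \<open>\<phi>\<close> is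
  induced by some \<open>(x, \<gamma>, z)\<close> exactly when \<open>x\<close>, \<open>z\<close> are central and \<open>\<phi>\<close> is the operator of \<open>-x\<close>, \<open>-z\<close>.\<close>

section \<open>Seminormed spaces, duals and adjoints\<close>

text \<open>Two obstacles shape the development. An element of an iterated dual is given by a
  definite description, so equations there are not found by unfolding; they rest on membership
  together with equality of all pairings. And module derivations and homomorphisms are additive but
  need not be complex linear, so adjoints are not formed for them. Only complex linear operators are
  dualised, namely products and actions with one factor fixed; a derivation is used through the
  Leibniz rule at elements of the algebra. The isomorphism of the last part comes from one linear
  map, \<open>Delta\<close>, from homomorphisms to derivations: it is onto modulo inner derivations,
  and it sends exactly the central Rosenblum operators to inner ones. The signs in \<open>-x\<close>
  and \<open>-z\<close> come from opposite conventions: an inner derivation is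
  \<open>a F - F a\<close>, a Rosenblum operator is \<open>x m - m z\<close>. The properties in
  \<open>seminormed\<close> are chosen because they pass from a space to its dual by estimates on
  the pairing alone.\<close>

definition seminormed :: "'x::complex_vector nspace \<Rightarrow> bool" where
  "seminormed X \<longleftrightarrow>
     csubspace (pts X) \<and> (\<forall>x\<in>pts X. 0 \<le> nrm X x) \<and>
     (\<forall>x\<in>pts X. \<forall>y\<in>pts X. nrm X (x + y) \<le> nrm X x + nrm X y) \<and>
     (\<forall>c. \<forall>x\<in>pts X. nrm X (c *\<^sub>C x) = cmod c * nrm X x)"

lemma seminormedD:
  assumes "seminormed X"
  shows "csubspace (pts X)" and "0 \<in> pts X" and "nrm X 0 = 0"
    and "x \<in> pts X \<Longrightarrow> 0 \<le> nrm X x"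
    and "x \<in> pts X \<Longrightarrow> y \<in> pts X \<Longrightarrow> x + y \<in> pts X"
    and "x \<in> pts X \<Longrightarrow> y \<in> pts X \<Longrightarrow> x - y \<in> pts X"
    and "x \<in> pts X \<Longrightarrow> - x \<in> pts X"
    and "x \<in> pts X \<Longrightarrow> c *\<^sub>C x \<in> pts X"
    and "x \<in> pts X \<Longrightarrow> y \<in> pts X \<Longrightarrow> nrm X (x + y) \<le> nrm X x + nrm X y"
    and "x \<in> pts X \<Longrightarrow> nrm X (c *\<^sub>C x) = cmod c * nrm X x"
    and "x \<in> pts X \<Longrightarrow> y \<in> pts X \<Longrightarrow> nrm X (x - y) \<le> nrm X x + nrm X y"
proof -
  show S: "csubspace (pts X)" using assms by (simp add: seminormed_def)
  show Z: "0 \<in> pts X" using S by (rule cvec.subspace_0)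
  show sc: "x \<in> pts X \<Longrightarrow> nrm X (c *\<^sub>C x) = cmod c * nrm X x" for x c
    using assms by (simp add: seminormed_def)
  show "nrm X 0 = 0" using sc[OF Z, of 0] by simp
  show "x \<in> pts X \<Longrightarrow> 0 \<le> nrm X x" using assms by (simp add: seminormed_def)
  show "x \<in> pts X \<Longrightarrow> y \<in> pts X \<Longrightarrow> x + y \<in> pts X" using S by (rule cvec.subspace_add)
  show "x \<in> pts X \<Longrightarrow> y \<in> pts X \<Longrightarrow> x - y \<in> pts X" using S by (rule cvec.subspace_diff)
  show N: "x \<in> pts X \<Longrightarrow> - x \<in> pts X" for x using S by (rule cvec.subspace_neg)
  show "x \<in> pts X \<Longrightarrow> c *\<^sub>C x \<in> pts X" using S by (rule cvec.subspace_scale)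
  show tri: "x \<in> pts X \<Longrightarrow> y \<in> pts X \<Longrightarrow> nrm X (x + y) \<le> nrm X x + nrm X y" for x y
    using assms by (simp add: seminormed_def)
  have "- y = (-1) *\<^sub>C y" for y :: 'a by simp
  then show "x \<in> pts X \<Longrightarrow> y \<in> pts X \<Longrightarrow> nrm X (x - y) \<le> nrm X x + nrm X y"
    using tri[of x "- y"] N[of y] sc[of y "-1"] by simp
qed

lemma seminormed_pre_normed: "seminormed X \<Longrightarrow> pre_normed X"
  by (auto simp: pre_normed_def dest: seminormedD)

lemma banach_space_seminormed: "banach_space X \<Longrightarrow> seminormed X"
  by (simp add: banach_space_def seminormed_def)

lemma is_dualD:
  assumes "is_dual X Y p"
  shows "csubspace (pts Y)"
    and "y \<in> pts Y \<Longrightarrow> bounded_functional X (p y)"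
    and "y \<in> pts Y \<Longrightarrow> x \<in> pts X \<Longrightarrow> x' \<in> pts X \<Longrightarrow> p y (x + x') = p y x + p y x'"
    and "y \<in> pts Y \<Longrightarrow> x \<in> pts X \<Longrightarrow> p y (c *\<^sub>C x) = c * p y x"
    and "y \<in> pts Y \<Longrightarrow> y' \<in> pts Y \<Longrightarrow> x \<in> pts X \<Longrightarrow> p (y + y') x = p y x + p y' x"
    and "y \<in> pts Y \<Longrightarrow> x \<in> pts X \<Longrightarrow> p (c *\<^sub>C y) x = c * p y x"
    and "y \<in> pts Y \<Longrightarrow> nrm Y y = dual_norm X (p y)"
    and "bounded_functional X f \<Longrightarrow> \<exists>!y. y \<in> pts Y \<and> (\<forall>x\<in>pts X. p y x = f x)"
  using assms by (simp_all add: is_dual_def bounded_functional_def additive_on_def)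

lemma is_dual_eqI:
  assumes "is_dual X Y p" "y \<in> pts Y" "y' \<in> pts Y" "\<And>x. x \<in> pts X \<Longrightarrow> p y x = p y' x"
  shows "y = y'"
  using is_dualD(8)[OF assms(1) is_dualD(2)[OF assms(1,3)]] assms(2-) by blast

text \<open>Scaling x to norm 1 reduces the estimate to the supremum that defines
  \<open>dual_norm\<close>. A point of seminorm 0 cannot be scaled; there the bound that y has as a
  functional already forces the value 0.\<close>

lemma pairing_le:
  assumes X: "seminormed X" and d: "is_dual X Y p" and y: "y \<in> pts Y" and x: "x \<in> pts X"
  shows "cmod (p y x) \<le> nrm Y y * nrm X x"
proof (cases "nrm X x = 0")
  case True
  obtain K where "\<forall>x\<in>pts X. cmod (p y x) \<le> K * nrm X x"
    using is_dualD(2)[OF d y] by (auto simp: bounded_functional_def)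
  then have "cmod (p y x) \<le> K * nrm X x" using x by blast
  then show ?thesis using True by simp
next
  case False
  let ?t = "nrm X x"
  have t: "0 < ?t" using False seminormedD(4)[OF X x] by simp
  let ?c = "complex_of_real (1 / ?t)"
  have c: "cmod ?c = 1 / ?t" using t by (simp add: norm_divide)
  have "cmod (p y (?c *\<^sub>C x)) \<le> nrm Y y"
    unfolding is_dualD(7)[OF d y]
    using seminormedD(8,10)[OF X x, of ?c] c t
    by (intro dual_norm_props(2)[OF seminormed_pre_normed[OF X] is_dualD(2)[OF d y]]) auto
  then have "cmod ?c * cmod (p y x) \<le> nrm Y y"
    by (simp only: is_dualD(4)[OF d y x] norm_mult)
  then show ?thesis using t unfolding c by (simp add: field_simps)
qed

lemma dual_nrm_le:
  assumes X: "seminormed X" and d: "is_dual X Y p" and y: "y \<in> pts Y"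
    and le: "\<And>x. x \<in> pts X \<Longrightarrow> cmod (p y x) \<le> K * nrm X x" and K: "0 \<le> K"
  shows "nrm Y y \<le> K"
  unfolding is_dualD(7)[OF d y]
proof (rule dual_norm_props(4)[OF seminormed_pre_normed[OF X] is_dualD(2)[OF d y]])
  fix x assume x: "x \<in> pts X" "nrm X x \<le> 1"
  show "cmod (p y x) \<le> K" using le[OF x(1)] mult_left_le[OF x(2) K] by linarith
qed

lemma seminormed_dual:
  assumes X: "seminormed X" and d: "is_dual X Y p"
  shows "seminormed Y"
proof -
  note sub = is_dualD(1)[OF d]
  have nn: "0 \<le> nrm Y y" if "y \<in> pts Y" for y
    using dual_norm_props(3)[OF seminormed_pre_normed[OF X] is_dualD(2)[OF d that]]
    by (simp add: is_dualD(7)[OF d that])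
  have tri: "nrm Y (y + z) \<le> nrm Y y + nrm Y z" if "y \<in> pts Y" "z \<in> pts Y" for y z
  proof (rule dual_nrm_le[OF X d])
    fix x assume x: "x \<in> pts X"
    have "cmod (p (y + z) x) \<le> cmod (p y x) + cmod (p z x)"
      using is_dualD(5)[OF d that x] norm_triangle_ineq by simp
    then show "cmod (p (y + z) x) \<le> (nrm Y y + nrm Y z) * nrm X x"
      using pairing_le[OF X d that(1) x] pairing_le[OF X d that(2) x] by (simp add: algebra_simps)
  qed (use that sub nn in \<open>auto intro: cvec.subspace_add\<close>)
  have le: "nrm Y (c *\<^sub>C y) \<le> cmod c * nrm Y y" if y: "y \<in> pts Y" for c y
  proof (rule dual_nrm_le[OF X d])
    fix x assume x: "x \<in> pts X"
    show "cmod (p (c *\<^sub>C y) x) \<le> (cmod c * nrm Y y) * nrm X x"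
      using pairing_le[OF X d y x] is_dualD(6)[OF d y x]
      by (simp add: norm_mult mult.assoc mult_left_mono)
  qed (use y sub nn in \<open>auto intro: cvec.subspace_scale\<close>)
  have "nrm Y (c *\<^sub>C y) = cmod c * nrm Y y" if y: "y \<in> pts Y" for c y
  proof (cases "c = 0")
    case True
    then show ?thesis using le[OF y, of 0] nn[OF cvec.subspace_0[OF sub]] by simp
  next
    case False
    \<comment> \<open>Pairings give only one inequality; the other is that inequality for the scalar
      \<open>inverse c\<close> and the point c y.\<close>
    have "nrm Y (inverse c *\<^sub>C c *\<^sub>C y) \<le> cmod (inverse c) * nrm Y (c *\<^sub>C y)"
      using y sub by (intro le cvec.subspace_scale)
    then have "nrm Y y \<le> cmod (inverse c) * nrm Y (c *\<^sub>C y)" using False by simp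
    then have "cmod c * nrm Y y \<le> nrm Y (c *\<^sub>C y)"
      using False by (simp add: norm_inverse norm_divide field_simps)
    then show ?thesis using le[OF y, of c] by simp
  qed
  then show ?thesis using sub nn tri by (simp add: seminormed_def)
qed

text \<open>The bound K is a parameter, not hidden in an existential: the adjoint inherits it
  unchanged, and later proofs need it both as the constant 1 (entries of a matrix) and in its
  dependence on m (the operators \<open>a \<mapsto> a m\<close>).\<close>

definition bounded_op ::
    "'x::complex_vector nspace \<Rightarrow> 'y::complex_vector nspace \<Rightarrow> real \<Rightarrow> ('x \<Rightarrow> 'y) \<Rightarrow> bool" where
  "bounded_op X Y K T \<longleftrightarrow>
     (\<forall>x\<in>pts X. T x \<in> pts Y) \<and> additive_on (pts X) T \<and>
     (\<forall>c. \<forall>x\<in>pts X. T (c *\<^sub>C x) = c *\<^sub>C T x) \<and>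
     0 \<le> K \<and> (\<forall>x\<in>pts X. nrm Y (T x) \<le> K * nrm X x)"

lemma bounded_opD:
  assumes "bounded_op X Y K T"
  shows "x \<in> pts X \<Longrightarrow> T x \<in> pts Y"
    and "x \<in> pts X \<Longrightarrow> x' \<in> pts X \<Longrightarrow> T (x + x') = T x + T x'"
    and "x \<in> pts X \<Longrightarrow> T (c *\<^sub>C x) = c *\<^sub>C T x"
    and "0 \<le> K"
    and "x \<in> pts X \<Longrightarrow> nrm Y (T x) \<le> K * nrm X x"
  using assms by (simp_all add: bounded_op_def additive_on_def)

lemma bounded_op_linear:
  assumes T: "bounded_op X Y K T" and X: "seminormed X"
  shows "T 0 = 0"
    and "x \<in> pts X \<Longrightarrow> T (- x) = - T x"
    and "x \<in> pts X \<Longrightarrow> x' \<in> pts X \<Longrightarrow> T (x - x') = T x - T x'"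
proof -
  have neg: "- y = (-1) *\<^sub>C y" for y :: "'z::complex_vector" by simp
  show "T 0 = 0" using bounded_opD(3)[OF T seminormedD(2)[OF X], of 0] by simp
  show N: "x \<in> pts X \<Longrightarrow> T (- x) = - T x" for x
    using bounded_opD(3)[OF T, of x "-1"] by simp
  show "x \<in> pts X \<Longrightarrow> x' \<in> pts X \<Longrightarrow> T (x - x') = T x - T x'"
    using bounded_opD(2)[OF T, of x "- x'"] N seminormedD(7)[OF X] by simp
qed

lemma bounded_op_id: "seminormed X \<Longrightarrow> bounded_op X X 1 (\<lambda>x. x)"
  by (simp add: bounded_op_def additive_on_def)

section \<open>Towers of duals and the adjoints between them\<close>

definition normed_tower :: "nat \<Rightarrow> ('x::complex_vector, 'z) dspace_scheme \<Rightarrow> bool" where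
  "normed_tower N X \<longleftrightarrow> seminormed (dual X 0) \<and> dual_tower N X"

lemma normed_tower_is_dual:
  "normed_tower N X \<Longrightarrow> k < N \<Longrightarrow> is_dual (dual X k) (dual X (Suc k)) (pairing X k)"
  by (simp add: normed_tower_def dual_tower_def)

lemma normed_tower_seminormed:
  assumes "normed_tower N X" "k \<le> N"
  shows "seminormed (dual X k)"
  using assms(2)
proof (induction k)
  case 0
  then show ?case using assms(1) by (simp add: normed_tower_def)
next
  case (Suc k)
  then show ?case using seminormed_dual normed_tower_is_dual[OF assms(1), of k] by auto
qed

text \<open>Unlike \<open>dual_op\<close>, which stays within one tower, this allows two:
  \<open>a \<mapsto> a m\<close> leads from A to M, and taking entries leads from the triangular
  algebra to A, M and B.\<close>

definition adjoint ::
    "('x, 'u) dspace_scheme \<Rightarrow> ('y, 'v) dspace_scheme \<Rightarrow> nat \<Rightarrow> ('x \<Rightarrow> 'y) \<Rightarrow> 'y \<Rightarrow> 'x" where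
  "adjoint X Y k T f = dual_elt X k (\<lambda>x. pairing Y k f (T x))"

context
  fixes N :: nat and X :: "('x::complex_vector, 'u) dspace_scheme"
    and Y :: "('y::complex_vector, 'v) dspace_scheme" and k :: nat
  assumes X: "normed_tower N X" and Y: "normed_tower N Y" and k: "k < N"
begin

text \<open>The functional that pairs f with T x is bounded by the norm of f times K, so exactly one
  point of the dual represents it, and the definite description in \<open>dual_elt\<close> denotes
  that point.\<close>

lemma adjoint_in_pairing:
  assumes T: "bounded_op (dual X k) (dual Y k) K T" and f: "f \<in> dpts Y (Suc k)"
  shows "adjoint X Y k T f \<in> dpts X (Suc k)"
    and "x \<in> dpts X k \<Longrightarrow> pairing X k (adjoint X Y k T f) x = pairing Y k f (T x)"
proof -
  note dX = normed_tower_is_dual[OF X k] and dY = normed_tower_is_dual[OF Y k]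
  note sX = normed_tower_seminormed[OF X] and sY = normed_tower_seminormed[OF Y]
  have nf: "0 \<le> nrm (dual Y (Suc k)) f" using sY[of "Suc k"] f k seminormedD(4) by auto
  have "cmod (pairing Y k f (T x)) \<le> (nrm (dual Y (Suc k)) f * K) * nrm (dual X k) x"
    if x: "x \<in> dpts X k" for x
  proof -
    have "cmod (pairing Y k f (T x)) \<le> nrm (dual Y (Suc k)) f * nrm (dual Y k) (T x)"
      using pairing_le[OF sY[of k] dY f bounded_opD(1)[OF T x]] k by simp
    also have "\<dots> \<le> nrm (dual Y (Suc k)) f * (K * nrm (dual X k) x)"
      using bounded_opD(5)[OF T x] nf by (rule mult_left_mono)
    finally show ?thesis by (simp add: mult.assoc)
  qed
  then have "bounded_functional (dual X k) (\<lambda>x. pairing Y k f (T x))"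
    unfolding bounded_functional_def additive_on_def
    using bounded_opD(1,2,3)[OF T] is_dualD(3,4)[OF dY f] by auto
  from theI'[OF is_dualD(8)[OF dX this]]
  show "adjoint X Y k T f \<in> dpts X (Suc k)"
    and "x \<in> dpts X k \<Longrightarrow> pairing X k (adjoint X Y k T f) x = pairing Y k f (T x)"
    by (auto simp: adjoint_def dual_elt_def)
qed

text \<open>Points of a dual with equal pairings coincide. The identities for iterated adjoints
  below reduce to this rule, once for each of the two adjoints in an induction step.\<close>

lemma adjoint_eqI:
  assumes T: "bounded_op (dual X k) (dual Y k) K T" and f: "f \<in> dpts Y (Suc k)"
    and g: "g \<in> dpts X (Suc k)"
    and eq: "\<And>x. x \<in> dpts X k \<Longrightarrow> pairing Y k f (T x) = pairing X k g x"
  shows "adjoint X Y k T f = g"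
  by (rule is_dual_eqI[OF normed_tower_is_dual[OF X k] adjoint_in_pairing(1)[OF T f] g])
    (simp add: adjoint_in_pairing(2)[OF T f] eq)

lemma bounded_op_adjoint:
  assumes T: "bounded_op (dual X k) (dual Y k) K T"
  shows "bounded_op (dual Y (Suc k)) (dual X (Suc k)) K (adjoint X Y k T)"
proof -
  note dX = normed_tower_is_dual[OF X k] and dY = normed_tower_is_dual[OF Y k]
  note sX = normed_tower_seminormed[OF X] and sY = normed_tower_seminormed[OF Y]
  note i = adjoint_in_pairing[OF T]
  have sX': "seminormed (dual X (Suc k))" and sY': "seminormed (dual Y (Suc k))"
    using sX sY k by auto
  have "adjoint X Y k T (f + g) = adjoint X Y k T f + adjoint X Y k T g"
    if "f \<in> dpts Y (Suc k)" "g \<in> dpts Y (Suc k)" for f g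
    by (rule adjoint_eqI[OF T])
      (use that i seminormedD(5)[OF sX'] seminormedD(5)[OF sY'] is_dualD(5)[OF dX]
        is_dualD(5)[OF dY] bounded_opD(1)[OF T] in auto)
  moreover have "adjoint X Y k T (c *\<^sub>C f) = c *\<^sub>C adjoint X Y k T f"
    if "f \<in> dpts Y (Suc k)" for c f
    by (rule adjoint_eqI[OF T])
      (use that i seminormedD(8)[OF sX'] seminormedD(8)[OF sY'] is_dualD(6)[OF dX]
        is_dualD(6)[OF dY] bounded_opD(1)[OF T] in auto)
  moreover have "nrm (dual X (Suc k)) (adjoint X Y k T f) \<le> K * nrm (dual Y (Suc k)) f"
    if f: "f \<in> dpts Y (Suc k)" for f
  proof (rule dual_nrm_le[OF sX dX])
    have nf: "0 \<le> nrm (dual Y (Suc k)) f" using seminormedD(4)[OF sY' f] .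
    then show "0 \<le> K * nrm (dual Y (Suc k)) f" using bounded_opD(4)[OF T] by simp
    fix x assume x: "x \<in> dpts X k"
    have "cmod (pairing Y k f (T x)) \<le> nrm (dual Y (Suc k)) f * nrm (dual Y k) (T x)"
      using pairing_le[OF sY[of k] dY f bounded_opD(1)[OF T x]] k by simp
    also have "\<dots> \<le> nrm (dual Y (Suc k)) f * (K * nrm (dual X k) x)"
      using bounded_opD(5)[OF T x] nf by (rule mult_left_mono)
    finally show "cmod (pairing X k (adjoint X Y k T f) x)
        \<le> K * nrm (dual Y (Suc k)) f * nrm (dual X k) x"
      by (simp add: i(2)[OF f x] mult_ac)
  qed (use k i f in auto)
  ultimately show ?thesis
    using i bounded_opD(4)[OF T] by (simp add: bounded_op_def additive_on_def)
qed

lemma adjoint_cong: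
  assumes T: "bounded_op (dual X k) (dual Y k) K T" and S: "bounded_op (dual X k) (dual Y k) L S"
    and eq: "\<And>x. x \<in> dpts X k \<Longrightarrow> T x = S x" and f: "f \<in> dpts Y (Suc k)"
  shows "adjoint X Y k T f = adjoint X Y k S f"
  using adjoint_in_pairing[OF S f] eq by (intro adjoint_eqI[OF T f]) auto

end


section \<open>Even iterated adjoints\<close>

text \<open>One adjoint reverses the direction of an operator, two restore it. Taking them in pairs
  gives an operator from the 2k-th dual of X to that of Y.\<close>

primrec even_adjoint ::
    "('x, 'u) dspace_scheme \<Rightarrow> ('y, 'v) dspace_scheme \<Rightarrow> nat \<Rightarrow> ('x \<Rightarrow> 'y) \<Rightarrow> 'x \<Rightarrow> 'y" where
  "even_adjoint X Y 0 T = T"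
| "even_adjoint X Y (Suc k) T =
     adjoint Y X (Suc (2 * k)) (adjoint X Y (2 * k) (even_adjoint X Y k T))"

lemma dual_op_even_adjoint: "dual_op X (2 * k) T = even_adjoint X X k T"
  by (induction k) (simp_all add: adjoint_def fun_eq_iff)

lemma dual_left_even_adjoint: "dual_left X n l s F = even_adjoint X X n (l s) F"
  by (simp add: dual_left_def dual_op_even_adjoint)

lemma dual_right_even_adjoint: "dual_right X n r F s = even_adjoint X X n (\<lambda>x. r x s) F"
  by (simp add: dual_right_def dual_op_even_adjoint)

text \<open>The element \<open>m \<phi>\<close> is the adjoint of
  \<open>\<lambda>' \<mapsto> \<lambda>' m\<close> at \<open>\<phi>\<close>, and pairing with it is
  the second adjoint. So the mixed products obey the same calculus as the dual actions, with A as
  source and M as target.\<close>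

lemma dual_lprod_even_adjoint: "dual_lprod A M k l m = even_adjoint A M k (\<lambda>a. lmod M a m) l"
  by (induction k arbitrary: l) (simp_all add: adjoint_def fun_eq_iff)

lemma dual_rprod_even_adjoint: "dual_rprod B M k m u = even_adjoint B M k (rmod M m) u"
  by (induction k arbitrary: u) (simp_all add: adjoint_def fun_eq_iff)

context
  fixes N :: nat and X :: "('x::complex_vector, 'u) dspace_scheme"
    and Y :: "('y::complex_vector, 'v) dspace_scheme"
  assumes X: "normed_tower N X" and Y: "normed_tower N Y"
begin

lemma bounded_op_even_adjoint:
  assumes T: "bounded_op (dual X 0) (dual Y 0) K T" and "2 * k \<le> N"
  shows "bounded_op (dual X (2 * k)) (dual Y (2 * k)) K (even_adjoint X Y k T)"
  using assms(2)
proof (induction k)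
  case (Suc k)
  then have "bounded_op (dual X (2 * k)) (dual Y (2 * k)) K (even_adjoint X Y k T)" by simp
  from bounded_op_adjoint[OF Y X _ bounded_op_adjoint[OF X Y _ this]] Suc.prems
  show ?case by simp
qed (simp add: T)

lemma even_adjoint_cong:
  assumes T: "bounded_op (dual X 0) (dual Y 0) K T" and S: "bounded_op (dual X 0) (dual Y 0) L S"
    and eq: "\<And>x. x \<in> carr X \<Longrightarrow> T x = S x" and "2 * k \<le> N" "F \<in> dpts X (2 * k)"
  shows "even_adjoint X Y k T F = even_adjoint X Y k S F"
  using assms(4,5)
proof (induction k arbitrary: F)
  case (Suc k)
  then have k: "2 * k < N" "Suc (2 * k) < N" by auto
  note T' = bounded_op_even_adjoint[OF T less_imp_le[OF k(1)]]
  note S' = bounded_op_even_adjoint[OF S less_imp_le[OF k(1)]]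
  have "adjoint X Y (2 * k) (even_adjoint X Y k T) f = adjoint X Y (2 * k) (even_adjoint X Y k S) f"
    if "f \<in> dpts Y (Suc (2 * k))" for f
    using adjoint_cong[OF X Y k(1) T' S' Suc.IH that] k by simp
  then show ?case
    using adjoint_cong[OF Y X k(2) bounded_op_adjoint[OF X Y k(1) T']
        bounded_op_adjoint[OF X Y k(1) S']] Suc.prems by simp
qed (simp add: eq)

text \<open>The sum is a third operator U, since the laws of a module make it equal to T + S on the
  carrier only, not as a function on the whole type.\<close>

lemma even_adjoint_add:
  assumes T: "bounded_op (dual X 0) (dual Y 0) K T" and S: "bounded_op (dual X 0) (dual Y 0) L S"
    and U: "bounded_op (dual X 0) (dual Y 0) J U"
    and eq: "\<And>x. x \<in> carr X \<Longrightarrow> U x = T x + S x" and "2 * k \<le> N" "F \<in> dpts X (2 * k)"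
  shows "even_adjoint X Y k U F = even_adjoint X Y k T F + even_adjoint X Y k S F"
  using assms(5,6)
proof (induction k arbitrary: F)
  case (Suc k)
  then have k: "2 * k < N" "Suc (2 * k) < N" and F: "F \<in> dpts X (Suc (Suc (2 * k)))" by auto
  note s = normed_tower_seminormed[OF X] normed_tower_seminormed[OF Y]
  note T' = bounded_op_even_adjoint[OF T less_imp_le[OF k(1)]]
  note S' = bounded_op_even_adjoint[OF S less_imp_le[OF k(1)]]
  note U' = bounded_op_even_adjoint[OF U less_imp_le[OF k(1)]]
  note T2 = bounded_op_adjoint[OF X Y k(1) T'] and S2 = bounded_op_adjoint[OF X Y k(1) S']
    and U2 = bounded_op_adjoint[OF X Y k(1) U']
  note iT = adjoint_in_pairing[OF X Y k(1) T'] and iS = adjoint_in_pairing[OF X Y k(1) S']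
  note dX = normed_tower_is_dual[OF X k(1)] normed_tower_is_dual[OF X k(2)]
    and dY = normed_tower_is_dual[OF Y k(1)] normed_tower_is_dual[OF Y k(2)]
  have e: "adjoint X Y (2 * k) (even_adjoint X Y k U) f = adjoint X Y (2 * k) (even_adjoint X Y k T) f
      + adjoint X Y (2 * k) (even_adjoint X Y k S) f"
    if f: "f \<in> dpts Y (Suc (2 * k))" for f
  proof (rule adjoint_eqI[OF X Y k(1) U' f])
    show "adjoint X Y (2 * k) (even_adjoint X Y k T) f + adjoint X Y (2 * k) (even_adjoint X Y k S) f
        \<in> dpts X (Suc (2 * k))" using iT(1)[OF f] iS(1)[OF f] is_dualD(1)[OF dX(1)] by (simp add: cvec.subspace_add)
    fix x assume x: "x \<in> dpts X (2 * k)"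
    show "pairing Y (2 * k) f (even_adjoint X Y k U x) = pairing X (2 * k)
        (adjoint X Y (2 * k) (even_adjoint X Y k T) f + adjoint X Y (2 * k) (even_adjoint X Y k S) f) x"
      using Suc.IH[OF _ x] k x f
      by (simp add: is_dualD(5)[OF dX(1)] iT iS is_dualD(3)[OF dY(1)]
          bounded_opD(1)[OF T'] bounded_opD(1)[OF S'])
  qed
  have "adjoint Y X (Suc (2 * k)) (adjoint X Y (2 * k) (even_adjoint X Y k U)) F =
      adjoint Y X (Suc (2 * k)) (adjoint X Y (2 * k) (even_adjoint X Y k T)) F +
      adjoint Y X (Suc (2 * k)) (adjoint X Y (2 * k) (even_adjoint X Y k S)) F"
    using adjoint_in_pairing[OF Y X k(2) T2 F] adjoint_in_pairing[OF Y X k(2) S2 F]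
      is_dualD(1)[OF dY(2)]
    by (intro adjoint_eqI[OF Y X k(2) U2 F])
      (auto simp: e F cvec.subspace_add is_dualD(5)[OF dY(2)] is_dualD(3)[OF dX(2)]
        bounded_opD(1)[OF T2] bounded_opD(1)[OF S2])
  then show ?case by simp
qed (simp add: eq)

end

lemma even_adjoint_id:
  assumes X: "normed_tower N X" and "2 * k \<le> N" "F \<in> dpts X (2 * k)"
  shows "even_adjoint X X k (\<lambda>x. x) F = F"
  using assms(2,3)
proof (induction k arbitrary: F)
  case (Suc k)
  then have k: "2 * k < N" "Suc (2 * k) < N" and F: "F \<in> dpts X (Suc (Suc (2 * k)))" by auto
  have I: "bounded_op (dual X 0) (dual X 0) 1 (\<lambda>x. x)"
    using bounded_op_id normed_tower_seminormed[OF X] by auto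
  note I' = bounded_op_even_adjoint[OF X X I less_imp_le[OF k(1)]]
  have "adjoint X X (2 * k) (even_adjoint X X k (\<lambda>x. x)) f = f" if "f \<in> dpts X (Suc (2 * k))" for f
    using that Suc.IH k by (intro adjoint_eqI[OF X X k(1) I']) auto
  then show ?case
    using F by (auto intro!: adjoint_eqI[OF X X k(2) bounded_op_adjoint[OF X X k(1) I']])
qed simp

text \<open>One adjoint reverses a composite and the next one restores its order, so on even duals
  the construction is a covariant functor. Again U is asked to equal the composite on the carrier
  only.\<close>

lemma even_adjoint_comp:
  assumes X: "normed_tower N X" and Y: "normed_tower N Y" and Z: "normed_tower N Z"
    and T: "bounded_op (dual X 0) (dual Y 0) K T" and S: "bounded_op (dual Y 0) (dual Z 0) L S"
    and U: "bounded_op (dual X 0) (dual Z 0) J U"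
    and eq: "\<And>x. x \<in> carr X \<Longrightarrow> U x = S (T x)" and "2 * k \<le> N" "F \<in> dpts X (2 * k)"
  shows "even_adjoint X Z k U F = even_adjoint Y Z k S (even_adjoint X Y k T F)"
  using assms(8,9)
proof (induction k arbitrary: F)
  case (Suc k)
  then have k: "2 * k < N" "Suc (2 * k) < N" and F: "F \<in> dpts X (Suc (Suc (2 * k)))" by auto
  note T' = bounded_op_even_adjoint[OF X Y T less_imp_le[OF k(1)]]
  note S' = bounded_op_even_adjoint[OF Y Z S less_imp_le[OF k(1)]]
  note U' = bounded_op_even_adjoint[OF X Z U less_imp_le[OF k(1)]]
  note T2 = bounded_op_adjoint[OF X Y k(1) T'] and S2 = bounded_op_adjoint[OF Y Z k(1) S']
    and U2 = bounded_op_adjoint[OF X Z k(1) U']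
  note iT = adjoint_in_pairing[OF X Y k(1) T'] and iS = adjoint_in_pairing[OF Y Z k(1) S']
  have e: "adjoint X Z (2 * k) (even_adjoint X Z k U) f =
      adjoint X Y (2 * k) (even_adjoint X Y k T) (adjoint Y Z (2 * k) (even_adjoint Y Z k S) f)"
    if f: "f \<in> dpts Z (Suc (2 * k))" for f
    using k by (intro adjoint_eqI[OF X Z k(1) U' f])
      (auto simp: Suc.IH iT iS f bounded_opD(1)[OF T'])
  note jT = adjoint_in_pairing[OF Y X k(2) T2] and jS = adjoint_in_pairing[OF Z Y k(2) S2]
  have "adjoint Z X (Suc (2 * k)) (adjoint X Z (2 * k) (even_adjoint X Z k U)) F =
      adjoint Z Y (Suc (2 * k)) (adjoint Y Z (2 * k) (even_adjoint Y Z k S))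
        (adjoint Y X (Suc (2 * k)) (adjoint X Y (2 * k) (even_adjoint X Y k T)) F)"
    by (intro adjoint_eqI[OF Z X k(2) U2 F])
      (auto simp: e jT jS F bounded_opD(1)[OF S2])
  then show ?case by simp
qed (simp add: eq)

text \<open>All levels of a tower share one type, so one formula can act on each of them. If the
  formulas T and S are adjoint to each other at every level, then iterating adjoints only alternates
  between S and T. Typically T reads off an entry of a matrix and S fills the other entries with
  0.\<close>

lemma even_adjoint_adjoint_pair:
  assumes X: "normed_tower N X" and Y: "normed_tower N Y"
    and T: "bounded_op (dual X 0) (dual Y 0) K T"
    and S_in: "\<And>j f. j < N \<Longrightarrow> f \<in> dpts Y (Suc j) \<Longrightarrow> S f \<in> dpts X (Suc j)"
    and T_in: "\<And>j F. j < N \<Longrightarrow> F \<in> dpts X (Suc j) \<Longrightarrow> T F \<in> dpts Y (Suc j)"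
    and ST: "\<And>j f x. j < N \<Longrightarrow> f \<in> dpts Y (Suc j) \<Longrightarrow> x \<in> dpts X j \<Longrightarrow>
      pairing Y j f (T x) = pairing X j (S f) x"
    and TS: "\<And>j F y. j < N \<Longrightarrow> F \<in> dpts X (Suc j) \<Longrightarrow> y \<in> dpts Y j \<Longrightarrow>
      pairing X j F (S y) = pairing Y j (T F) y"
    and "2 * k \<le> N" "F \<in> dpts X (2 * k)"
  shows "even_adjoint X Y k T F = T F"
  using assms(8,9)
proof (induction k arbitrary: F)
  case (Suc k)
  then have k: "2 * k < N" "Suc (2 * k) < N" and F: "F \<in> dpts X (Suc (Suc (2 * k)))" by auto
  note T' = bounded_op_even_adjoint[OF X Y T less_imp_le[OF k(1)]]
  have "adjoint X Y (2 * k) (even_adjoint X Y k T) f = S f" if "f \<in> dpts Y (Suc (2 * k))" for f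
    using that k Suc.IH by (intro adjoint_eqI[OF X Y k(1) T']) (auto simp: S_in ST)
  then show ?case
    using F k T_in TS by (auto intro!: adjoint_eqI[OF Y X k(2) bounded_op_adjoint[OF X Y k(1) T']])
qed simp


section \<open>Operators between bottom spaces of towers\<close>

definition bounded_map ::
    "('x::complex_vector, 'u) dspace_scheme \<Rightarrow> ('y::complex_vector, 'v) dspace_scheme
      \<Rightarrow> ('x \<Rightarrow> 'y) \<Rightarrow> bool" where
  "bounded_map X Y T \<longleftrightarrow> (\<exists>K. bounded_op (dual X 0) (dual Y 0) K T)"

lemma bounded_map_comp:
  assumes "bounded_map X Y T" "bounded_map Y Z S"
  shows "bounded_map X Z (\<lambda>x. S (T x))"
proof -
  obtain K L where T: "bounded_op (dual X 0) (dual Y 0) K T" and S: "bounded_op (dual Y 0) (dual Z 0) L S"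
    using assms by (auto simp: bounded_map_def)
  have "nrm (dual Z 0) (S (T x)) \<le> (L * K) * nrm (dual X 0) x" if x: "x \<in> carr X" for x
    using bounded_opD(5)[OF S bounded_opD(1)[OF T x]] bounded_opD(5)[OF T x]
      mult_left_mono[OF _ bounded_opD(4)[OF S]]
    by (smt (verit) mult.assoc)
  then have "bounded_op (dual X 0) (dual Z 0) (L * K) (\<lambda>x. S (T x))"
    using bounded_opD(1-4)[OF T] bounded_opD(1-4)[OF S] by (simp add: bounded_op_def additive_on_def)
  then show ?thesis by (auto simp: bounded_map_def)
qed

lemma bounded_map_add:
  assumes "bounded_map X Y T" "bounded_map X Y S" and Y: "seminormed (dual Y 0)"
  shows "bounded_map X Y (\<lambda>x. T x + S x)"
proof -
  obtain K L where T: "bounded_op (dual X 0) (dual Y 0) K T" and S: "bounded_op (dual X 0) (dual Y 0) L S"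
    using assms by (auto simp: bounded_map_def)
  have "nrm (dual Y 0) (T x + S x) \<le> (K + L) * nrm (dual X 0) x" if x: "x \<in> carr X" for x
    using seminormedD(9)[OF Y bounded_opD(1)[OF T x] bounded_opD(1)[OF S x]]
      bounded_opD(5)[OF T x] bounded_opD(5)[OF S x] by (simp add: algebra_simps)
  then have "bounded_op (dual X 0) (dual Y 0) (K + L) (\<lambda>x. T x + S x)"
    using bounded_opD(1-4)[OF T] bounded_opD(1-4)[OF S] seminormedD(5)[OF Y]
    by (simp add: bounded_op_def additive_on_def scaleC_add_right algebra_simps)
  then show ?thesis by (auto simp: bounded_map_def)
qed

lemma bounded_map_zero: "seminormed (dual Y 0) \<Longrightarrow> bounded_map X Y (\<lambda>x. 0)"
  by (auto simp: bounded_map_def bounded_op_def additive_on_def seminormedD intro!: exI[of _ 0])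

lemma bounded_bilinear_opD:
  assumes f: "bounded_bilinear_op X Y Z f" and X: "seminormed X" and Y: "seminormed Y"
  shows "\<exists>K\<ge>0. (\<forall>x\<in>pts X. bounded_op Y Z (K * nrm X x) (f x)) \<and>
    (\<forall>y\<in>pts Y. bounded_op X Z (K * nrm Y y) (\<lambda>x. f x y))"
proof -
  obtain K where K: "\<And>x y. x \<in> pts X \<Longrightarrow> y \<in> pts Y \<Longrightarrow> nrm Z (f x y) \<le> K * nrm X x * nrm Y y"
    using f unfolding bounded_bilinear_op_def by blast
  \<comment> \<open>\<open>bounded_bilinear_op\<close> does not fix the sign of its constant, while
    \<open>bounded_op\<close> asks for a nonnegative one.\<close>
  have le: "nrm Z (f x y) \<le> \<bar>K\<bar> * nrm X x * nrm Y y" if "x \<in> pts X" "y \<in> pts Y" for x y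
  proof -
    have "K * nrm X x * nrm Y y \<le> \<bar>K\<bar> * nrm X x * nrm Y y"
      using that by (intro mult_right_mono) (auto simp: seminormedD(4)[OF X] seminormedD(4)[OF Y])
    then show ?thesis using K[OF that] by linarith
  qed
  have le': "nrm Z (f x y) \<le> \<bar>K\<bar> * nrm Y y * nrm X x" if "x \<in> pts X" "y \<in> pts Y" for x y
    using le[OF that] by (simp add: mult_ac)
  show ?thesis
    using f le le' seminormedD(4)[OF X] seminormedD(4)[OF Y]
    by (intro exI[of _ "\<bar>K\<bar>"]) (simp add: bounded_bilinear_op_def bounded_op_def additive_on_def)
qed

context
  fixes n :: nat and X :: "('x::complex_vector, 'u) dspace_scheme"
    and Y :: "('y::complex_vector, 'v) dspace_scheme"
  assumes X: "normed_tower (2 * n) X" and Y: "normed_tower (2 * n) Y"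
begin

lemma even_adjoint_linear:
  assumes T: "bounded_map X Y T"
  shows "F \<in> dpts X (2 * n) \<Longrightarrow> even_adjoint X Y n T F \<in> dpts Y (2 * n)"
    and "F \<in> dpts X (2 * n) \<Longrightarrow> G \<in> dpts X (2 * n) \<Longrightarrow>
      even_adjoint X Y n T (F + G) = even_adjoint X Y n T F + even_adjoint X Y n T G"
    and "F \<in> dpts X (2 * n) \<Longrightarrow> even_adjoint X Y n T (c *\<^sub>C F) = c *\<^sub>C even_adjoint X Y n T F"
    and "even_adjoint X Y n T 0 = 0"
    and "F \<in> dpts X (2 * n) \<Longrightarrow> even_adjoint X Y n T (- F) = - even_adjoint X Y n T F"
    and "F \<in> dpts X (2 * n) \<Longrightarrow> G \<in> dpts X (2 * n) \<Longrightarrow>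
      even_adjoint X Y n T (F - G) = even_adjoint X Y n T F - even_adjoint X Y n T G"
    and "\<exists>K. \<forall>F\<in>dpts X (2 * n). nrm (dual Y (2 * n)) (even_adjoint X Y n T F) \<le> K * nrm (dual X (2 * n)) F"
proof -
  obtain K where "bounded_op (dual X 0) (dual Y 0) K T" using T by (auto simp: bounded_map_def)
  note T' = bounded_op_even_adjoint[OF X Y this order_refl]
  note s = normed_tower_seminormed[OF X order_refl]
  show "F \<in> dpts X (2 * n) \<Longrightarrow> even_adjoint X Y n T F \<in> dpts Y (2 * n)"
    by (rule bounded_opD(1)[OF T'])
  show "F \<in> dpts X (2 * n) \<Longrightarrow> G \<in> dpts X (2 * n) \<Longrightarrow>
      even_adjoint X Y n T (F + G) = even_adjoint X Y n T F + even_adjoint X Y n T G"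
    by (rule bounded_opD(2)[OF T'])
  show "F \<in> dpts X (2 * n) \<Longrightarrow> even_adjoint X Y n T (c *\<^sub>C F) = c *\<^sub>C even_adjoint X Y n T F"
    by (rule bounded_opD(3)[OF T'])
  show "even_adjoint X Y n T 0 = 0"
    by (rule bounded_op_linear(1)[OF T' s])
  show "F \<in> dpts X (2 * n) \<Longrightarrow> even_adjoint X Y n T (- F) = - even_adjoint X Y n T F"
    by (rule bounded_op_linear(2)[OF T' s])
  show "F \<in> dpts X (2 * n) \<Longrightarrow> G \<in> dpts X (2 * n) \<Longrightarrow>
      even_adjoint X Y n T (F - G) = even_adjoint X Y n T F - even_adjoint X Y n T G"
    by (rule bounded_op_linear(3)[OF T' s])
  show "\<exists>K. \<forall>F\<in>dpts X (2 * n). nrm (dual Y (2 * n)) (even_adjoint X Y n T F) \<le> K * nrm (dual X (2 * n)) F"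
    using bounded_opD(5)[OF T'] by (intro exI[of _ K] ballI)
qed

lemma even_adjoint_sum:
  assumes "bounded_map X Y T" "bounded_map X Y S" "bounded_map X Y U"
    and "\<And>x. x \<in> carr X \<Longrightarrow> U x = T x + S x" and "F \<in> dpts X (2 * n)"
  shows "even_adjoint X Y n U F = even_adjoint X Y n T F + even_adjoint X Y n S F"
  using assms(1-3) unfolding bounded_map_def
  by (elim exE) (rule even_adjoint_add[OF X Y _ _ _ assms(4) order_refl assms(5)]; assumption)

lemma even_adjoint_congruence:
  assumes "bounded_map X Y T" "bounded_map X Y S"
    and "\<And>x. x \<in> carr X \<Longrightarrow> T x = S x" and "F \<in> dpts X (2 * n)"
  shows "even_adjoint X Y n T F = even_adjoint X Y n S F"
  using assms(1,2) unfolding bounded_map_def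
  by (elim exE) (rule even_adjoint_cong[OF X Y _ _ assms(3) order_refl assms(4)]; assumption)

text \<open>On the carrier T agrees with T + T, so the value V at F satisfies V = V + V.\<close>

lemma even_adjoint_eq_0:
  assumes "bounded_map X Y T" "\<And>x. x \<in> carr X \<Longrightarrow> T x = 0" "F \<in> dpts X (2 * n)"
  shows "even_adjoint X Y n T F = 0"
  using even_adjoint_sum[OF assms(1) assms(1) assms(1) _ assms(3)] assms(2) by simp

end

lemma even_adjoint_compose:
  assumes X: "normed_tower (2 * n) X" and Y: "normed_tower (2 * n) Y" and Z: "normed_tower (2 * n) Z"
    and "bounded_map X Y T" "bounded_map Y Z S" "bounded_map X Z U"
    and "\<And>x. x \<in> carr X \<Longrightarrow> U x = S (T x)" and "F \<in> dpts X (2 * n)"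
  shows "even_adjoint X Z n U F = even_adjoint Y Z n S (even_adjoint X Y n T F)"
  using assms(4-6) unfolding bounded_map_def
  by (elim exE) (rule even_adjoint_comp[where S = S and T = T and U = U, OF X Y Z _ _ _ assms(7) order_refl assms(8)]; assumption)

text \<open>A square that commutes on the carrier of X still commutes on the 2n-th duals. The middle
  spaces may differ: read as an identity in a, the law (c a) m = c (a m) has one path through A and
  one through M.\<close>

lemma even_adjoint_compose2:
  assumes X: "normed_tower (2 * n) X" and Y: "normed_tower (2 * n) Y"
    and Y': "normed_tower (2 * n) Y'" and Z: "normed_tower (2 * n) Z"
    and T: "bounded_map X Y T" and S: "bounded_map Y Z S"
    and T': "bounded_map X Y' T'" and S': "bounded_map Y' Z S'"
    and eq: "\<And>x. x \<in> carr X \<Longrightarrow> S (T x) = S' (T' x)" and F: "F \<in> dpts X (2 * n)"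
  shows "even_adjoint Y Z n S (even_adjoint X Y n T F) =
    even_adjoint Y' Z n S' (even_adjoint X Y' n T' F)"
  using even_adjoint_compose[OF X Y Z T S bounded_map_comp[OF T S] _ F]
    even_adjoint_compose[OF X Y' Z T' S' bounded_map_comp[OF T S] _ F] eq by simp

lemma even_adjoint_eq_id:
  assumes X: "normed_tower (2 * n) X" and T: "bounded_map X X T"
    and eq: "\<And>x. x \<in> carr X \<Longrightarrow> T x = x" and F: "F \<in> dpts X (2 * n)"
  shows "even_adjoint X X n T F = F"
proof -
  have "bounded_map X X (\<lambda>x. x)"
    using bounded_op_id[OF normed_tower_seminormed[OF X, of 0]] by (auto simp: bounded_map_def)
  then show ?thesis
    using even_adjoint_congruence[OF X X T _ _ F, of "\<lambda>x. x"] eq even_adjoint_id[OF X order_refl F] by simp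
qed


section \<open>Derivations and inner derivations form subspaces\<close>

lemma bounded_add:
  assumes Y: "seminormed Y" and f: "\<And>x. x \<in> S \<Longrightarrow> f x \<in> pts Y" and g: "\<And>x. x \<in> S \<Longrightarrow> g x \<in> pts Y"
    and "\<exists>K. \<forall>x\<in>S. nrm Y (f x) \<le> K * p x" "\<exists>K. \<forall>x\<in>S. nrm Y (g x) \<le> K * p x"
  shows "\<exists>K. \<forall>x\<in>S. nrm Y (f x + g x) \<le> K * (p x :: real)"
proof -
  obtain K L where K: "\<And>x. x \<in> S \<Longrightarrow> nrm Y (f x) \<le> K * p x" and L: "\<And>x. x \<in> S \<Longrightarrow> nrm Y (g x) \<le> L * p x"
    using assms by blast
  have "nrm Y (f x + g x) \<le> (K + L) * p x" if "x \<in> S" for x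
    using seminormedD(9)[OF Y f[OF that] g[OF that]] K[OF that] L[OF that]
    by (simp add: algebra_simps)
  then show ?thesis by blast
qed

lemma bounded_scale:
  assumes Y: "seminormed Y" and f: "\<And>x. x \<in> S \<Longrightarrow> f x \<in> pts Y"
    and "\<exists>K. \<forall>x\<in>S. nrm Y (f x) \<le> K * p x"
  shows "\<exists>K. \<forall>x\<in>S. nrm Y (c *\<^sub>C f x) \<le> K * (p x :: real)"
proof -
  obtain K where K: "\<And>x. x \<in> S \<Longrightarrow> nrm Y (f x) \<le> K * p x" using assms by blast
  have "nrm Y (c *\<^sub>C f x) \<le> (cmod c * K) * p x" if "x \<in> S" for x
    using seminormedD(10)[OF Y f[OF that]] mult_left_mono[OF K[OF that], of "cmod c"]
    by (simp add: mult.assoc)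
  then show ?thesis by blast
qed

text \<open>Each action by a fixed element is a bounded complex linear operator, so its iterated
  adjoint is linear in the element of the dual. This is what makes sums and multiples of derivations
  derivations again.\<close>

locale bounded_actions =
  fixes S :: "'s set" and X :: "('s, 'x::complex_vector, 'z) aalg_scheme" and n :: nat
  assumes tower: "normed_tower (2 * n) X"
    and lact: "s \<in> S \<Longrightarrow> bounded_map X X (lact X s)"
    and ract: "s \<in> S \<Longrightarrow> bounded_map X X (\<lambda>x. ract X x s)"
    and mul_left: "a \<in> carr X \<Longrightarrow> bounded_map X X (mul X a)"
    and mul_right: "a \<in> carr X \<Longrightarrow> bounded_map X X (\<lambda>x. mul X x a)"
begin

text \<open>Derivations need not be complex linear, yet their complex multiples are derivations: in
  each defining equation the scalar stands on values in the dual, and there the actions are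
  linear.\<close>

lemma csubspace_Z1: "csubspace (Z1 S X n)"
proof -
  note l = even_adjoint_linear[OF tower tower lact] even_adjoint_linear[OF tower tower ract]
    even_adjoint_linear[OF tower tower mul_left] even_adjoint_linear[OF tower tower mul_right]
  note sn = normed_tower_seminormed[OF tower order_refl]
  show ?thesis
    unfolding cvec.subspace_def
  proof (intro conjI ballI allI)
    show "0 \<in> Z1 S X n"
      using seminormedD(2,3)[OF sn] unfolding Z1_def module_derivation_def
      by (auto simp: vanishes_off_def additive_on_def dual_left_even_adjoint dual_right_even_adjoint l
        intro!: exI[of _ 0])
    show "D + D' \<in> Z1 S X n" if D: "D \<in> Z1 S X n" "D' \<in> Z1 S X n" for D D'
    proof -
      have "\<exists>K. \<forall>a\<in>carr X. nrm (dual X (2 * n)) (D a + D' a) \<le> K * nrm (dual X 0) a"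
        by (rule bounded_add[OF sn]) (use D in \<open>auto simp: Z1_def module_derivation_def\<close>)
      then show ?thesis
        using D l seminormedD(5)[OF sn] unfolding Z1_def module_derivation_def
        by (simp add: vanishes_off_def additive_on_def dual_left_even_adjoint dual_right_even_adjoint
            algebra_simps)
    qed
    show "c *\<^sub>C D \<in> Z1 S X n" if D: "D \<in> Z1 S X n" for c D
    proof -
      have "\<exists>K. \<forall>a\<in>carr X. nrm (dual X (2 * n)) (c *\<^sub>C D a) \<le> K * nrm (dual X 0) a"
        by (rule bounded_scale[OF sn]) (use D in \<open>auto simp: Z1_def module_derivation_def\<close>)
      then show ?thesis
        using D l seminormedD(8)[OF sn] unfolding Z1_def module_derivation_def
        by (simp add: scaleC_fun_def vanishes_off_def additive_on_def dual_left_even_adjoint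
            dual_right_even_adjoint scaleC_add_right)
    qed
  qed
qed

lemma csubspace_N1: "csubspace (N1 S X n)"
proof -
  note l = even_adjoint_linear[OF tower tower mul_left] even_adjoint_linear[OF tower tower mul_right]
  note sn = normed_tower_seminormed[OF tower order_refl]
  note z = csubspace_Z1
  show ?thesis
    unfolding cvec.subspace_def
  proof (intro conjI ballI allI)
    show "0 \<in> N1 S X n"
      using seminormedD(2)[OF sn] cvec.subspace_0[OF z] l unfolding N1_def inner_derivation_def
      by (auto simp: dual_left_even_adjoint dual_right_even_adjoint intro!: bexI[of _ 0])
    show "D + D' \<in> N1 S X n" if D: "D \<in> N1 S X n" "D' \<in> N1 S X n" for D D'
    proof -
      obtain F F' where "F \<in> dpts X (2 * n)" "F' \<in> dpts X (2 * n)"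
        "\<forall>a\<in>carr X. D a = dual_left X n (mul X) a F - dual_right X n (mul X) F a"
        "\<forall>a\<in>carr X. D' a = dual_left X n (mul X) a F' - dual_right X n (mul X) F' a"
        using D by (auto simp: N1_def inner_derivation_def)
      then have "inner_derivation X n (D + D')"
        using seminormedD(5)[OF sn] l unfolding inner_derivation_def
        by (intro bexI[of _ "F + F'"]) (simp_all add: dual_left_even_adjoint dual_right_even_adjoint)
      then show ?thesis using D cvec.subspace_add[OF z] by (simp add: N1_def)
    qed
    show "c *\<^sub>C D \<in> N1 S X n" if D: "D \<in> N1 S X n" for c D
    proof -
      obtain F where "F \<in> dpts X (2 * n)"
        "\<forall>a\<in>carr X. D a = dual_left X n (mul X) a F - dual_right X n (mul X) F a"
        using D by (auto simp: N1_def inner_derivation_def)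
      then have "inner_derivation X n (c *\<^sub>C D)"
        using seminormedD(8)[OF sn] l unfolding inner_derivation_def
        by (intro bexI[of _ "c *\<^sub>C F"])
          (simp_all add: scaleC_fun_def dual_left_even_adjoint dual_right_even_adjoint cvec.scale_right_diff_distrib)
      then show ?thesis using D cvec.subspace_scale[OF z] by (simp add: N1_def)
    qed
  qed
qed

end


section \<open>Continuous additive maps are bounded\<close>

lemma additive_on_of_nat:
  assumes S: "csubspace S" and f: "additive_on S f" and x: "x \<in> S"
  shows "f (of_nat k *\<^sub>C x) = of_nat k *\<^sub>C (f x :: 'y::complex_vector)"
proof (induction k)
  case 0
  have "f (0 + 0) = f 0 + f 0" using f cvec.subspace_0[OF S] unfolding additive_on_def by blast
  then show ?case by simp
next
  case (Suc k)
  have "of_nat k *\<^sub>C x \<in> S" using S x by (rule cvec.subspace_scale)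
  then have "f (x + of_nat k *\<^sub>C x) = f x + f (of_nat k *\<^sub>C x)"
    using f x by (auto simp: additive_on_def)
  then show ?case using Suc by (simp add: scaleC_add_left)
qed

text \<open>An additive map commutes with rational multiples. If the bound failed at x, a rational r
  would fit between \<open>nrm X x / d\<close> and \<open>nrm Y (f x)\<close>; then x / r lies in
  the ball of radius d, so its image has norm less than 1, and f x has norm less than r.\<close>

lemma additive_continuous_bounded:
  assumes X: "seminormed X" and Y: "seminormed Y" and f: "additive_on (pts X) f"
    and Yf: "\<And>x. x \<in> pts X \<Longrightarrow> f x \<in> pts Y"
    and d: "0 < d" "\<And>x. x \<in> pts X \<Longrightarrow> nrm X x < d \<Longrightarrow> nrm Y (f x) < 1"
    and x: "x \<in> pts X"
  shows "nrm Y (f x) \<le> 1 / d * nrm X x"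
proof (rule ccontr)
  assume "\<not> ?thesis"
  then have "nrm X x / d < nrm Y (f x)" by simp
  then obtain r where r: "r \<in> \<rat>" "nrm X x / d < r" "r < nrm Y (f x)"
    using Rats_dense_in_real by blast
  have r0: "0 < r" using r(2) d seminormedD(4)[OF X x] by (smt (verit) divide_nonneg_pos)
  obtain q p :: nat where p: "p \<noteq> 0" and "\<bar>r\<bar> = real q / real p"
    using Rats_abs_nat_div_natE[OF r(1)] by metis
  with r0 have qp: "r = real q / real p" by simp
  with r0 have q: "q \<noteq> 0" by (cases "q = 0") auto
  \<comment> \<open>This is x / r with r = q / p, written so that q u = p x involves natural
    multiples only.\<close>
  define u where "u = (of_nat p / of_nat q :: complex) *\<^sub>C x"
  have u: "u \<in> pts X" unfolding u_def by (rule seminormedD(8)[OF X x])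
  have "nrm X u = nrm X x / r"
    unfolding u_def seminormedD(10)[OF X x] using qp by (simp add: norm_divide)
  also have "\<dots> < d" using r r0 d by (simp add: field_simps)
  finally have fu: "nrm Y (f u) < 1" using d(2)[OF u] by simp
  have "(of_nat q :: complex) *\<^sub>C u = of_nat p *\<^sub>C x"
    using q by (simp add: u_def)
  then have "of_nat q *\<^sub>C f u = of_nat p *\<^sub>C f x"
    using additive_on_of_nat[OF seminormedD(1)[OF X] f] u x by metis
  then have "real q * nrm Y (f u) = real p * nrm Y (f x)"
    using seminormedD(10)[OF Y Yf[OF u], of "of_nat q"] seminormedD(10)[OF Y Yf[OF x], of "of_nat p"]
    by simp
  moreover have "real q * nrm Y (f u) < real q" using fu q by simp
  ultimately have "real p * nrm Y (f x) < real q" by simp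
  then show False using r(3) qp p by (simp add: field_simps)
qed


section \<open>Isomorphisms of quotients induced by a linear map\<close>

text \<open>A linear map from W to V that meets every coset of U, and under which exactly K goes
  into U, induces an isomorphism of W / K with V / U. The predicate asks for a map in the opposite
  direction, so the proof builds the inverse.\<close>

lemma quotients_isomorphicI:
  assumes V: "csubspace V" and U: "csubspace U" and UV: "U \<subseteq> V"
    and W: "csubspace W" and K: "csubspace K" and KW: "K \<subseteq> W"
    and add: "\<And>w w'. w \<in> W \<Longrightarrow> w' \<in> W \<Longrightarrow> \<psi> (w + w') = \<psi> w + \<psi> w'"
    and scale: "\<And>c w. w \<in> W \<Longrightarrow> \<psi> (c *\<^sub>C w) = c *\<^sub>C \<psi> w"
    and into: "\<And>w. w \<in> W \<Longrightarrow> \<psi> w \<in> V"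
    and ker: "\<And>w. w \<in> W \<Longrightarrow> \<psi> w \<in> U \<longleftrightarrow> w \<in> K"
    and onto: "\<And>v. v \<in> V \<Longrightarrow> \<exists>w\<in>W. v - \<psi> w \<in> U"
  shows "quotients_isomorphic V U W K"
proof -
  have coset_eq: "a +o H = b +o H \<longleftrightarrow> a - b \<in> H" if H: "csubspace H" for H and a b :: "'c::complex_vector"
  proof
    assume "a +o H = b +o H"
    then have "a \<in> b +o H" using cvec.subspace_0[OF H] by (auto simp: elt_set_plus_def)
    then show "a - b \<in> H" by (simp add: set_minus_plus)
  next
    assume ab: "a - b \<in> H"
    have "x - a \<in> H \<longleftrightarrow> x - b \<in> H" for x
      using cvec.subspace_add[OF H _ ab, of "x - a"] cvec.subspace_diff[OF H _ ab, of "x - b"] by auto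
    then show "a +o H = b +o H" by (auto simp: set_minus_plus[symmetric])
  qed
  have coset_add: "(a +o H) + (b +o H) = (a + b) +o H" if H: "csubspace H" for H and a b :: "'c::complex_vector"
  proof -
    have "H + H = H" using cvec.subspace_0[OF H] cvec.subspace_add[OF H]
      by (force simp: set_plus_def)
    then show ?thesis by (simp add: set_plus_rearrange)
  qed
  have coset_scale: "scaleC c ` (a +o H) + H = (c *\<^sub>C a) +o H" if H: "csubspace H"
    for H c and a :: "'c::complex_vector"
  proof (intro equalityI subsetI)
    fix x assume "x \<in> scaleC c ` (a +o H) + H"
    then obtain h h' where h: "h \<in> H" "h' \<in> H" "x = c *\<^sub>C (a + h) + h'"
      by (auto simp: set_plus_def elt_set_plus_def)
    have "x = c *\<^sub>C a + (c *\<^sub>C h + h')" using h by (simp add: scaleC_add_right add.assoc)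
    then show "x \<in> (c *\<^sub>C a) +o H"
      using cvec.subspace_add[OF H cvec.subspace_scale[OF H h(1)] h(2)] by (auto simp: elt_set_plus_def)
  next
    fix x assume "x \<in> (c *\<^sub>C a) +o H"
    then obtain h where "h \<in> H" "x = c *\<^sub>C (a + 0) + h" by (auto simp: elt_set_plus_def)
    then show "x \<in> scaleC c ` (a +o H) + H"
      using cvec.subspace_0[OF H] by (auto simp: set_plus_def elt_set_plus_def)
  qed
  have diff: "\<psi> (w - w') = \<psi> w - \<psi> w'" if "w \<in> W" "w' \<in> W" for w w'
    using add[OF cvec.subspace_diff[OF W that] that(2)] by simp
  \<comment> \<open>The inverse sends a coset to its preimage in W. This needs no choice of
    representatives, and by the next fact the preimage of v + U is w + K for any w in W with v -
    \<psi> w in U.\<close>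
  define \<Phi> where "\<Phi> C = {w \<in> W. \<psi> w \<in> C}" for C
  have \<Phi>: "\<Phi> (v +o U) = w +o K" if "v \<in> V" and w: "w \<in> W" and vw: "v - \<psi> w \<in> U" for v w
  proof (rule set_eqI)
    fix w'
    have "w' \<in> \<Phi> (v +o U) \<longleftrightarrow> w' \<in> W \<and> \<psi> w' - v \<in> U"
      by (simp add: \<Phi>_def set_minus_plus)
    also have "\<dots> \<longleftrightarrow> w' \<in> W \<and> \<psi> (w' - w) \<in> U"
      using diff[OF _ w] cvec.subspace_add[OF U _ vw, of "\<psi> w' - v"]
        cvec.subspace_diff[OF U _ vw, of "\<psi> w' - \<psi> w"] by auto
    also have "\<dots> \<longleftrightarrow> w' \<in> W \<and> w' - w \<in> K"
      using ker cvec.subspace_diff[OF W _ w] by blast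
    also have "\<dots> \<longleftrightarrow> w' - w \<in> K"
      using cvec.subspace_add[OF W _ w, of "w' - w"] KW by auto
    finally show "w' \<in> \<Phi> (v +o U) \<longleftrightarrow> w' \<in> w +o K" by (simp add: set_minus_plus)
  qed
  \<comment> \<open>The choice need not be linear. For sums and multiples it suffices that
    \<open>\<sigma> v + \<sigma> w\<close> and \<open>c *\<^sub>C \<sigma> v\<close> are admissible
    representatives too.\<close>
  obtain \<sigma> where \<sigma>: "\<And>v. v \<in> V \<Longrightarrow> \<sigma> v \<in> W" "\<And>v. v \<in> V \<Longrightarrow> v - \<psi> (\<sigma> v) \<in> U"
    using onto by metis
  have \<Phi>\<sigma>: "\<Phi> (v +o U) = \<sigma> v +o K" if "v \<in> V" for v using \<Phi>[OF that \<sigma>[OF that]] .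
  have "bij_betw \<Phi> (quotient_space V U) (quotient_space W K)"
    unfolding bij_betw_def
  proof
    show "inj_on \<Phi> (quotient_space V U)"
    proof (rule inj_onI)
      fix C D assume "C \<in> quotient_space V U" "D \<in> quotient_space V U" and eq: "\<Phi> C = \<Phi> D"
      then obtain v w where v: "v \<in> V" "C = v +o U" and w: "w \<in> V" "D = w +o U"
        by (auto simp: quotient_space_def)
      then have "\<sigma> v - \<sigma> w \<in> K" using eq \<Phi>\<sigma> coset_eq[OF K] by simp
      then have "\<psi> (\<sigma> v) - \<psi> (\<sigma> w) \<in> U"
        using ker diff \<sigma>(1) v w cvec.subspace_diff[OF W] by metis
      then have "(v - \<psi> (\<sigma> v)) - (w - \<psi> (\<sigma> w)) + (\<psi> (\<sigma> v) - \<psi> (\<sigma> w)) \<in> U"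
        using \<sigma>(2) v w cvec.subspace_diff[OF U] cvec.subspace_add[OF U] by blast
      then show "C = D" using v w coset_eq[OF U] by (simp add: algebra_simps)
    qed
    show "\<Phi> ` quotient_space V U = quotient_space W K"
    proof (intro equalityI subsetI)
      fix C assume "C \<in> \<Phi> ` quotient_space V U"
      then show "C \<in> quotient_space W K" using \<Phi>\<sigma> \<sigma>(1) by (auto simp: quotient_space_def)
    next
      fix C assume "C \<in> quotient_space W K"
      then obtain w where w: "w \<in> W" "C = w +o K" by (auto simp: quotient_space_def)
      then have "C = \<Phi> (\<psi> w +o U)" using \<Phi>[OF into[OF w(1)] w(1)] cvec.subspace_0[OF U] by simp
      then show "C \<in> \<Phi> ` quotient_space V U" using into[OF w(1)] by (auto simp: quotient_space_def)
    qed
  qed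
  moreover have "\<Phi> (C + D) = \<Phi> C + \<Phi> D" if "C \<in> quotient_space V U" "D \<in> quotient_space V U" for C D
  proof -
    obtain v w where v: "v \<in> V" "C = v +o U" and w: "w \<in> V" "D = w +o U"
      using \<open>C \<in> _\<close> \<open>D \<in> _\<close> by (auto simp: quotient_space_def)
    have "v + w - \<psi> (\<sigma> v + \<sigma> w) = (v - \<psi> (\<sigma> v)) + (w - \<psi> (\<sigma> w))"
      using add \<sigma>(1) v w by (simp add: algebra_simps)
    also have "\<dots> \<in> U" using \<sigma>(2) v w by (intro cvec.subspace_add[OF U]) auto
    finally have "\<Phi> ((v + w) +o U) = (\<sigma> v + \<sigma> w) +o K"
      using \<sigma>(1) v w cvec.subspace_add[OF V] cvec.subspace_add[OF W]
      by (intro \<Phi>) auto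
    then show ?thesis using v w \<Phi>\<sigma> coset_add[OF U] coset_add[OF K] by simp
  qed
  moreover have "\<Phi> (scaleC c ` C + U) = scaleC c ` \<Phi> C + K" if "C \<in> quotient_space V U" for c C
  proof -
    obtain v where v: "v \<in> V" "C = v +o U" using \<open>C \<in> _\<close> by (auto simp: quotient_space_def)
    have "c *\<^sub>C v - \<psi> (c *\<^sub>C \<sigma> v) = c *\<^sub>C (v - \<psi> (\<sigma> v))"
      using scale \<sigma>(1) v by (simp add: cvec.scale_right_diff_distrib)
    also have "\<dots> \<in> U" using \<sigma>(2) v by (intro cvec.subspace_scale[OF U]) auto
    finally have "\<Phi> ((c *\<^sub>C v) +o U) = (c *\<^sub>C \<sigma> v) +o K"
      using \<sigma>(1) v cvec.subspace_scale[OF V] cvec.subspace_scale[OF W]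
      by (intro \<Phi>) auto
    then show ?thesis using v \<Phi>\<sigma> coset_scale[OF U] coset_scale[OF K] by simp
  qed
  ultimately show ?thesis
    unfolding quotients_isomorphic_def using assms(1-6) by blast
qed

section \<open>Triangular matrices\<close>

lemma is_dual_zero:
  assumes "is_dual X Y p" "seminormed X"
  shows "y \<in> pts Y \<Longrightarrow> p y 0 = 0" and "x \<in> pts X \<Longrightarrow> p 0 x = 0"
  using is_dualD(4)[OF assms(1), of y 0 0] is_dualD(6)[OF assms(1), of 0 x 0]
    cvec.subspace_0[OF is_dualD(1)[OF assms(1)]] seminormedD(2)[OF assms(2)] by simp_all

lemma Tri_sel [simp]:
  "dpts (Tri A M B) k = dpts A k \<times> dpts M k \<times> dpts B k"
  "nrm (dual (Tri A M B) 0) (a, m, b) = nrm (dual A 0) a + nrm (dual M 0) m + nrm (dual B 0) b"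
  "pairing (Tri A M B) = tri_pairing A M B"
  "mul (Tri A M B) (a, m, b) (a', m', b') = (mul A a a', lmod M a m' + rmod M m b', mul B b b')"
  "lact (Tri A M B) (Diag \<alpha>) (a, m, b) = (lact A \<alpha> a, lact M \<alpha> m, lact B \<alpha> b)"
  "ract (Tri A M B) (a, m, b) (Diag \<alpha>) = (ract A a \<alpha>, ract M m \<alpha>, ract B b \<alpha>)"
  by (simp_all add: Tri_def pts_tri_nspace tri_pts_def)

section \<open>The triangular algebra and its tower of duals\<close>

locale triangular =
  fixes R :: "'r::complex_vector nspace" and mulR :: "'r \<Rightarrow> 'r \<Rightarrow> 'r"
    and A :: "('r, 'a::complex_vector) aalg" and B :: "('r, 'b::complex_vector) aalg"
    and M :: "('r, 'a, 'b, 'm::complex_vector) abmod" and n :: nat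
  assumes unital_A: "unital_banach_algebra A" and module_A: "banach_algebra_module R mulR A"
    and unital_B: "unital_banach_algebra B" and module_B: "banach_algebra_module R mulR B"
    and unital_M: "unital_banach_AB_module A B M" and module_M: "banach_AB_module_module R mulR A B M"
    and commutative_M: "commutative_module R M"
    and banach_R: "banach_space R"
    and dual_tower_A: "dual_tower (2 * n) A" and dual_tower_B: "dual_tower (2 * n) B"
    and dual_tower_M: "dual_tower (2 * n) M"
begin

abbreviation T where "T \<equiv> Tri A M B"

lemma banach: "banach_space (dual A 0)" "banach_space (dual B 0)" "banach_space (dual M 0)"
  using unital_A unital_B unital_M
  by (auto simp: unital_banach_algebra_def banach_algebra_def unital_banach_AB_module_def banach_bimodule_def)

lemmas seminormed_0 = banach[THEN banach_space_seminormed]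
lemmas seminormed_R = banach_R[THEN banach_space_seminormed]

lemma tower_A: "normed_tower (2 * n) A" and tower_B: "normed_tower (2 * n) B"
  and tower_M: "normed_tower (2 * n) M"
  using seminormed_0 dual_tower_A dual_tower_B dual_tower_M by (auto simp: normed_tower_def)

lemma seminormed_T: "seminormed (dual T 0)"
proof -
  note sA = seminormedD[OF seminormed_0(1)] and sB = seminormedD[OF seminormed_0(2)]
    and sM = seminormedD[OF seminormed_0(3)]
  have "csubspace (carr T)"
    unfolding cvec.subspace_def using sA(2,5,8) sB(2,5,8) sM(2,5,8)
    by (auto simp: zero_prod_def scaleC_prod_def)
  moreover have "nrm (dual T 0) (x + y) \<le> nrm (dual T 0) x + nrm (dual T 0) y"
    if "x \<in> carr T" "y \<in> carr T" for x y
    using that sA(9)[of "fst x" "fst y"] sB(9)[of "snd (snd x)" "snd (snd y)"]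
      sM(9)[of "fst (snd x)" "fst (snd y)"]
    by (cases x; cases y) simp
  ultimately show ?thesis
    using sA(4,10) sB(4,10) sM(4,10)
    by (auto simp: seminormed_def scaleC_prod_def distrib_left)
qed

lemma tower_T: "normed_tower (2 * n) T"
  using seminormed_T dual_tower_Tri[OF banach(1,3,2) dual_tower_A dual_tower_M dual_tower_B]
  by (simp add: normed_tower_def)

lemmas seminormed_2n = tower_A[THEN normed_tower_seminormed, OF order_refl]
  tower_B[THEN normed_tower_seminormed, OF order_refl]
  tower_M[THEN normed_tower_seminormed, OF order_refl]
  tower_T[THEN normed_tower_seminormed, OF order_refl]

lemma zero_in: "0 \<in> carr A" "0 \<in> carr B" "0 \<in> carr M"
    "0 \<in> dpts A (2 * n)" "0 \<in> dpts B (2 * n)" "0 \<in> dpts M (2 * n)"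
  using seminormedD(2) seminormed_0 seminormed_2n by blast+

subsection \<open>Entries of matrices\<close>

lemma pairing_zero:
  assumes "j < 2 * n"
  shows "y \<in> dpts A (Suc j) \<Longrightarrow> pairing A j y 0 = 0" "x \<in> dpts A j \<Longrightarrow> pairing A j 0 x = 0"
    "y' \<in> dpts B (Suc j) \<Longrightarrow> pairing B j y' 0 = 0" "x' \<in> dpts B j \<Longrightarrow> pairing B j 0 x' = 0"
    "y'' \<in> dpts M (Suc j) \<Longrightarrow> pairing M j y'' 0 = 0" "x'' \<in> dpts M j \<Longrightarrow> pairing M j 0 x'' = 0"
    "0 \<in> dpts A (Suc j)" "0 \<in> dpts B (Suc j)" "0 \<in> dpts M (Suc j)"
  using assms is_dual_zero[OF normed_tower_is_dual[OF tower_A assms] normed_tower_seminormed[OF tower_A]]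
    is_dual_zero[OF normed_tower_is_dual[OF tower_B assms] normed_tower_seminormed[OF tower_B]]
    is_dual_zero[OF normed_tower_is_dual[OF tower_M assms] normed_tower_seminormed[OF tower_M]]
    seminormedD(2)[OF normed_tower_seminormed[OF tower_A, of "Suc j"]]
    seminormedD(2)[OF normed_tower_seminormed[OF tower_B, of "Suc j"]]
    seminormedD(2)[OF normed_tower_seminormed[OF tower_M, of "Suc j"]]
  by simp_all

text \<open>The norm of a matrix is the sum of the norms of its entries, hence the bound 1 for all
  four maps. Adjoints preserve it, which later compares the norms of the entries with the dual norm
  on the 2n-th dual.\<close>

lemma bounded_op_entries:
  "bounded_op (dual T 0) (dual A 0) 1 fst"
  "bounded_op (dual T 0) (dual M 0) 1 (\<lambda>t. fst (snd t))"
  "bounded_op (dual T 0) (dual B 0) 1 (\<lambda>t. snd (snd t))"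
  "bounded_op (dual M 0) (dual T 0) 1 (\<lambda>m. (0, m, 0))"
  using zero_in seminormedD(3,4)[OF seminormed_0(1)] seminormedD(3,4)[OF seminormed_0(2)]
    seminormedD(3,4)[OF seminormed_0(3)]
  by (auto simp: bounded_op_def additive_on_def scaleC_prod_def)

lemma bounded_map_entries:
  "bounded_map T A fst" "bounded_map T M (\<lambda>t. fst (snd t))" "bounded_map T B (\<lambda>t. snd (snd t))"
  "bounded_map M T (\<lambda>m. (0, m, 0))"
  using bounded_op_entries unfolding bounded_map_def by blast+

text \<open>For the entrywise pairing, reading off an entry and inserting it among zeros are adjoint
  to each other at every level.\<close>

lemma even_adjoint_entries:
  "F \<in> dpts T (2 * n) \<Longrightarrow> even_adjoint T A n fst F = fst F"
  "F \<in> dpts T (2 * n) \<Longrightarrow> even_adjoint T M n (\<lambda>t. fst (snd t)) F = fst (snd F)"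
  "F \<in> dpts T (2 * n) \<Longrightarrow> even_adjoint T B n (\<lambda>t. snd (snd t)) F = snd (snd F)"
  "\<gamma> \<in> dpts M (2 * n) \<Longrightarrow> even_adjoint M T n (\<lambda>m. (0, m, 0)) \<gamma> = (0, \<gamma>, 0)"
proof -
  show "F \<in> dpts T (2 * n) \<Longrightarrow> even_adjoint T A n fst F = fst F"
    by (rule even_adjoint_adjoint_pair[OF tower_T tower_A bounded_op_entries(1),
          where S = "\<lambda>f. (f, 0, 0)"])
      (auto simp: tri_pairing_def pairing_zero)
  show "F \<in> dpts T (2 * n) \<Longrightarrow> even_adjoint T M n (\<lambda>t. fst (snd t)) F = fst (snd F)"
    by (rule even_adjoint_adjoint_pair[OF tower_T tower_M bounded_op_entries(2),
          where S = "\<lambda>f. (0, f, 0)"])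
      (auto simp: tri_pairing_def pairing_zero)
  show "F \<in> dpts T (2 * n) \<Longrightarrow> even_adjoint T B n (\<lambda>t. snd (snd t)) F = snd (snd F)"
    by (rule even_adjoint_adjoint_pair[OF tower_T tower_B bounded_op_entries(3),
          where S = "\<lambda>f. (0, 0, f)"])
      (auto simp: tri_pairing_def pairing_zero)
  show "\<gamma> \<in> dpts M (2 * n) \<Longrightarrow> even_adjoint M T n (\<lambda>m. (0, m, 0)) \<gamma> = (0, \<gamma>, 0)"
    by (rule even_adjoint_adjoint_pair[OF tower_M tower_T bounded_op_entries(4),
          where S = "\<lambda>t. fst (snd t)"])
      (auto simp: tri_pairing_def pairing_zero)
qed

lemma bounded_map_triple:
  assumes "bounded_map T A f" "bounded_map T M g" "bounded_map T B h"
  shows "bounded_map T T (\<lambda>t. (f t, g t, h t))"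
proof -
  obtain K L J where f: "bounded_op (dual T 0) (dual A 0) K f"
    and g: "bounded_op (dual T 0) (dual M 0) L g" and h: "bounded_op (dual T 0) (dual B 0) J h"
    using assms by (auto simp: bounded_map_def)
  have "nrm (dual T 0) (f t, g t, h t) \<le> (K + L + J) * nrm (dual T 0) t" if "t \<in> carr T" for t
    using bounded_opD(5)[OF f that] bounded_opD(5)[OF g that] bounded_opD(5)[OF h that]
    by (simp add: distrib_right)
  then have "bounded_op (dual T 0) (dual T 0) (K + L + J) (\<lambda>t. (f t, g t, h t))"
    unfolding bounded_op_def[of "dual T 0" "dual T 0"] additive_on_def
    using bounded_opD(1-4)[OF f] bounded_opD(1-4)[OF g] bounded_opD(1-4)[OF h]
    by (auto simp: scaleC_prod_def)
  then show ?thesis by (auto simp: bounded_map_def)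
qed

text \<open>Both actions by a fixed matrix or scalar matrix have this shape, with p and q the
  contributions of the diagonal entries to the corner. Each entry of the value is found by composing
  U with the projection onto that entry, whose even adjoint is again the projection.\<close>

lemma triangular_operator:
  assumes f: "bounded_map A A f" and g: "bounded_map M M g" and h: "bounded_map B B h"
    and p: "bounded_map A M p" and q: "bounded_map B M q"
  defines "U \<equiv> \<lambda>(x, y, z). (f x, g y + p x + q z, h z)"
  shows "bounded_map T T U"
    and "(x, y, z) \<in> dpts T (2 * n) \<Longrightarrow> even_adjoint T T n U (x, y, z) =
      (even_adjoint A A n f x, even_adjoint M M n g y + even_adjoint A M n p x + even_adjoint B M n q z,
       even_adjoint B B n h z)"
proof -
  note e = bounded_map_entries
  note f' = bounded_map_comp[OF e(1) f] and h' = bounded_map_comp[OF e(3) h]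
    and g' = bounded_map_comp[OF e(2) g] and p' = bounded_map_comp[OF e(1) p]
    and q' = bounded_map_comp[OF e(3) q]
  note gp' = bounded_map_add[OF g' p' seminormed_0(3)]
  note gpq' = bounded_map_add[OF gp' q' seminormed_0(3)]
  have U: "U = (\<lambda>t. (f (fst t), g (fst (snd t)) + p (fst t) + q (snd (snd t)), h (snd (snd t))))"
    by (auto simp: U_def)
  show bU: "bounded_map T T U" unfolding U by (rule bounded_map_triple[OF f' gpq' h'])
  assume t: "(x, y, z) \<in> dpts T (2 * n)"
  note W = even_adjoint_linear(1)[OF tower_T tower_T bU t]
  let ?W = "even_adjoint T T n U (x, y, z)"
  have "fst ?W = even_adjoint A A n f x"
    using even_adjoint_compose2[OF tower_T tower_T tower_A tower_A bU e(1) e(1) f _ t]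
      even_adjoint_entries(1)[OF W] even_adjoint_entries(1)[OF t] by (simp add: U)
  moreover have "snd (snd ?W) = even_adjoint B B n h z"
    using even_adjoint_compose2[OF tower_T tower_T tower_B tower_B bU e(3) e(3) h _ t]
      even_adjoint_entries(3)[OF W] even_adjoint_entries(3)[OF t] by (simp add: U)
  moreover have "fst (snd ?W) =
      even_adjoint M M n g y + even_adjoint A M n p x + even_adjoint B M n q z"
  proof -
    \<comment> \<open>The corner composes to a sum of three operators on matrices; additivity splits
      it, and each summand factors through one projection.\<close>
    have "fst (snd ?W) = even_adjoint T M n
        (\<lambda>t. g (fst (snd t)) + p (fst t) + q (snd (snd t))) (x, y, z)"
      using even_adjoint_compose[OF tower_T tower_T tower_M bU e(2) gpq' _ t]
        even_adjoint_entries(2)[OF W] by (simp add: U)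
    also have "\<dots> = even_adjoint T M n (\<lambda>t. g (fst (snd t)) + p (fst t)) (x, y, z)
        + even_adjoint T M n (\<lambda>t. q (snd (snd t))) (x, y, z)"
      by (rule even_adjoint_sum[OF tower_T tower_M gp' q' gpq' refl t])
    also have "even_adjoint T M n (\<lambda>t. g (fst (snd t)) + p (fst t)) (x, y, z) =
        even_adjoint T M n (\<lambda>t. g (fst (snd t))) (x, y, z) + even_adjoint T M n (\<lambda>t. p (fst t)) (x, y, z)"
      by (rule even_adjoint_sum[OF tower_T tower_M g' p' gp' refl t])
    also have "even_adjoint T M n (\<lambda>t. g (fst (snd t))) (x, y, z) = even_adjoint M M n g y"
      using even_adjoint_compose[OF tower_T tower_M tower_M e(2) g g' refl t]
        even_adjoint_entries(2)[OF t] by simp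
    also have "even_adjoint T M n (\<lambda>t. p (fst t)) (x, y, z) = even_adjoint A M n p x"
      using even_adjoint_compose[OF tower_T tower_A tower_M e(1) p p' refl t]
        even_adjoint_entries(1)[OF t] by simp
    also have "even_adjoint T M n (\<lambda>t. q (snd (snd t))) (x, y, z) = even_adjoint B M n q z"
      using even_adjoint_compose[OF tower_T tower_B tower_M e(3) q q' refl t]
        even_adjoint_entries(3)[OF t] by simp
    finally show ?thesis .
  qed
  ultimately show "?W = (even_adjoint A A n f x,
      even_adjoint M M n g y + even_adjoint A M n p x + even_adjoint B M n q z, even_adjoint B B n h z)"
    by (simp add: prod_eq_iff)
qed


subsection \<open>Products and actions\<close>

lemma bilinear:
  "bounded_bilinear_op (dual A 0) (dual A 0) (dual A 0) (mul A)"
  "bounded_bilinear_op (dual B 0) (dual B 0) (dual B 0) (mul B)"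
  "bounded_bilinear_op (dual A 0) (dual M 0) (dual M 0) (lmod M)"
  "bounded_bilinear_op (dual M 0) (dual B 0) (dual M 0) (rmod M)"
  "bounded_bilinear_op R (dual A 0) (dual A 0) (lact A)"
  "bounded_bilinear_op (dual A 0) R (dual A 0) (ract A)"
  "bounded_bilinear_op R (dual B 0) (dual B 0) (lact B)"
  "bounded_bilinear_op (dual B 0) R (dual B 0) (ract B)"
  "bounded_bilinear_op R (dual M 0) (dual M 0) (lact M)"
  "bounded_bilinear_op (dual M 0) R (dual M 0) (ract M)"
  using unital_A unital_B unital_M module_A module_B module_M
  by (simp_all add: unital_banach_algebra_def banach_algebra_def unital_banach_AB_module_def
      banach_bimodule_def banach_algebra_module_def banach_AB_module_module_def)

lemma bounded_map_bilinear:
  assumes "bounded_bilinear_op (dual X 0) (dual Y 0) (dual Z 0) f"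
    and "seminormed (dual X 0)" "seminormed (dual Y 0)"
  shows "x \<in> carr X \<Longrightarrow> bounded_map Y Z (f x)" "y \<in> carr Y \<Longrightarrow> bounded_map X Z (\<lambda>x. f x y)"
  using bounded_bilinear_opD[OF assms] unfolding bounded_map_def by blast+

lemma bounded_map_products:
  "a \<in> carr A \<Longrightarrow> bounded_map A A (mul A a)" "a \<in> carr A \<Longrightarrow> bounded_map A A (\<lambda>x. mul A x a)"
  "b \<in> carr B \<Longrightarrow> bounded_map B B (mul B b)" "b \<in> carr B \<Longrightarrow> bounded_map B B (\<lambda>x. mul B x b)"
  "a \<in> carr A \<Longrightarrow> bounded_map M M (lmod M a)" "m \<in> carr M \<Longrightarrow> bounded_map A M (\<lambda>x. lmod M x m)"
  "m \<in> carr M \<Longrightarrow> bounded_map B M (rmod M m)" "b \<in> carr B \<Longrightarrow> bounded_map M M (\<lambda>x. rmod M x b)"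
  by (rule bounded_map_bilinear[OF bilinear(1)] bounded_map_bilinear[OF bilinear(2)]
      bounded_map_bilinear[OF bilinear(3)] bounded_map_bilinear[OF bilinear(4)] seminormed_0; assumption?)+

lemma bounded_map_actions:
  assumes "\<alpha> \<in> pts R"
  shows "bounded_map A A (lact A \<alpha>)" "bounded_map A A (\<lambda>x. ract A x \<alpha>)"
    "bounded_map B B (lact B \<alpha>)" "bounded_map B B (\<lambda>x. ract B x \<alpha>)"
    "bounded_map M M (lact M \<alpha>)" "bounded_map M M (\<lambda>x. ract M x \<alpha>)"
  using bounded_bilinear_opD[OF bilinear(5)] bounded_bilinear_opD[OF bilinear(6)]
    bounded_bilinear_opD[OF bilinear(7)] bounded_bilinear_opD[OF bilinear(8)]
    bounded_bilinear_opD[OF bilinear(9)] bounded_bilinear_opD[OF bilinear(10)]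
    seminormed_0 seminormed_R assms unfolding bounded_map_def by blast+

lemmas bounded_maps = bounded_map_products bounded_map_actions

lemma zero_products [simp]:
  "a \<in> carr A \<Longrightarrow> mul A a 0 = 0" "a \<in> carr A \<Longrightarrow> mul A 0 a = 0"
  "b \<in> carr B \<Longrightarrow> mul B b 0 = 0" "b \<in> carr B \<Longrightarrow> mul B 0 b = 0"
  "a \<in> carr A \<Longrightarrow> lmod M a 0 = 0" "m \<in> carr M \<Longrightarrow> lmod M 0 m = 0"
  "m \<in> carr M \<Longrightarrow> rmod M m 0 = 0" "b \<in> carr B \<Longrightarrow> rmod M 0 b = 0"
  "\<alpha> \<in> pts R \<Longrightarrow> lact A \<alpha> 0 = 0" "\<alpha> \<in> pts R \<Longrightarrow> ract A 0 \<alpha> = 0"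
  "\<alpha> \<in> pts R \<Longrightarrow> lact B \<alpha> 0 = 0" "\<alpha> \<in> pts R \<Longrightarrow> ract B 0 \<alpha> = 0"
  "\<alpha> \<in> pts R \<Longrightarrow> lact M \<alpha> 0 = 0" "\<alpha> \<in> pts R \<Longrightarrow> ract M 0 \<alpha> = 0"
  using bounded_maps bounded_op_linear(1) seminormed_0 unfolding bounded_map_def by metis+

lemma products_in [simp]:
  "a \<in> carr A \<Longrightarrow> a' \<in> carr A \<Longrightarrow> mul A a a' \<in> carr A"
  "b \<in> carr B \<Longrightarrow> b' \<in> carr B \<Longrightarrow> mul B b b' \<in> carr B"
  "a \<in> carr A \<Longrightarrow> m \<in> carr M \<Longrightarrow> lmod M a m \<in> carr M"
  "m \<in> carr M \<Longrightarrow> b \<in> carr B \<Longrightarrow> rmod M m b \<in> carr M"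
  "\<alpha> \<in> pts R \<Longrightarrow> a \<in> carr A \<Longrightarrow> lact A \<alpha> a \<in> carr A"
  "\<alpha> \<in> pts R \<Longrightarrow> a \<in> carr A \<Longrightarrow> ract A a \<alpha> \<in> carr A"
  "\<alpha> \<in> pts R \<Longrightarrow> b \<in> carr B \<Longrightarrow> lact B \<alpha> b \<in> carr B"
  "\<alpha> \<in> pts R \<Longrightarrow> b \<in> carr B \<Longrightarrow> ract B b \<alpha> \<in> carr B"
  "\<alpha> \<in> pts R \<Longrightarrow> m \<in> carr M \<Longrightarrow> lact M \<alpha> m \<in> carr M"
  "\<alpha> \<in> pts R \<Longrightarrow> m \<in> carr M \<Longrightarrow> ract M m \<alpha> \<in> carr M"
  using bilinear by (simp_all add: bounded_bilinear_op_def)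

lemma one_in [simp]: "one A \<in> carr A" "one B \<in> carr B"
  and unit_products [simp]:
    "a \<in> carr A \<Longrightarrow> mul A (one A) a = a" "a \<in> carr A \<Longrightarrow> mul A a (one A) = a"
    "b \<in> carr B \<Longrightarrow> mul B (one B) b = b" "b \<in> carr B \<Longrightarrow> mul B b (one B) = b"
    "m \<in> carr M \<Longrightarrow> lmod M (one A) m = m" "m \<in> carr M \<Longrightarrow> rmod M m (one B) = m"
  using unital_A unital_B unital_M
  by (simp_all add: unital_banach_algebra_def unital_banach_AB_module_def)

lemma module_laws:
  "a \<in> carr A \<Longrightarrow> a' \<in> carr A \<Longrightarrow> m \<in> carr M \<Longrightarrow> lmod M (mul A a a') m = lmod M a (lmod M a' m)"
  "m \<in> carr M \<Longrightarrow> b \<in> carr B \<Longrightarrow> b' \<in> carr B \<Longrightarrow> rmod M m (mul B b b') = rmod M (rmod M m b) b'"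
  "a \<in> carr A \<Longrightarrow> m \<in> carr M \<Longrightarrow> b \<in> carr B \<Longrightarrow> rmod M (lmod M a m) b = lmod M a (rmod M m b)"
  using unital_M by (simp_all add: unital_banach_AB_module_def banach_bimodule_def)

text \<open>Compatibility gives each law for the scalar on one side only; commutativity of M moves
  it across, as in a (\<alpha> m) = a (m \<alpha>) = (a m) \<alpha> = \<alpha> (a m).\<close>

lemma action_laws:
  assumes "\<alpha> \<in> pts R" "m \<in> carr M"
  shows "lact M \<alpha> m = ract M m \<alpha>"
    and "a \<in> carr A \<Longrightarrow> lmod M a (lact M \<alpha> m) = lact M \<alpha> (lmod M a m)"
    and "a \<in> carr A \<Longrightarrow> lmod M a (ract M m \<alpha>) = ract M (lmod M a m) \<alpha>"
    and "b \<in> carr B \<Longrightarrow> rmod M (lact M \<alpha> m) b = lact M \<alpha> (rmod M m b)"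
    and "b \<in> carr B \<Longrightarrow> rmod M (ract M m \<alpha>) b = ract M (rmod M m b) \<alpha>"
proof -
  have c: "lact M \<alpha> x = ract M x \<alpha>" if "x \<in> carr M" for x
    using commutative_M that assms by (simp add: commutative_module_def)
  \<comment> \<open>The compatibility conditions are quantified jointly over A, M and B; the point 0
    of B fills the place that this one does not mention.\<close>
  have l: "ract M (lmod M a m) \<alpha> = lmod M a (ract M m \<alpha>)" if "a \<in> carr A" for a
    using module_M assms that zero_in(2) unfolding banach_AB_module_module_def by blast
  have r: "rmod M (lact M \<alpha> m) b = lact M \<alpha> (rmod M m b)" if "b \<in> carr B" for b
    using module_M assms that zero_in(1) unfolding banach_AB_module_module_def by blast
  show "lact M \<alpha> m = ract M m \<alpha>"
    and "a \<in> carr A \<Longrightarrow> lmod M a (lact M \<alpha> m) = lact M \<alpha> (lmod M a m)"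
    and "a \<in> carr A \<Longrightarrow> lmod M a (ract M m \<alpha>) = ract M (lmod M a m) \<alpha>"
    and "b \<in> carr B \<Longrightarrow> rmod M (lact M \<alpha> m) b = lact M \<alpha> (rmod M m b)"
    and "b \<in> carr B \<Longrightarrow> rmod M (ract M m \<alpha>) b = ract M (rmod M m b) \<alpha>"
    using c l r assms by simp_all
qed

lemma additive_products:
  "a \<in> carr A \<Longrightarrow> m \<in> carr M \<Longrightarrow> m' \<in> carr M \<Longrightarrow> lmod M a (m + m') = lmod M a m + lmod M a m'"
  "b \<in> carr B \<Longrightarrow> m \<in> carr M \<Longrightarrow> m' \<in> carr M \<Longrightarrow> rmod M (m + m') b = rmod M m b + rmod M m' b"
  using bilinear(3,4) by (simp_all add: bounded_bilinear_op_def additive_on_def)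

lemmas dual_actions = dual_left_even_adjoint dual_right_even_adjoint
  dual_lprod_even_adjoint dual_rprod_even_adjoint

abbreviation A2 where "A2 \<equiv> dpts A (2 * n)"
abbreviation B2 where "B2 \<equiv> dpts B (2 * n)"
abbreviation M2 where "M2 \<equiv> dpts M (2 * n)"

lemmas linear_AA = even_adjoint_linear[OF tower_A tower_A]
lemmas linear_BB = even_adjoint_linear[OF tower_B tower_B]
lemmas linear_MM = even_adjoint_linear[OF tower_M tower_M]
lemmas linear_AM = even_adjoint_linear[OF tower_A tower_M]
lemmas linear_BM = even_adjoint_linear[OF tower_B tower_M]

text \<open>Each law is the equality of two composites at the bottom, transported by functoriality of the
  even adjoint.\<close>

lemma dual_laws:
  assumes "x \<in> A2" "z \<in> B2" "a \<in> carr A" "b \<in> carr B" "m \<in> carr M"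
  shows "dual_lprod A M n (dual_right A n (mul A) x a) m = dual_lprod A M n x (lmod M a m)"
    and "dual_lprod A M n (dual_left A n (mul A) a x) m = dual_left M n (lmod M) a (dual_lprod A M n x m)"
    and "dual_lprod A M n x (rmod M m b) = dual_right M n (rmod M) (dual_lprod A M n x m) b"
    and "dual_rprod B M n m (dual_left B n (mul B) b z) = dual_rprod B M n (rmod M m b) z"
    and "dual_rprod B M n m (dual_right B n (mul B) z b) = dual_right M n (rmod M) (dual_rprod B M n m z) b"
    and "dual_rprod B M n (lmod M a m) z = dual_left M n (lmod M) a (dual_rprod B M n m z)"
  \<comment> \<open>The rules cover the three shapes of a law: a composite on the left only, on the
    right only, or on both sides.\<close>
  unfolding dual_actions using assms module_laws bounded_map_products
  by - (rule even_adjoint_compose[symmetric] even_adjoint_compose even_adjoint_compose2;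
      (rule tower_A tower_B tower_M | assumption | simp))+

text \<open>For fixed m and \<alpha> these are identities between operators from A or B to M. The
  first and the last transport laws that hold by the commutativity of M.\<close>

lemma dual_action_laws:
  assumes "x \<in> A2" "z \<in> B2" "\<alpha> \<in> pts R" "m \<in> carr M"
  shows "dual_lprod A M n x (lact M \<alpha> m) = dual_left M n (lact M) \<alpha> (dual_lprod A M n x m)"
    and "dual_lprod A M n x (ract M m \<alpha>) = dual_right M n (ract M) (dual_lprod A M n x m) \<alpha>"
    and "dual_rprod B M n (lact M \<alpha> m) z = dual_left M n (lact M) \<alpha> (dual_rprod B M n m z)"
    and "dual_rprod B M n (ract M m \<alpha>) z = dual_right M n (ract M) (dual_rprod B M n m z) \<alpha>"
  unfolding dual_actions using assms action_laws(2-) bounded_maps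
  by - (rule even_adjoint_compose;
      (rule tower_A tower_B tower_M | assumption | simp))+

end

section \<open>Corner maps as a linear and injective image of the maps on the module\<close>

lemma corner_map_add:
  "corner_map (f + g) = (corner_map f + corner_map g
    :: 'a::monoid_add \<times> 'm::monoid_add \<times> 'b::monoid_add \<Rightarrow> 'a \<times> 'm \<times> 'b)"
  by (auto simp: corner_map_def fun_eq_iff)

lemma corner_map_scale: "corner_map (c *\<^sub>C f) = c *\<^sub>C corner_map f"
  by (auto simp: corner_map_def fun_eq_iff scaleC_fun_def scaleC_prod_def)

lemma corner_map_inject:
  "(corner_map f :: 'a::zero \<times> 'm::zero \<times> 'b::zero \<Rightarrow> 'a \<times> 'm \<times> 'b) = corner_map g \<longleftrightarrow> f = g"
proof
  assume eq: "(corner_map f :: 'a \<times> 'm \<times> 'b \<Rightarrow> 'a \<times> 'm \<times> 'b) = corner_map g"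
  have "corner_map f (0 :: 'a, m, 0 :: 'b) = corner_map g (0, m, 0)" for m by (simp only: eq)
  then show "f = g" by (simp add: corner_map_def fun_eq_iff)
qed simp

lemma csubspace_corner_map:
  assumes S: "csubspace S"
  shows "csubspace ((corner_map :: ('m::complex_vector \<Rightarrow> 'm) \<Rightarrow> 'a::complex_vector \<times> 'm \<times> 'b::complex_vector \<Rightarrow> _) ` S)"
  unfolding cvec.subspace_def
proof (intro conjI ballI allI)
  have "corner_map (0 *\<^sub>C 0) = (0 *\<^sub>C corner_map 0 :: 'a \<times> 'm \<times> 'b \<Rightarrow> 'a \<times> 'm \<times> 'b)"
    by (rule corner_map_scale)
  then have "(0 :: 'a \<times> 'm \<times> 'b \<Rightarrow> 'a \<times> 'm \<times> 'b) = corner_map 0" by simp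
  then show "(0 :: 'a \<times> 'm \<times> 'b \<Rightarrow> 'a \<times> 'm \<times> 'b) \<in> corner_map ` S"
    using cvec.subspace_0[OF S] by blast
qed (use cvec.subspace_add[OF S] cvec.subspace_scale[OF S] in
    \<open>auto simp: corner_map_add[symmetric] corner_map_scale[symmetric]\<close>)

section \<open>Dual actions of the triangular algebra, entry by entry\<close>

context triangular
begin

sublocale bounded_actions "scalar_matrices R" T n
proof
  show "normed_tower (2 * n) T" by (rule tower_T)
  have z: "bounded_map A M (\<lambda>x. 0)" "bounded_map B M (\<lambda>x. 0)"
    using bounded_map_zero seminormed_0 by auto
  fix s assume "s \<in> scalar_matrices R"
  then obtain \<alpha> where s: "s = Diag \<alpha>" "\<alpha> \<in> pts R" by blast
  \<comment> \<open>The two zeros stand for the operators p and q, so that the action has the form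
    required by \<open>triangular_operator\<close>.\<close>
  have "lact T s = (\<lambda>(x, y, z). (lact A \<alpha> x, lact M \<alpha> y + 0 + 0, lact B \<alpha> z))"
    by (auto simp: s)
  then show "bounded_map T T (lact T s)"
    using triangular_operator(1)[OF bounded_map_actions(1,5,3)[OF s(2)] z] by simp
  have "(\<lambda>x. ract T x s) = (\<lambda>(x, y, z). (ract A x \<alpha>, ract M y \<alpha> + 0 + 0, ract B z \<alpha>))"
    by (auto simp: s)
  then show "bounded_map T T (\<lambda>x. ract T x s)"
    using triangular_operator(1)[OF bounded_map_actions(2,6,4)[OF s(2)] z] by simp
next
  have z: "bounded_map A M (\<lambda>x. 0)" "bounded_map B M (\<lambda>x. 0)"
    using bounded_map_zero seminormed_0 by auto
  fix t assume "t \<in> carr T"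
  then obtain a m b where t: "t = (a, m, b)" "a \<in> carr A" "m \<in> carr M" "b \<in> carr B" by auto
  have "mul T t = (\<lambda>(x, y, z). (mul A a x, lmod M a y + 0 + rmod M m z, mul B b z))"
    by (auto simp: t)
  then show "bounded_map T T (mul T t)"
    using triangular_operator(1)[OF bounded_map_products(1)[OF t(2)] bounded_map_products(5)[OF t(2)]
        bounded_map_products(3)[OF t(4)] z(1) bounded_map_products(7)[OF t(3)]] by simp
  have "(\<lambda>x. mul T x t) = (\<lambda>(x, y, z). (mul A x a, rmod M y b + lmod M x m + 0, mul B z b))"
    by (auto simp: t)
  then show "bounded_map T T (\<lambda>x. mul T x t)"
    using triangular_operator(1)[OF bounded_map_products(2)[OF t(2)] bounded_map_products(8)[OF t(4)]
        bounded_map_products(4)[OF t(4)] bounded_map_products(6)[OF t(3)] z(2)] by simp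
qed

text \<open>The actions on the 2n-th dual are iterated adjoints for \<open>tri_pairing\<close>, so
  the matrix formulas are a result, not a definition. The mixed products enter through the corner: m
  z from left multiplication, where m meets the lower diagonal entry, and x m from right
  multiplication, where it meets the upper one.\<close>

lemma dual_actions_T:
  assumes "x \<in> A2" "y \<in> M2" "z \<in> B2"
  shows "a \<in> carr A \<Longrightarrow> m \<in> carr M \<Longrightarrow> b \<in> carr B \<Longrightarrow> dual_left T n (mul T) (a, m, b) (x, y, z) =
      (dual_left A n (mul A) a x, dual_left M n (lmod M) a y + dual_rprod B M n m z,
       dual_left B n (mul B) b z)"
    and "a \<in> carr A \<Longrightarrow> m \<in> carr M \<Longrightarrow> b \<in> carr B \<Longrightarrow> dual_right T n (mul T) (x, y, z) (a, m, b) =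
      (dual_right A n (mul A) x a, dual_lprod A M n x m + dual_right M n (rmod M) y b,
       dual_right B n (mul B) z b)"
    and "\<alpha> \<in> pts R \<Longrightarrow> dual_left T n (lact T) (Diag \<alpha>) (x, y, z) =
      (dual_left A n (lact A) \<alpha> x, dual_left M n (lact M) \<alpha> y, dual_left B n (lact B) \<alpha> z)"
    and "\<alpha> \<in> pts R \<Longrightarrow> dual_right T n (ract T) (x, y, z) (Diag \<alpha>) =
      (dual_right A n (ract A) x \<alpha>, dual_right M n (ract M) y \<alpha>, dual_right B n (ract B) z \<alpha>)"
proof -
  have t: "(x, y, z) \<in> dpts T (2 * n)" using assms by simp
  have zA: "bounded_map A M (\<lambda>x. 0)" and zB: "bounded_map B M (\<lambda>x. 0)"
    using bounded_map_zero seminormed_0 by auto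
  have z: "even_adjoint A M n (\<lambda>x. 0) x = 0" "even_adjoint B M n (\<lambda>x. 0) z = 0"
    using even_adjoint_eq_0[OF tower_A tower_M zA] even_adjoint_eq_0[OF tower_B tower_M zB] assms by auto
  show "a \<in> carr A \<Longrightarrow> m \<in> carr M \<Longrightarrow> b \<in> carr B \<Longrightarrow> dual_left T n (mul T) (a, m, b) (x, y, z) =
      (dual_left A n (mul A) a x, dual_left M n (lmod M) a y + dual_rprod B M n m z,
       dual_left B n (mul B) b z)"
  proof -
    assume h: "a \<in> carr A" "m \<in> carr M" "b \<in> carr B"
    have "mul T (a, m, b) = (\<lambda>(x, y, z). (mul A a x, lmod M a y + 0 + rmod M m z, mul B b z))" by auto
    then show ?thesis
      using triangular_operator(2)[OF bounded_map_products(1)[OF h(1)] bounded_map_products(5)[OF h(1)]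
        bounded_map_products(3)[OF h(3)] zA bounded_map_products(7)[OF h(2)] t]
      by (simp add: dual_actions z)
  qed
  show "a \<in> carr A \<Longrightarrow> m \<in> carr M \<Longrightarrow> b \<in> carr B \<Longrightarrow> dual_right T n (mul T) (x, y, z) (a, m, b) =
      (dual_right A n (mul A) x a, dual_lprod A M n x m + dual_right M n (rmod M) y b,
       dual_right B n (mul B) z b)"
  proof -
    assume h: "a \<in> carr A" "m \<in> carr M" "b \<in> carr B"
    have "(\<lambda>x. mul T x (a, m, b)) =
        (\<lambda>(x, y, z). (mul A x a, rmod M y b + lmod M x m + 0, mul B z b))" by auto
    then show ?thesis
      using triangular_operator(2)[OF bounded_map_products(2)[OF h(1)] bounded_map_products(8)[OF h(3)]
        bounded_map_products(4)[OF h(3)] bounded_map_products(6)[OF h(2)] zB t]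
      by (simp add: dual_actions z add.commute)
  qed
  show "\<alpha> \<in> pts R \<Longrightarrow> dual_left T n (lact T) (Diag \<alpha>) (x, y, z) =
      (dual_left A n (lact A) \<alpha> x, dual_left M n (lact M) \<alpha> y, dual_left B n (lact B) \<alpha> z)"
  proof -
    assume h: "\<alpha> \<in> pts R"
    have "lact T (Diag \<alpha>) = (\<lambda>(x, y, z). (lact A \<alpha> x, lact M \<alpha> y + 0 + 0, lact B \<alpha> z))" by auto
    then show ?thesis
      using triangular_operator(2)[OF bounded_map_actions(1,5,3)[OF h] zA zB t]
      by (simp add: dual_actions z)
  qed
  show "\<alpha> \<in> pts R \<Longrightarrow> dual_right T n (ract T) (x, y, z) (Diag \<alpha>) =
      (dual_right A n (ract A) x \<alpha>, dual_right M n (ract M) y \<alpha>, dual_right B n (ract B) z \<alpha>)"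
  proof -
    assume h: "\<alpha> \<in> pts R"
    have "(\<lambda>x. ract T x (Diag \<alpha>)) =
        (\<lambda>(x, y, z). (ract A x \<alpha>, ract M y \<alpha> + 0 + 0, ract B z \<alpha>))" by auto
    then show ?thesis
      using triangular_operator(2)[OF bounded_map_actions(2,6,4)[OF h] zA zB t]
      by (simp add: dual_actions z)
  qed
qed

lemma dual_products_in [simp]:
  "a \<in> carr A \<Longrightarrow> x \<in> A2 \<Longrightarrow> dual_left A n (mul A) a x \<in> A2"
  "a \<in> carr A \<Longrightarrow> x \<in> A2 \<Longrightarrow> dual_right A n (mul A) x a \<in> A2"
  "b \<in> carr B \<Longrightarrow> z \<in> B2 \<Longrightarrow> dual_left B n (mul B) b z \<in> B2"
  "b \<in> carr B \<Longrightarrow> z \<in> B2 \<Longrightarrow> dual_right B n (mul B) z b \<in> B2"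
  "a \<in> carr A \<Longrightarrow> y \<in> M2 \<Longrightarrow> dual_left M n (lmod M) a y \<in> M2"
  "b \<in> carr B \<Longrightarrow> y \<in> M2 \<Longrightarrow> dual_right M n (rmod M) y b \<in> M2"
  "m \<in> carr M \<Longrightarrow> x \<in> A2 \<Longrightarrow> dual_lprod A M n x m \<in> M2"
  "m \<in> carr M \<Longrightarrow> z \<in> B2 \<Longrightarrow> dual_rprod B M n m z \<in> M2"
  unfolding dual_actions
  by (auto intro: linear_AA(1) linear_BB(1) linear_MM(1) linear_AM(1) linear_BM(1) bounded_map_products)

lemma dual_zero_products [simp]:
  "a \<in> carr A \<Longrightarrow> dual_left A n (mul A) a 0 = 0" "a \<in> carr A \<Longrightarrow> dual_right A n (mul A) 0 a = 0"
  "b \<in> carr B \<Longrightarrow> dual_left B n (mul B) b 0 = 0" "b \<in> carr B \<Longrightarrow> dual_right B n (mul B) 0 b = 0"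
  "a \<in> carr A \<Longrightarrow> dual_left M n (lmod M) a 0 = 0" "b \<in> carr B \<Longrightarrow> dual_right M n (rmod M) 0 b = 0"
  "m \<in> carr M \<Longrightarrow> dual_lprod A M n 0 m = 0" "m \<in> carr M \<Longrightarrow> dual_rprod B M n m 0 = 0"
  "\<alpha> \<in> pts R \<Longrightarrow> dual_left A n (lact A) \<alpha> 0 = 0" "\<alpha> \<in> pts R \<Longrightarrow> dual_right A n (ract A) 0 \<alpha> = 0"
  "\<alpha> \<in> pts R \<Longrightarrow> dual_left B n (lact B) \<alpha> 0 = 0" "\<alpha> \<in> pts R \<Longrightarrow> dual_right B n (ract B) 0 \<alpha> = 0"
  unfolding dual_actions
  by (auto intro: linear_AA(4) linear_BB(4) linear_MM(4) linear_AM(4) linear_BM(4) bounded_maps)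

lemma dual_products_by_zero [simp]:
  "x \<in> A2 \<Longrightarrow> dual_left A n (mul A) 0 x = 0" "x \<in> A2 \<Longrightarrow> dual_right A n (mul A) x 0 = 0"
  "z \<in> B2 \<Longrightarrow> dual_left B n (mul B) 0 z = 0" "z \<in> B2 \<Longrightarrow> dual_right B n (mul B) z 0 = 0"
  "y \<in> M2 \<Longrightarrow> dual_left M n (lmod M) 0 y = 0" "y \<in> M2 \<Longrightarrow> dual_right M n (rmod M) y 0 = 0"
  "x \<in> A2 \<Longrightarrow> dual_lprod A M n x 0 = 0" "z \<in> B2 \<Longrightarrow> dual_rprod B M n 0 z = 0"
  unfolding dual_actions
  by (auto intro!: even_adjoint_eq_0[OF tower_A tower_A] even_adjoint_eq_0[OF tower_B tower_B]
      even_adjoint_eq_0[OF tower_M tower_M] even_adjoint_eq_0[OF tower_A tower_M]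
      even_adjoint_eq_0[OF tower_B tower_M] bounded_map_products zero_in)

text \<open>Multiplication by the unit is the identity on the carrier, and the even adjoint of an
  identity is an identity. So the dual modules are unital, which the idempotent argument for
  derivations relies on.\<close>

lemma dual_unit_products [simp]:
  "x \<in> A2 \<Longrightarrow> dual_left A n (mul A) (one A) x = x" "x \<in> A2 \<Longrightarrow> dual_right A n (mul A) x (one A) = x"
  "z \<in> B2 \<Longrightarrow> dual_left B n (mul B) (one B) z = z" "z \<in> B2 \<Longrightarrow> dual_right B n (mul B) z (one B) = z"
  "y \<in> M2 \<Longrightarrow> dual_left M n (lmod M) (one A) y = y" "y \<in> M2 \<Longrightarrow> dual_right M n (rmod M) y (one B) = y"
  unfolding dual_actions
  by (auto intro!: even_adjoint_eq_id[OF tower_A] even_adjoint_eq_id[OF tower_B]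
      even_adjoint_eq_id[OF tower_M] bounded_map_products)


subsection \<open>Module homomorphisms and Rosenblum operators\<close>

text \<open>Additivity makes continuity equivalent to boundedness, although homomorphisms need not be
  complex linear.\<close>

lemma Hom_iff:
  "\<phi> \<in> Hom R A B M n \<longleftrightarrow>
     (\<forall>m\<in>carr M. \<phi> m \<in> M2) \<and> additive_on (carr M) \<phi> \<and>
     (\<exists>K. \<forall>m\<in>carr M. nrm (dual M (2 * n)) (\<phi> m) \<le> K * nrm (dual M 0) m) \<and>
     (\<forall>m\<in>carr M.
        (\<forall>a\<in>carr A. \<phi> (lmod M a m) = dual_left M n (lmod M) a (\<phi> m)) \<and>
        (\<forall>b\<in>carr B. \<phi> (rmod M m b) = dual_right M n (rmod M) (\<phi> m) b) \<and>
        (\<forall>\<alpha>\<in>pts R. \<phi> (lact M \<alpha> m) = dual_left M n (lact M) \<alpha> (\<phi> m) \<and>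
                   \<phi> (ract M m \<alpha>) = dual_right M n (ract M) (\<phi> m) \<alpha>)) \<and>
     vanishes_off (carr M) \<phi>"
proof -
  note sM = seminormed_0(3) and sM2 = seminormed_2n(3)
  have "(\<forall>m\<in>carr M. \<forall>e>0. \<exists>d>0. \<forall>m'\<in>carr M.
        nrm (dual M 0) (m' - m) < d \<longrightarrow> nrm (dual M (2 * n)) (\<phi> m' - \<phi> m) < e) \<longleftrightarrow>
      (\<exists>K. \<forall>m\<in>carr M. nrm (dual M (2 * n)) (\<phi> m) \<le> K * nrm (dual M 0) m)" (is "?C \<longleftrightarrow> ?B")
    if into: "\<forall>m\<in>carr M. \<phi> m \<in> M2" and add: "additive_on (carr M) \<phi>"
  proof
    assume ?C
    then obtain d where d: "d > 0" "\<And>m'. m' \<in> carr M \<Longrightarrow> nrm (dual M 0) (m' - 0) < d \<Longrightarrow>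
        nrm (dual M (2 * n)) (\<phi> m' - \<phi> 0) < 1"
      using zero_in(3) zero_less_one by blast
    have "\<phi> (0 + 0) = \<phi> 0 + \<phi> 0" using add zero_in(3) unfolding additive_on_def by blast
    then have "nrm (dual M (2 * n)) (\<phi> m) \<le> 1 / d * nrm (dual M 0) m" if "m \<in> carr M" for m
      using d into that by (intro additive_continuous_bounded[OF sM sM2 add]) auto
    then show ?B by blast
  next
    assume ?B
    then obtain K where K: "\<And>m. m \<in> carr M \<Longrightarrow> nrm (dual M (2 * n)) (\<phi> m) \<le> K * nrm (dual M 0) m"
      by blast
    show ?C
    proof (intro ballI allI impI)
      fix m and e :: real assume m: "m \<in> carr M" and e: "0 < e"
      \<comment> \<open>The summand 1 keeps the radius \<open>e / (\<bar>K\<bar> + 1)\<close>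
        meaningful when K = 0.\<close>
      have "nrm (dual M (2 * n)) (\<phi> m' - \<phi> m) < e"
        if m': "m' \<in> carr M" and lt: "nrm (dual M 0) (m' - m) < e / (\<bar>K\<bar> + 1)" for m'
      proof -
        have s: "m' - m \<in> carr M" using seminormedD(6)[OF sM m' m] .
        have "\<phi> ((m' - m) + m) = \<phi> (m' - m) + \<phi> m" using add s m unfolding additive_on_def by blast
        then have "nrm (dual M (2 * n)) (\<phi> m' - \<phi> m) \<le> K * nrm (dual M 0) (m' - m)"
          using K[OF s] by simp
        also have "\<dots> \<le> (\<bar>K\<bar> + 1) * nrm (dual M 0) (m' - m)"
          using seminormedD(4)[OF sM s] by (intro mult_right_mono) auto
        also have "\<dots> < e" using lt by (simp add: field_simps)
        finally show ?thesis .
      qed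
      then show "\<exists>d>0. \<forall>m'\<in>carr M. nrm (dual M 0) (m' - m) < d \<longrightarrow>
          nrm (dual M (2 * n)) (\<phi> m' - \<phi> m) < e"
        using e by (intro exI[of _ "e / (\<bar>K\<bar> + 1)"]) auto
    qed
  qed
  then show ?thesis unfolding Hom_def by auto
qed

lemma csubspace_Hom: "csubspace (Hom R A B M n)"
  unfolding cvec.subspace_def
proof (intro conjI ballI allI)
  note sn = seminormed_2n(3)
  note l = linear_MM[OF bounded_map_products(5)] linear_MM[OF bounded_map_products(8)]
    linear_MM[OF bounded_map_actions(5)] linear_MM[OF bounded_map_actions(6)]
  show "0 \<in> Hom R A B M n"
    unfolding Hom_iff using seminormedD(2,3)[OF sn]
    by (auto simp: vanishes_off_def additive_on_def dual_actions l intro!: exI[of _ 0])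
  show "\<phi> + \<phi>' \<in> Hom R A B M n" if \<phi>: "\<phi> \<in> Hom R A B M n" "\<phi>' \<in> Hom R A B M n" for \<phi> \<phi>'
  proof -
    have "\<exists>K. \<forall>m\<in>carr M. nrm (dual M (2 * n)) (\<phi> m + \<phi>' m) \<le> K * nrm (dual M 0) m"
      by (rule bounded_add[OF sn]) (use \<phi> in \<open>auto simp: Hom_iff\<close>)
    then show ?thesis
      using \<phi> l seminormedD(5)[OF sn] unfolding Hom_iff
      by (simp add: vanishes_off_def additive_on_def dual_actions algebra_simps)
  qed
  show "c *\<^sub>C \<phi> \<in> Hom R A B M n" if \<phi>: "\<phi> \<in> Hom R A B M n" for c \<phi>
  proof -
    have "\<exists>K. \<forall>m\<in>carr M. nrm (dual M (2 * n)) (c *\<^sub>C \<phi> m) \<le> K * nrm (dual M 0) m"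
      by (rule bounded_scale[OF sn]) (use \<phi> in \<open>auto simp: Hom_iff\<close>)
    then show ?thesis
      using \<phi> l seminormedD(8)[OF sn] unfolding Hom_iff
      by (simp add: scaleC_fun_def vanishes_off_def additive_on_def dual_actions scaleC_add_right)
  qed
qed

text \<open>The operator \<open>a \<mapsto> a m\<close> is bounded by K times the norm of m, with K
  independent of m, and its even adjoint has the same bound. Evaluated at a fixed x, this becomes a
  bound linear in the norm of m. The argument for B is the same.\<close>

lemma dual_products_bounded:
  "x \<in> A2 \<Longrightarrow> \<exists>K. \<forall>m\<in>carr M. nrm (dual M (2 * n)) (dual_lprod A M n x m) \<le> K * nrm (dual M 0) m"
  "z \<in> B2 \<Longrightarrow> \<exists>K. \<forall>m\<in>carr M. nrm (dual M (2 * n)) (dual_rprod B M n m z) \<le> K * nrm (dual M 0) m"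
proof -
  obtain K where K: "\<And>m. m \<in> carr M \<Longrightarrow>
      bounded_op (dual A 0) (dual M 0) (K * nrm (dual M 0) m) (\<lambda>a. lmod M a m)"
    using bounded_bilinear_opD[OF bilinear(3) seminormed_0(1,3)] by blast
  have "nrm (dual M (2 * n)) (dual_lprod A M n x m) \<le> K * nrm (dual M 0) m * nrm (dual A (2 * n)) x"
    if "x \<in> A2" "m \<in> carr M" for x m
    unfolding dual_actions
    by (rule bounded_opD(5)[OF bounded_op_even_adjoint[OF tower_A tower_M K[OF that(2)] order_refl] that(1)])
  then show "x \<in> A2 \<Longrightarrow> \<exists>K. \<forall>m\<in>carr M. nrm (dual M (2 * n)) (dual_lprod A M n x m) \<le> K * nrm (dual M 0) m"
    by (intro exI[of _ "K * nrm (dual A (2 * n)) x"]) (simp add: mult_ac)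
  obtain L where L: "\<And>m. m \<in> carr M \<Longrightarrow>
      bounded_op (dual B 0) (dual M 0) (L * nrm (dual M 0) m) (rmod M m)"
    using bounded_bilinear_opD[OF bilinear(4) seminormed_0(3,2)] by blast
  have "nrm (dual M (2 * n)) (dual_rprod B M n m z) \<le> L * nrm (dual M 0) m * nrm (dual B (2 * n)) z"
    if "z \<in> B2" "m \<in> carr M" for z m
    unfolding dual_actions
    by (rule bounded_opD(5)[OF bounded_op_even_adjoint[OF tower_B tower_M L[OF that(2)] order_refl] that(1)])
  then show "z \<in> B2 \<Longrightarrow> \<exists>K. \<forall>m\<in>carr M. nrm (dual M (2 * n)) (dual_rprod B M n m z) \<le> K * nrm (dual M 0) m"
    by (intro exI[of _ "L * nrm (dual B (2 * n)) z"]) (simp add: mult_ac)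
qed

text \<open>The elements x and z are arbitrary here, and the commutators x a - a x and z b - b z
  measure how far the operator is from a module map. They vanish for central elements; if x and z
  induce the diagonal parts of a derivation, they cancel the corresponding terms of its corner
  part.\<close>

lemma rosenblum_props:
  assumes x: "x \<in> A2" and z: "z \<in> B2"
  defines "\<rho> \<equiv> rosenblum A B M n x z"
  shows "m \<in> carr M \<Longrightarrow> \<rho> m = dual_lprod A M n x m - dual_rprod B M n m z"
    and "m \<in> carr M \<Longrightarrow> \<rho> m \<in> M2"
    and "additive_on (carr M) \<rho>"
    and "\<exists>K. \<forall>m\<in>carr M. nrm (dual M (2 * n)) (\<rho> m) \<le> K * nrm (dual M 0) m"
    and "m \<in> carr M \<Longrightarrow> \<alpha> \<in> pts R \<Longrightarrow> \<rho> (lact M \<alpha> m) = dual_left M n (lact M) \<alpha> (\<rho> m)"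
    and "m \<in> carr M \<Longrightarrow> \<alpha> \<in> pts R \<Longrightarrow> \<rho> (ract M m \<alpha>) = dual_right M n (ract M) (\<rho> m) \<alpha>"
    and "m \<in> carr M \<Longrightarrow> a \<in> carr A \<Longrightarrow> \<rho> (lmod M a m) =
      dual_lprod A M n (dual_right A n (mul A) x a - dual_left A n (mul A) a x) m
      + dual_left M n (lmod M) a (\<rho> m)"
    and "m \<in> carr M \<Longrightarrow> b \<in> carr B \<Longrightarrow> \<rho> (rmod M m b) =
      dual_rprod B M n m (dual_right B n (mul B) z b - dual_left B n (mul B) b z)
      + dual_right M n (rmod M) (\<rho> m) b"
    and "vanishes_off (carr M) \<rho>"
proof -
  note sM2 = seminormedD[OF seminormed_2n(3)]
  show eq: "m \<in> carr M \<Longrightarrow> \<rho> m = dual_lprod A M n x m - dual_rprod B M n m z" for m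
    by (simp add: \<rho>_def rosenblum_def)
  show "m \<in> carr M \<Longrightarrow> \<rho> m \<in> M2" using sM2(6) x z by (simp add: eq)
  show "vanishes_off (carr M) \<rho>" by (simp add: vanishes_off_def \<rho>_def rosenblum_def)
  have "dual_lprod A M n x (m + m') = dual_lprod A M n x m + dual_lprod A M n x m'"
    "dual_rprod B M n (m + m') z = dual_rprod B M n m z + dual_rprod B M n m' z"
    "m + m' \<in> carr M"
    if "m \<in> carr M" "m' \<in> carr M" for m m'
  proof -
    show mm: "m + m' \<in> carr M" using seminormedD(5)[OF seminormed_0(3)] that by blast
    show "dual_lprod A M n x (m + m') = dual_lprod A M n x m + dual_lprod A M n x m'"
      unfolding dual_actions using that x mm additive_products
      by (intro even_adjoint_sum[OF tower_A tower_M] bounded_map_products) auto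
    show "dual_rprod B M n (m + m') z = dual_rprod B M n m z + dual_rprod B M n m' z"
      unfolding dual_actions using that z mm additive_products
      by (intro even_adjoint_sum[OF tower_B tower_M] bounded_map_products) auto
  qed
  then show "additive_on (carr M) \<rho>" by (simp add: additive_on_def eq)
  have "\<exists>K. \<forall>m\<in>carr M. nrm (dual M (2 * n)) (dual_lprod A M n x m + (-1) *\<^sub>C dual_rprod B M n m z)
      \<le> K * nrm (dual M 0) m"
  proof (rule bounded_add[OF seminormed_2n(3) _ _ dual_products_bounded(1)[OF x]
        bounded_scale[OF seminormed_2n(3) _ dual_products_bounded(2)[OF z]]])
  qed (use x z sM2(7,8) in simp_all)
  then show "\<exists>K. \<forall>m\<in>carr M. nrm (dual M (2 * n)) (\<rho> m) \<le> K * nrm (dual M 0) m"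
    by (simp add: eq)
  show "m \<in> carr M \<Longrightarrow> \<alpha> \<in> pts R \<Longrightarrow> \<rho> (lact M \<alpha> m) = dual_left M n (lact M) \<alpha> (\<rho> m)"
    using x z linear_MM(6)[OF bounded_map_actions(5), folded dual_left_even_adjoint]
    by (simp add: eq dual_action_laws)
  show "m \<in> carr M \<Longrightarrow> \<alpha> \<in> pts R \<Longrightarrow> \<rho> (ract M m \<alpha>) = dual_right M n (ract M) (\<rho> m) \<alpha>"
    using x z linear_MM(6)[OF bounded_map_actions(6), folded dual_right_even_adjoint]
    by (simp add: eq dual_action_laws)
  show "\<rho> (lmod M a m) =
      dual_lprod A M n (dual_right A n (mul A) x a - dual_left A n (mul A) a x) m
      + dual_left M n (lmod M) a (\<rho> m)" if m: "m \<in> carr M" and a: "a \<in> carr A"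
  proof -
    \<comment> \<open>Since x (a m) = (x a) m, subtracting and adding (a x) m = a (x m) splits off
      the commutator.\<close>
    note d = dual_laws[OF x z a zero_in(2) m]
    have "dual_lprod A M n (dual_right A n (mul A) x a - dual_left A n (mul A) a x) m =
        dual_lprod A M n (dual_right A n (mul A) x a) m - dual_lprod A M n (dual_left A n (mul A) a x) m"
      unfolding dual_lprod_even_adjoint using a x m by (intro linear_AM(6) bounded_map_products) auto
    moreover have "dual_left M n (lmod M) a (\<rho> m) =
        dual_left M n (lmod M) a (dual_lprod A M n x m) - dual_left M n (lmod M) a (dual_rprod B M n m z)"
      unfolding dual_left_even_adjoint eq[OF m] using a x z m by (intro linear_MM(6) bounded_map_products) auto
    ultimately show ?thesis using m a by (simp add: eq d)
  qed
  show "\<rho> (rmod M m b) =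
      dual_rprod B M n m (dual_right B n (mul B) z b - dual_left B n (mul B) b z)
      + dual_right M n (rmod M) (\<rho> m) b" if m: "m \<in> carr M" and b: "b \<in> carr B"
  proof -
    note d = dual_laws[OF x z zero_in(1) b m]
    have "dual_rprod B M n m (dual_right B n (mul B) z b - dual_left B n (mul B) b z) =
        dual_rprod B M n m (dual_right B n (mul B) z b) - dual_rprod B M n m (dual_left B n (mul B) b z)"
      unfolding dual_rprod_even_adjoint using b z m by (intro linear_BM(6) bounded_map_products) auto
    moreover have "dual_right M n (rmod M) (\<rho> m) b =
        dual_right M n (rmod M) (dual_lprod A M n x m) b - dual_right M n (rmod M) (dual_rprod B M n m z) b"
      unfolding dual_right_even_adjoint eq[OF m] using b x z m by (intro linear_MM(6) bounded_map_products) auto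
    ultimately show ?thesis using m b by (simp add: eq d)
  qed
qed

lemma ZR_subset_Hom: "ZR A B M n \<subseteq> Hom R A B M n"
proof
  fix \<phi> assume "\<phi> \<in> ZR A B M n"
  then obtain x z where xz: "x \<in> A2" "z \<in> B2" and \<phi>: "\<phi> = rosenblum A B M n x z"
    and c: "\<And>a. a \<in> carr A \<Longrightarrow> dual_right A n (mul A) x a = dual_left A n (mul A) a x"
      "\<And>b. b \<in> carr B \<Longrightarrow> dual_right B n (mul B) z b = dual_left B n (mul B) b z"
    by (auto simp: ZR_def dual_centre_def)
  show "\<phi> \<in> Hom R A B M n"
    unfolding Hom_iff \<phi> using rosenblum_props[OF xz] c by simp
qed

lemma csubspace_dual_centre: "csubspace (dual_centre A n)" "csubspace (dual_centre B n)"
proof -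
  note l = linear_AA[OF bounded_map_products(1)] linear_AA[OF bounded_map_products(2)]
  show "csubspace (dual_centre A n)"
    unfolding cvec.subspace_def dual_centre_def using seminormedD(2,5,8)[OF seminormed_2n(1)] l
    by (auto simp: dual_actions)
  note l = linear_BB[OF bounded_map_products(3)] linear_BB[OF bounded_map_products(4)]
  show "csubspace (dual_centre B n)"
    unfolding cvec.subspace_def dual_centre_def using seminormedD(2,5,8)[OF seminormed_2n(2)] l
    by (auto simp: dual_actions)
qed

lemma rosenblum_in_ZR: "x \<in> dual_centre A n \<Longrightarrow> z \<in> dual_centre B n \<Longrightarrow> rosenblum A B M n x z \<in> ZR A B M n"
  by (auto simp: ZR_def)

text \<open>The operator depends linearly on the pair (x, z), and the pairs of central elements form
  a subspace.\<close>

lemma csubspace_ZR: "csubspace (ZR A B M n)"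
  unfolding cvec.subspace_def
proof (intro conjI ballI allI)
  note l = linear_AM[OF bounded_map_products(6)] linear_BM[OF bounded_map_products(7)]
  note s = cvec.subspace_0 cvec.subspace_add cvec.subspace_scale
  note sA = s[OF csubspace_dual_centre(1)] and sB = s[OF csubspace_dual_centre(2)]
  have "rosenblum A B M n 0 0 = 0" by (auto simp: rosenblum_def fun_eq_iff)
  then show "0 \<in> ZR A B M n" using rosenblum_in_ZR[OF sA(1) sB(1)] by simp
  show "\<phi> + \<phi>' \<in> ZR A B M n" if \<phi>: "\<phi> \<in> ZR A B M n" "\<phi>' \<in> ZR A B M n" for \<phi> \<phi>'
  proof -
    obtain x z x' z' where c: "x \<in> dual_centre A n" "z \<in> dual_centre B n"
        "x' \<in> dual_centre A n" "z' \<in> dual_centre B n"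
      and e: "\<phi> = rosenblum A B M n x z" "\<phi>' = rosenblum A B M n x' z'"
      using \<phi> by (auto simp: ZR_def)
    have "\<phi> + \<phi>' = rosenblum A B M n (x + x') (z + z')"
      using c l by (auto simp: e rosenblum_def fun_eq_iff dual_actions dual_centre_def)
    then show ?thesis using c sA sB rosenblum_in_ZR by simp
  qed
  show "c *\<^sub>C \<phi> \<in> ZR A B M n" if \<phi>: "\<phi> \<in> ZR A B M n" for c \<phi>
  proof -
    obtain x z where xz: "x \<in> dual_centre A n" "z \<in> dual_centre B n"
      and e: "\<phi> = rosenblum A B M n x z"
      using \<phi> by (auto simp: ZR_def)
    have "c *\<^sub>C \<phi> = rosenblum A B M n (c *\<^sub>C x) (c *\<^sub>C z)"
      using xz l by (auto simp: e rosenblum_def fun_eq_iff dual_actions dual_centre_def scaleC_fun_def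
          cvec.scale_right_diff_distrib)
    then show ?thesis using xz sA sB rosenblum_in_ZR by simp
  qed
qed


subsection \<open>The derivation of a corner map\<close>

lemma Delta_corner_map:
  "Delta A B M (corner_map \<phi>) (a, m, b) =
    (if a \<in> carr A \<and> m \<in> carr M \<and> b \<in> carr B then (0, \<phi> m, 0) else 0)"
  by (auto simp: Delta_def corner_map_def)

text \<open>The corner of a product is a m' + m b', and the module property turns its image into a
  \<phi>(m') + \<phi>(m) b'. These are the corners of the two Leibniz terms, since the values of the
  map have zero diagonal.\<close>

lemma Delta_Z1:
  assumes \<phi>: "\<phi> \<in> Hom R A B M n"
  shows "Delta A B M (corner_map \<phi>) \<in> Z1 (scalar_matrices R) T n"
proof -
  note h = \<phi>[unfolded Hom_iff]
  have into: "\<phi> m \<in> M2" if "m \<in> carr M" for m using h that by blast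
  have add: "\<phi> (m + m') = \<phi> m + \<phi> m'" if "m \<in> carr M" "m' \<in> carr M" for m m'
    using h that by (simp add: additive_on_def)
  note s = seminormedD(5)[OF seminormed_0(1)] seminormedD(5)[OF seminormed_0(2)]
    seminormedD(5)[OF seminormed_0(3)]
  obtain K where K: "\<And>m. m \<in> carr M \<Longrightarrow> nrm (dual M (2 * n)) (\<phi> m) \<le> K * nrm (dual M 0) m"
    using h by blast
  \<comment> \<open>The norm on the 2n-th dual of the matrices is a dual norm, not defined as a sum
    of entry norms. The constant L comes from the insertion of the corner, seen as an even
    adjoint.\<close>
  obtain L where L: "\<And>y. y \<in> M2 \<Longrightarrow> nrm (dual T (2 * n)) (0, y, 0) \<le> L * nrm (dual M (2 * n)) y"
    using even_adjoint_linear(7)[OF tower_M tower_T bounded_map_entries(4)] even_adjoint_entries(4) by auto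
  have "nrm (dual T (2 * n)) (Delta A B M (corner_map \<phi>) t) \<le> (\<bar>L\<bar> * \<bar>K\<bar>) * nrm (dual T 0) t"
    if tT: "t \<in> carr T" for t
  proof -
    obtain a m b where t: "t = (a, m, b)" "a \<in> carr A" "m \<in> carr M" "b \<in> carr B"
      using tT by auto
    have n0: "0 \<le> nrm (dual A 0) a" "0 \<le> nrm (dual M 0) m" "0 \<le> nrm (dual B 0) b"
      using t seminormedD(4) seminormed_0 by auto
    have "K * nrm (dual M 0) m \<le> \<bar>K\<bar> * nrm (dual T 0) t"
      using n0 by (intro mult_mono) (auto simp: t(1))
    with K[OF t(3)] have "nrm (dual M (2 * n)) (\<phi> m) \<le> \<bar>K\<bar> * nrm (dual T 0) t" by linarith
    then have "\<bar>L\<bar> * nrm (dual M (2 * n)) (\<phi> m) \<le> \<bar>L\<bar> * (\<bar>K\<bar> * nrm (dual T 0) t)"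
      by (rule mult_left_mono) simp
    moreover have "L * nrm (dual M (2 * n)) (\<phi> m) \<le> \<bar>L\<bar> * nrm (dual M (2 * n)) (\<phi> m)"
      using seminormedD(4)[OF seminormed_2n(3) into[OF t(3)]] by (intro mult_right_mono) auto
    ultimately show ?thesis
      using L[OF into[OF t(3)]] t by (simp add: Delta_corner_map mult.assoc)
  qed
  then have "\<exists>K. \<forall>t\<in>carr T. nrm (dual T (2 * n)) (Delta A B M (corner_map \<phi>) t) \<le> K * nrm (dual T 0) t"
    by blast
  moreover have "\<forall>t\<in>carr T. Delta A B M (corner_map \<phi>) t \<in> dpts T (2 * n)"
    using into zero_in by (auto simp: Delta_corner_map)
  moreover have "additive_on (carr T) (Delta A B M (corner_map \<phi>))"
    using add s by (auto simp: additive_on_def Delta_corner_map)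
  moreover have "\<forall>s\<in>scalar_matrices R. \<forall>t\<in>carr T.
      Delta A B M (corner_map \<phi>) (lact T s t) = dual_left T n (lact T) s (Delta A B M (corner_map \<phi>) t) \<and>
      Delta A B M (corner_map \<phi>) (ract T t s) = dual_right T n (ract T) (Delta A B M (corner_map \<phi>) t) s"
    using into h zero_in by (auto simp: Delta_corner_map dual_actions_T)
  moreover have "\<forall>s\<in>carr T. \<forall>t\<in>carr T. Delta A B M (corner_map \<phi>) (mul T s t) =
      dual_right T n (mul T) (Delta A B M (corner_map \<phi>) s) t
      + dual_left T n (mul T) s (Delta A B M (corner_map \<phi>) t)"
    using into h zero_in add s by (auto simp: Delta_corner_map dual_actions_T)
  moreover have "vanishes_off (carr T) (Delta A B M (corner_map \<phi>))"
    by (auto simp: vanishes_off_def Delta_corner_map)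
  ultimately show ?thesis unfolding Z1_def module_derivation_def by blast
qed

text \<open>For F = (x, y, z) the inner derivation has diagonal a x - x a, b z - z b and, at
  matrices with a = b = 0, corner m z - x m. The diagonal vanishes exactly for central x and z, and
  the corner is the Rosenblum operator of -x and -z.\<close>

lemma Delta_N1_iff:
  assumes \<phi>: "\<phi> \<in> Hom R A B M n"
  shows "Delta A B M (corner_map \<phi>) \<in> N1 (scalar_matrices R) T n \<longleftrightarrow> \<phi> \<in> ZR A B M n"
proof
  note lA = linear_AA(5)[OF bounded_map_products(1)] linear_AA(5)[OF bounded_map_products(2)]
    linear_BB(5)[OF bounded_map_products(3)] linear_BB(5)[OF bounded_map_products(4)]
    linear_AM(5)[OF bounded_map_products(6)] linear_BM(5)[OF bounded_map_products(7)]
  note neg = lA[folded dual_left_even_adjoint dual_right_even_adjoint dual_lprod_even_adjoint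
      dual_rprod_even_adjoint]
  note nA = seminormedD(7)[OF seminormed_2n(1)] and nB = seminormedD(7)[OF seminormed_2n(2)]
  {
    assume "Delta A B M (corner_map \<phi>) \<in> N1 (scalar_matrices R) T n"
    then obtain F where F: "F \<in> dpts T (2 * n)" and eq: "\<And>t. t \<in> carr T \<Longrightarrow>
        Delta A B M (corner_map \<phi>) t = dual_left T n (mul T) t F - dual_right T n (mul T) F t"
      unfolding N1_def inner_derivation_def by blast
    obtain x y z where xyz: "F = (x, y, z)" "x \<in> A2" "y \<in> M2" "z \<in> B2" using F by auto
    have e: "(0, \<phi> m, 0) =
        (dual_left A n (mul A) a x, dual_left M n (lmod M) a y + dual_rprod B M n m z,
         dual_left B n (mul B) b z) -
        (dual_right A n (mul A) x a, dual_lprod A M n x m + dual_right M n (rmod M) y b,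
         dual_right B n (mul B) z b)" if "a \<in> carr A" "m \<in> carr M" "b \<in> carr B" for a m b
      using eq[of "(a, m, b)"] that xyz by (simp add: Delta_corner_map dual_actions_T)
    \<comment> \<open>Matrices with a single nonzero entry isolate the three conditions.\<close>
    have "- x \<in> dual_centre A n"
      unfolding dual_centre_def using e[OF _ zero_in(3,2)] xyz nA by (auto simp: neg)
    moreover have "- z \<in> dual_centre B n"
      unfolding dual_centre_def using e[OF zero_in(1,3)] xyz nB by (auto simp: neg)
    moreover have "\<phi> m = rosenblum A B M n (- x) (- z) m" for m
    proof (cases "m \<in> carr M")
      case True
      then show ?thesis using e[OF zero_in(1) True zero_in(2)] xyz by (simp add: rosenblum_def neg)
    next
      case False
      then show ?thesis using \<phi> by (simp add: rosenblum_def Hom_iff vanishes_off_def)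
    qed
    then have "\<phi> = rosenblum A B M n (- x) (- z)" ..
    ultimately show "\<phi> \<in> ZR A B M n" using rosenblum_in_ZR by simp
  }
  assume "\<phi> \<in> ZR A B M n"
  then obtain x z where xz: "x \<in> A2" "z \<in> B2" and e: "\<phi> = rosenblum A B M n x z"
    and c: "\<And>a. a \<in> carr A \<Longrightarrow> dual_right A n (mul A) x a = dual_left A n (mul A) a x"
      "\<And>b. b \<in> carr B \<Longrightarrow> dual_right B n (mul B) z b = dual_left B n (mul B) b z"
    by (auto simp: ZR_def dual_centre_def)
  \<comment> \<open>The corner y of the inducing element has to be 0: at a = 1, m = 0, b = 0 the
    equation of corners reads y = 0.\<close>
  have "Delta A B M (corner_map \<phi>) t =
      dual_left T n (mul T) t (- x, 0, - z) - dual_right T n (mul T) (- x, 0, - z) t" if "t \<in> carr T" for t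
    using that xz nA nB zero_in c by (auto simp: Delta_corner_map dual_actions_T neg e rosenblum_def)
  moreover have "(- x, 0, - z) \<in> dpts T (2 * n)" using xz nA nB zero_in by simp
  ultimately have "inner_derivation T n (Delta A B M (corner_map \<phi>))"
    unfolding inner_derivation_def by blast
  then show "Delta A B M (corner_map \<phi>) \<in> N1 (scalar_matrices R) T n"
    using Delta_Z1[OF \<phi>] by (simp add: N1_def)
qed

subsection \<open>Derivations modulo inner derivations\<close>

lemma Z1_TD:
  assumes "D \<in> Z1 (scalar_matrices R) T n"
  shows "t \<in> carr T \<Longrightarrow> D t \<in> A2 \<times> M2 \<times> B2"
    and "s \<in> carr T \<Longrightarrow> t \<in> carr T \<Longrightarrow> D (s + t) = D s + D t"
    and "s \<in> carr T \<Longrightarrow> t \<in> carr T \<Longrightarrow>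
      D (mul T s t) = dual_right T n (mul T) (D s) t + dual_left T n (mul T) s (D t)"
    and "\<alpha> \<in> pts R \<Longrightarrow> t \<in> carr T \<Longrightarrow> D (lact T (Diag \<alpha>) t) = dual_left T n (lact T) (Diag \<alpha>) (D t)"
    and "\<alpha> \<in> pts R \<Longrightarrow> t \<in> carr T \<Longrightarrow> D (ract T t (Diag \<alpha>)) = dual_right T n (ract T) (D t) (Diag \<alpha>)"
    and "\<exists>K. \<forall>t\<in>carr T. nrm (dual T (2 * n)) (D t) \<le> K * nrm (dual T 0) t"
  using assms unfolding Z1_def module_derivation_def additive_on_def mem_Collect_eq Tri_sel(1)[of A M B "2 * n"]
  by blast+

text \<open>Evaluating the Leibniz rule on products with the two diagonal idempotents determines the
  shape of a derivation.\<close>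

lemma derivation_entries:
  assumes D: "D \<in> Z1 (scalar_matrices R) T n"
  obtains \<gamma> where "\<gamma> \<in> M2"
    and "\<And>a. a \<in> carr A \<Longrightarrow> D (a, 0, 0) = (fst (D (a, 0, 0)), dual_left M n (lmod M) a \<gamma>, 0)"
    and "\<And>m. m \<in> carr M \<Longrightarrow> D (0, m, 0) = (0, fst (snd (D (0, m, 0))), 0)"
    and "\<And>b. b \<in> carr B \<Longrightarrow> D (0, 0, b) = (0, - dual_right M n (rmod M) \<gamma> b, snd (snd (D (0, 0, b))))"
proof -
  note into = Z1_TD(1)[OF D] and add = Z1_TD(2)[OF D] and leib = Z1_TD(3)[OF D]
  note z = zero_in
  let ?p = "(one A, 0, 0) :: 'a \<times> 'm \<times> 'b" and ?q = "(0, 0, one B) :: 'a \<times> 'm \<times> 'b"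
  obtain x0 \<gamma> z0 where p: "D ?p = (x0, \<gamma>, z0)" "x0 \<in> A2" "\<gamma> \<in> M2" "z0 \<in> B2"
    using into[of ?p] z by (cases "D ?p") auto
  obtain x1 y1 z1 where q: "D ?q = (x1, y1, z1)" "x1 \<in> A2" "y1 \<in> M2" "z1 \<in> B2"
    using into[of ?q] z by (cases "D ?q") auto
  \<comment> \<open>On the diagonal, p p = p gives x0 = x0 + x0 and z0 = 0; it says nothing about
    the corner.\<close>
  have p0: "x0 = 0" "z0 = 0"
    using leib[of ?p ?p] p z by (simp_all add: dual_actions_T)
  have q0: "x1 = 0" "z1 = 0"
    using leib[of ?q ?q] q z by (simp_all add: dual_actions_T)
  have D0: "D (0, 0, 0) = 0" using add[of "(0, 0, 0)" "(0, 0, 0)"] z by simp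
  \<comment> \<open>From p q = 0: the corner of D p times q is \<gamma>, that of p times D q is
    y1.\<close>
  have "\<gamma> + y1 = 0"
    using leib[of ?p ?q] p q p0 q0 z D0 by (simp add: dual_actions_T zero_prod_def)
  then have y1: "y1 = - \<gamma>" by (simp add: add_eq_0_iff)
  have "D (a, 0, 0) = (fst (D (a, 0, 0)), dual_left M n (lmod M) a \<gamma>, 0)" if a: "a \<in> carr A" for a
  proof -
    obtain x y w where e: "D (a, 0, 0) = (x, y, w)" "x \<in> A2" "y \<in> M2" "w \<in> B2"
      using into[of "(a, 0, 0)"] z a by (cases "D (a, 0, 0)") auto
    \<comment> \<open>Here (a, 0, 0) p = (a, 0, 0), so only a \<gamma> reaches the corner.\<close>
    show ?thesis using leib[of "(a, 0, 0)" ?p] p p0 e z a by (simp add: dual_actions_T)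
  qed
  moreover have "D (0, m, 0) = (0, fst (snd (D (0, m, 0))), 0)" if m: "m \<in> carr M" for m
  proof -
    obtain x y w where e: "D (0, m, 0) = (x, y, w)" "x \<in> A2" "y \<in> M2" "w \<in> B2"
      using into[of "(0, m, 0)"] z m by (cases "D (0, m, 0)") auto
    \<comment> \<open>Multiplying by p on the left kills the lower diagonal entry, by q on the right
      the upper one; both leave (0, m, 0) unchanged.\<close>
    have "w = 0" using leib[of ?p "(0, m, 0)"] p p0 e z m by (simp add: dual_actions_T)
    moreover have "x = 0" using leib[of "(0, m, 0)" ?q] q q0 e z m by (simp add: dual_actions_T)
    ultimately show ?thesis by (simp add: e(1))
  qed
  moreover have "D (0, 0, b) = (0, - dual_right M n (rmod M) \<gamma> b, snd (snd (D (0, 0, b))))"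
    if b: "b \<in> carr B" for b
  proof -
    obtain x y w where e: "D (0, 0, b) = (x, y, w)" "x \<in> A2" "y \<in> M2" "w \<in> B2"
      using into[of "(0, 0, b)"] z b by (cases "D (0, 0, b)") auto
    have "dual_right M n (rmod M) y1 b = - dual_right M n (rmod M) \<gamma> b"
      unfolding y1 dual_right_even_adjoint by (rule linear_MM(5)[OF bounded_map_products(8)[OF b] p(3)])
    then show ?thesis using leib[of ?q "(0, 0, b)"] q q0 e z b by (simp add: dual_actions_T)
  qed
  ultimately show ?thesis using that p(3) by blast
qed

text \<open>The embeddings of A and B as diagonal entries respect products and actions, and the dual
  actions of such matrices act entrywise on the diagonal, so every condition on D passes to the
  entry. These are the derivations to which weak module amenability is applied.\<close>

lemma derivation_diagonal:
  assumes D: "D \<in> Z1 (scalar_matrices R) T n"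
  shows "module_derivation (pts R) A n (\<lambda>a. fst (D (a, 0, 0)))"
    and "module_derivation (pts R) B n (\<lambda>b. snd (snd (D (0, 0, b))))"
proof -
  note into = Z1_TD(1)[OF D] and add = Z1_TD(2)[OF D] and leib = Z1_TD(3)[OF D]
  note act = Z1_TD(4,5)[OF D]
  note z = zero_in
  obtain K where K: "\<And>t. t \<in> carr T \<Longrightarrow> nrm (dual T (2 * n)) (D t) \<le> K * nrm (dual T 0) t"
    using Z1_TD(6)[OF D] by blast
  note entry = bounded_op_even_adjoint[OF tower_T _ _ order_refl]
  \<comment> \<open>Reading off an entry has bound 1 on matrices, and its even adjoint, again the
    entry, keeps this bound.\<close>
  have le: "nrm (dual A (2 * n)) (fst F) \<le> nrm (dual T (2 * n)) F"
    "nrm (dual B (2 * n)) (snd (snd F)) \<le> nrm (dual T (2 * n)) F" if "F \<in> dpts T (2 * n)" for F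
    using bounded_opD(5)[OF entry[OF tower_A bounded_op_entries(1)] that] even_adjoint_entries(1)[OF that]
      bounded_opD(5)[OF entry[OF tower_B bounded_op_entries(3)] that] even_adjoint_entries(3)[OF that]
    by simp_all
  have nrm0: "nrm (dual A 0) 0 = 0" "nrm (dual M 0) 0 = 0" "nrm (dual B 0) 0 = 0"
    using seminormedD(3) seminormed_0 by auto
  have A: "\<exists>x y w. D (a, 0, 0) = (x, y, w) \<and> x \<in> A2 \<and> y \<in> M2 \<and> w \<in> B2" if "a \<in> carr A" for a
    using into[of "(a, 0, 0)"] z that by (cases "D (a, 0, 0)") auto
  have B: "\<exists>x y w. D (0, 0, b) = (x, y, w) \<and> x \<in> A2 \<and> y \<in> M2 \<and> w \<in> B2" if "b \<in> carr B" for b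
    using into[of "(0, 0, b)"] z that by (cases "D (0, 0, b)") auto
  show "module_derivation (pts R) A n (\<lambda>a. fst (D (a, 0, 0)))"
    unfolding module_derivation_def
  proof (intro conjI ballI)
    show "additive_on (carr A) (\<lambda>a. fst (D (a, 0, 0)))"
      unfolding additive_on_def
    proof (intro ballI)
      fix a a' assume "a \<in> carr A" "a' \<in> carr A"
      then show "fst (D (a + a', 0, 0)) = fst (D (a, 0, 0)) + fst (D (a', 0, 0))"
        using add[of "(a, 0, 0)" "(a', 0, 0)"] z by simp
    qed
    show "\<exists>K. \<forall>a\<in>carr A. nrm (dual A (2 * n)) (fst (D (a, 0, 0))) \<le> K * nrm (dual A 0) a"
    proof (intro exI ballI)
      fix a assume a: "a \<in> carr A"
      then have t: "(a, 0, 0) \<in> carr T" using z by simp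
      show "nrm (dual A (2 * n)) (fst (D (a, 0, 0))) \<le> K * nrm (dual A 0) a"
        using le(1)[of "D (a, 0, 0)"] into[OF t] K[OF t] nrm0 by simp
    qed
    show "fst (D (a, 0, 0)) \<in> A2" if "a \<in> carr A" for a using A[OF that] by auto
    show "fst (D (lact A \<alpha> a, 0, 0)) = dual_left A n (lact A) \<alpha> (fst (D (a, 0, 0)))"
      "fst (D (ract A a \<alpha>, 0, 0)) = dual_right A n (ract A) (fst (D (a, 0, 0))) \<alpha>"
      if \<alpha>: "\<alpha> \<in> pts R" "a \<in> carr A" for \<alpha> a
      using A[OF \<alpha>(2)] act[OF \<alpha>(1), of "(a, 0, 0)"] \<alpha> z by (auto simp: dual_actions_T)
    show "fst (D (mul A a a', 0, 0)) = dual_right A n (mul A) (fst (D (a, 0, 0))) a' +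
        dual_left A n (mul A) a (fst (D (a', 0, 0)))" if aa: "a \<in> carr A" "a' \<in> carr A" for a a'
      using A[OF aa(1)] A[OF aa(2)] leib[of "(a, 0, 0)" "(a', 0, 0)"] aa z by (auto simp: dual_actions_T)
  qed
  show "module_derivation (pts R) B n (\<lambda>b. snd (snd (D (0, 0, b))))"
    unfolding module_derivation_def
  proof (intro conjI ballI)
    show "additive_on (carr B) (\<lambda>b. snd (snd (D (0, 0, b))))"
      unfolding additive_on_def
    proof (intro ballI)
      fix b b' assume "b \<in> carr B" "b' \<in> carr B"
      then show "snd (snd (D (0, 0, b + b'))) = snd (snd (D (0, 0, b))) + snd (snd (D (0, 0, b')))"
        using add[of "(0, 0, b)" "(0, 0, b')"] z by simp
    qed
    show "\<exists>K. \<forall>b\<in>carr B. nrm (dual B (2 * n)) (snd (snd (D (0, 0, b)))) \<le> K * nrm (dual B 0) b"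
    proof (intro exI ballI)
      fix b assume b: "b \<in> carr B"
      then have t: "(0, 0, b) \<in> carr T" using z by simp
      show "nrm (dual B (2 * n)) (snd (snd (D (0, 0, b)))) \<le> K * nrm (dual B 0) b"
        using le(2)[of "D (0, 0, b)"] into[OF t] K[OF t] nrm0 by simp
    qed
    show "snd (snd (D (0, 0, b))) \<in> B2" if "b \<in> carr B" for b using B[OF that] by auto
    show "snd (snd (D (0, 0, lact B \<alpha> b))) = dual_left B n (lact B) \<alpha> (snd (snd (D (0, 0, b))))"
      "snd (snd (D (0, 0, ract B b \<alpha>))) = dual_right B n (ract B) (snd (snd (D (0, 0, b)))) \<alpha>"
      if \<alpha>: "\<alpha> \<in> pts R" "b \<in> carr B" for \<alpha> b
      using B[OF \<alpha>(2)] act[OF \<alpha>(1), of "(0, 0, b)"] \<alpha> z by (auto simp: dual_actions_T)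
    show "snd (snd (D (0, 0, mul B b b'))) = dual_right B n (mul B) (snd (snd (D (0, 0, b)))) b' +
        dual_left B n (mul B) b (snd (snd (D (0, 0, b'))))" if bb: "b \<in> carr B" "b' \<in> carr B" for b b'
      using B[OF bb(1)] B[OF bb(2)] leib[of "(0, 0, b)" "(0, 0, b')"] bb z by (auto simp: dual_actions_T)
  qed
qed

text \<open>The corner part \<open>dM\<close> need not be a module map: its value at a m has the
  extra term (\<open>dA\<close> a) m. As \<open>dA\<close> a = a x - x a, adding the Rosenblum
  operator of x and z contributes the commutator x a - a x and cancels that term; the same happens
  on the right.\<close>

lemma derivation_decomposition:
  assumes D: "D \<in> Z1 (scalar_matrices R) T n"
    and A: "even_weakly_module_amenable (pts R) A n" and B: "even_weakly_module_amenable (pts R) B n"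
  shows "\<exists>\<phi>\<in>Hom R A B M n. D - Delta A B M (corner_map \<phi>) \<in> N1 (scalar_matrices R) T n"
proof -
  note into = Z1_TD(1)[OF D] and add = Z1_TD(2)[OF D] and leib = Z1_TD(3)[OF D]
  note act = Z1_TD(4,5)[OF D]
  obtain K where K: "\<And>t. t \<in> carr T \<Longrightarrow> nrm (dual T (2 * n)) (D t) \<le> K * nrm (dual T 0) t"
    using Z1_TD(6)[OF D] by blast
  note zi = zero_in
  define dA where "dA a = fst (D (a, 0, 0))" for a
  define dM where "dM m = fst (snd (D (0, m, 0)))" for m
  define dB where "dB b = snd (snd (D (0, 0, b)))" for b
  obtain \<gamma> where \<gamma>: "\<gamma> \<in> M2"
    and DA: "\<And>a. a \<in> carr A \<Longrightarrow> D (a, 0, 0) = (dA a, dual_left M n (lmod M) a \<gamma>, 0)"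
    and DM: "\<And>m. m \<in> carr M \<Longrightarrow> D (0, m, 0) = (0, dM m, 0)"
    and DB: "\<And>b. b \<in> carr B \<Longrightarrow> D (0, 0, b) = (0, - dual_right M n (rmod M) \<gamma> b, dB b)"
    by (rule derivation_entries[OF D, folded dA_def dM_def dB_def]) blast
  have in_A: "dA a \<in> A2" if "a \<in> carr A" for a using into[of "(a, 0, 0)"] DA[OF that] that zi by simp
  have in_M: "dM m \<in> M2" if "m \<in> carr M" for m using into[of "(0, m, 0)"] DM[OF that] that zi by simp
  have in_B: "dB b \<in> B2" if "b \<in> carr B" for b using into[of "(0, 0, b)"] DB[OF that] that zi by simp
  have D_eq: "D (a, m, b) =
      (dA a, dual_left M n (lmod M) a \<gamma> + dM m - dual_right M n (rmod M) \<gamma> b, dB b)"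
    if "a \<in> carr A" "m \<in> carr M" "b \<in> carr B" for a m b
    using add[of "(a, 0, 0)" "(0, m, 0)"] add[of "(a, m, 0)" "(0, 0, b)"] that DA DM DB zi by simp
  obtain x where x: "x \<in> A2" "\<And>a. a \<in> carr A \<Longrightarrow> dA a = dual_left A n (mul A) a x - dual_right A n (mul A) x a"
    using A derivation_diagonal(1)[OF D]
    unfolding even_weakly_module_amenable_def inner_derivation_def dA_def by blast
  obtain z where z: "z \<in> B2" "\<And>b. b \<in> carr B \<Longrightarrow> dB b = dual_left B n (mul B) b z - dual_right B n (mul B) z b"
    using B derivation_diagonal(2)[OF D]
    unfolding even_weakly_module_amenable_def inner_derivation_def dB_def by blast
  have sM: "m + m' \<in> carr M" if "m \<in> carr M" "m' \<in> carr M" for m m'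
    using that seminormedD(5)[OF seminormed_0(3)] by blast
  have dM_add: "dM (m + m') = dM m + dM m'" if "m \<in> carr M" "m' \<in> carr M" for m m'
    using add[of "(0, m, 0)" "(0, m', 0)"] that sM DM zi by simp
  have dM_act: "dM (lact M \<alpha> m) = dual_left M n (lact M) \<alpha> (dM m)"
    "dM (ract M m \<alpha>) = dual_right M n (ract M) (dM m) \<alpha>" if "\<alpha> \<in> pts R" "m \<in> carr M" for \<alpha> m
    using act[OF that(1), of "(0, m, 0)"] that DM in_M zi by (simp_all add: dual_actions_T)
  have dM_left: "dM (lmod M a m) = dual_lprod A M n (dA a) m + dual_left M n (lmod M) a (dM m)"
    if "a \<in> carr A" "m \<in> carr M" for a m
    using leib[of "(a, 0, 0)" "(0, m, 0)"] that DM DA in_M in_A \<gamma> zi by (simp add: dual_actions_T)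
  have dM_right: "dM (rmod M m b) = dual_rprod B M n m (dB b) + dual_right M n (rmod M) (dM m) b"
    if "b \<in> carr B" "m \<in> carr M" for b m
    using leib[of "(0, m, 0)" "(0, 0, b)"] that DM DB in_M in_B \<gamma> zi
      seminormedD(7)[OF seminormed_2n(3)] by (simp add: dual_actions_T add.commute)
  have dM_bound: "nrm (dual M (2 * n)) (dM m) \<le> K * nrm (dual M 0) m" if m: "m \<in> carr M" for m
  proof -
    have t: "(0, m, 0) \<in> carr T" using m zi by simp
    have F: "D (0, m, 0) \<in> dpts T (2 * n)" using into[OF t] by simp
    have "nrm (dual M (2 * n)) (dM m) \<le> nrm (dual T (2 * n)) (D (0, m, 0))"
      using bounded_opD(5)[OF bounded_op_even_adjoint[OF tower_T tower_M bounded_op_entries(2) order_refl] F]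
        even_adjoint_entries(2)[OF F] by (simp add: dM_def)
    then show ?thesis
      using K[OF t] seminormedD(3)[OF seminormed_0(1)] seminormedD(3)[OF seminormed_0(2)] by simp
  qed
  define \<rho> where "\<rho> = rosenblum A B M n x z"
  note \<rho> = rosenblum_props[OF x(1) z(1), folded \<rho>_def]
  define \<phi> where "\<phi> m = (if m \<in> carr M then dM m + \<rho> m else 0)" for m
  have neg: "dual_lprod A M n (- w) m = - dual_lprod A M n w m" if "w \<in> A2" "m \<in> carr M" for w m
    unfolding dual_lprod_even_adjoint by (rule linear_AM(5)[OF bounded_map_products(6)[OF that(2)] that(1)])
  have neg': "dual_rprod B M n m (- w) = - dual_rprod B M n m w" if "w \<in> B2" "m \<in> carr M" for w m
    unfolding dual_rprod_even_adjoint by (rule linear_BM(5)[OF bounded_map_products(7)[OF that(2)] that(1)])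
  have \<phi>: "\<phi> \<in> Hom R A B M n"
    unfolding Hom_iff
  proof (intro conjI ballI)
    show "vanishes_off (carr M) \<phi>" by (simp add: vanishes_off_def \<phi>_def)
    show "additive_on (carr M) \<phi>"
      using \<rho>(3) dM_add sM by (simp add: additive_on_def \<phi>_def)
    have "\<exists>K. \<forall>m\<in>carr M. nrm (dual M (2 * n)) (dM m + \<rho> m) \<le> K * nrm (dual M 0) m"
      by (rule bounded_add[OF seminormed_2n(3) in_M \<rho>(2) _ \<rho>(4)]) (use dM_bound in auto)
    then show "\<exists>K. \<forall>m\<in>carr M. nrm (dual M (2 * n)) (\<phi> m) \<le> K * nrm (dual M 0) m"
      by (simp add: \<phi>_def)
    fix m assume m: "m \<in> carr M"
    show "\<phi> m \<in> M2" using seminormedD(5)[OF seminormed_2n(3) in_M[OF m] \<rho>(2)[OF m]] m by (simp add: \<phi>_def)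
    show "\<phi> (lmod M a m) = dual_left M n (lmod M) a (\<phi> m)" if a: "a \<in> carr A" for a
    proof -
      have "dual_right A n (mul A) x a - dual_left A n (mul A) a x = - dA a" using x(2)[OF a] by simp
      moreover have "dual_left M n (lmod M) a (dM m + \<rho> m) =
          dual_left M n (lmod M) a (dM m) + dual_left M n (lmod M) a (\<rho> m)"
        unfolding dual_left_even_adjoint
        by (rule linear_MM(2)[OF bounded_map_products(5)[OF a] in_M[OF m] \<rho>(2)[OF m]])
      ultimately show ?thesis
        using m a \<rho>(7)[OF m a] dM_left[OF a m] neg[OF in_A[OF a] m] by (simp add: \<phi>_def)
    qed
    show "\<phi> (rmod M m b) = dual_right M n (rmod M) (\<phi> m) b" if b: "b \<in> carr B" for b
    proof -
      have "dual_right B n (mul B) z b - dual_left B n (mul B) b z = - dB b" using z(2)[OF b] by simp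
      moreover have "dual_right M n (rmod M) (dM m + \<rho> m) b =
          dual_right M n (rmod M) (dM m) b + dual_right M n (rmod M) (\<rho> m) b"
        unfolding dual_right_even_adjoint
        by (rule linear_MM(2)[OF bounded_map_products(8)[OF b] in_M[OF m] \<rho>(2)[OF m]])
      ultimately show ?thesis
        using m b \<rho>(8)[OF m b] dM_right[OF b m] neg'[OF in_B[OF b] m] by (simp add: \<phi>_def)
    qed
    fix \<alpha> assume \<alpha>: "\<alpha> \<in> pts R"
    show "\<phi> (lact M \<alpha> m) = dual_left M n (lact M) \<alpha> (\<phi> m)"
      using linear_MM(2)[OF bounded_map_actions(5)[OF \<alpha>] in_M[OF m] \<rho>(2)[OF m]] m \<alpha>
        dM_act(1)[OF \<alpha> m] \<rho>(5)[OF m \<alpha>] by (simp add: \<phi>_def dual_left_even_adjoint)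
    show "\<phi> (ract M m \<alpha>) = dual_right M n (ract M) (\<phi> m) \<alpha>"
      using linear_MM(2)[OF bounded_map_actions(6)[OF \<alpha>] in_M[OF m] \<rho>(2)[OF m]] m \<alpha>
        dM_act(2)[OF \<alpha> m] \<rho>(6)[OF m \<alpha>] by (simp add: \<phi>_def dual_right_even_adjoint)
  qed
  \<comment> \<open>In the corner \<open>dM\<close> cancels and a \<gamma> + m z - x m - \<gamma> b
    remains, which is the corner of the inner derivation of (x, \<gamma>, z).\<close>
  have "(D - Delta A B M (corner_map \<phi>)) t =
      dual_left T n (mul T) t (x, \<gamma>, z) - dual_right T n (mul T) (x, \<gamma>, z) t" if "t \<in> carr T" for t
    using that x z \<gamma> by (auto simp: D_eq Delta_corner_map dual_actions_T \<phi>_def \<rho>(1) algebra_simps)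
  moreover have "(x, \<gamma>, z) \<in> dpts T (2 * n)" using x z \<gamma> by simp
  ultimately have "inner_derivation T n (D - Delta A B M (corner_map \<phi>))"
    unfolding inner_derivation_def by blast
  moreover have "D - Delta A B M (corner_map \<phi>) \<in> Z1 (scalar_matrices R) T n"
    using cvec.subspace_diff[OF csubspace_Z1 D Delta_Z1[OF \<phi>]] .
  ultimately show ?thesis using \<phi> by (auto simp: N1_def)
qed

section \<open>The isomorphisms of quotient spaces\<close>

lemma Delta_linear:
  "Delta A B M (\<Omega> + \<Omega>') = Delta A B M \<Omega> + Delta A B M \<Omega>'"
  "Delta A B M (c *\<^sub>C \<Omega>) = c *\<^sub>C Delta A B M \<Omega>"
  by (auto simp: Delta_def fun_eq_iff scaleC_fun_def)

text \<open>The linear map \<open>Delta\<close> satisfies the conditions of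
  \<open>quotients_isomorphicI\<close>: its values are derivations, they are inner exactly on
  \<open>ZR_mat\<close>, and \<open>derivation_decomposition\<close> makes it onto modulo inner
  derivations.\<close>

lemma quotients_isomorphic_Hom_mat:
  assumes "even_weakly_module_amenable (pts R) A n" "even_weakly_module_amenable (pts R) B n"
  shows "quotients_isomorphic (Z1 (scalar_matrices R) T n) (N1 (scalar_matrices R) T n)
    (Hom_mat R A B M n) (ZR_mat A B M n)"
proof (rule quotients_isomorphicI[where \<psi> = "Delta A B M"])
  show "csubspace (Hom_mat R A B M n)" "csubspace (ZR_mat A B M n)"
    unfolding Hom_mat_def ZR_mat_def by (rule csubspace_corner_map csubspace_Hom csubspace_ZR)+
  show "N1 (scalar_matrices R) T n \<subseteq> Z1 (scalar_matrices R) T n" by (auto simp: N1_def)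
  show "ZR_mat A B M n \<subseteq> Hom_mat R A B M n" using ZR_subset_Hom by (auto simp: Hom_mat_def ZR_mat_def)
qed (use derivation_decomposition assms in
    \<open>auto simp: csubspace_Z1 csubspace_N1 Delta_linear Hom_mat_def ZR_mat_def Delta_Z1 Delta_N1_iff
      corner_map_inject image_iff\<close>)

text \<open>The same criterion for the composite of \<open>Delta\<close> with
  \<open>corner_map\<close> gives this form directly, without composing two isomorphisms of
  quotients.\<close>

lemma quotients_isomorphic_Hom:
  assumes "even_weakly_module_amenable (pts R) A n" "even_weakly_module_amenable (pts R) B n"
  shows "quotients_isomorphic (Z1 (scalar_matrices R) T n) (N1 (scalar_matrices R) T n)
    (Hom R A B M n) (ZR A B M n)"
proof (rule quotients_isomorphicI[where \<psi> = "\<lambda>\<phi>. Delta A B M (corner_map \<phi>)"])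
  show "N1 (scalar_matrices R) T n \<subseteq> Z1 (scalar_matrices R) T n" by (auto simp: N1_def)
qed (use derivation_decomposition assms in
    \<open>auto simp: csubspace_Z1 csubspace_N1 csubspace_Hom csubspace_ZR ZR_subset_Hom
      Delta_linear corner_map_add corner_map_scale Delta_Z1 Delta_N1_iff\<close>)

end

theorem theorem5p1:
  fixes R :: "'r::complex_vector nspace" and mulR :: "'r \<Rightarrow> 'r \<Rightarrow> 'r"
    and A :: "('r, 'a::complex_vector) aalg" and B :: "('r, 'b::complex_vector) aalg"
    and M :: "('r, 'a, 'b, 'm::complex_vector) abmod" and n :: nat
  assumes "1 \<le> n"
    and "banach_algebra R mulR"
    and "unital_banach_algebra A" and "banach_algebra_module R mulR A" and "commutative_module R A"
    and "unital_banach_algebra B" and "banach_algebra_module R mulR B" and "commutative_module R B"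
    and "unital_banach_AB_module A B M" and "banach_AB_module_module R mulR A B M"
    and "commutative_module R M"
    and "dual_tower (2 * n) A" and "dual_tower (2 * n) B" and "dual_tower (2 * n) M"
  shows "ZR A B M n \<subseteq> Hom R A B M n \<and>
         (\<forall>\<Omega> \<in> Hom_mat R A B M n.
           Delta A B M \<Omega> \<in> Z1 (scalar_matrices R) (Tri A M B) n \<and>
           (\<exists>\<Omega>M \<in> Hom R A B M n. \<forall>a\<in>carr A. \<forall>m\<in>carr M. \<forall>b\<in>carr B.
              Delta A B M \<Omega> (a, m, b) = \<Omega> (0, m, 0) \<and> \<Omega> (0, m, 0) = (0, \<Omega>M m, 0)) \<and>
           (Delta A B M \<Omega> \<in> N1 (scalar_matrices R) (Tri A M B) n \<longleftrightarrow> \<Omega> \<in> ZR_mat A B M n)) \<and>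
         (even_weakly_module_amenable (pts R) A n \<and> even_weakly_module_amenable (pts R) B n \<longrightarrow>
           quotients_isomorphic
             (Z1 (scalar_matrices R) (Tri A M B) n) (N1 (scalar_matrices R) (Tri A M B) n)
             (Hom_mat R A B M n) (ZR_mat A B M n) \<and>
           quotients_isomorphic
             (Z1 (scalar_matrices R) (Tri A M B) n) (N1 (scalar_matrices R) (Tri A M B) n)
             (Hom R A B M n) (ZR A B M n))"
proof -
  interpret triangular R mulR A B M n
    using assms by unfold_locales (simp_all add: banach_algebra_def)
  have "Delta A B M \<Omega> \<in> Z1 (scalar_matrices R) (Tri A M B) n \<and>
      (\<exists>\<Omega>M \<in> Hom R A B M n. \<forall>a\<in>carr A. \<forall>m\<in>carr M. \<forall>b\<in>carr B.
        Delta A B M \<Omega> (a, m, b) = \<Omega> (0, m, 0) \<and> \<Omega> (0, m, 0) = (0, \<Omega>M m, 0)) \<and>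
      (Delta A B M \<Omega> \<in> N1 (scalar_matrices R) (Tri A M B) n \<longleftrightarrow> \<Omega> \<in> ZR_mat A B M n)"
    if mat: "\<Omega> \<in> Hom_mat R A B M n" for \<Omega>
  proof -
    obtain \<phi> where \<phi>: "\<phi> \<in> Hom R A B M n" and \<Omega>: "\<Omega> = corner_map \<phi>"
      using mat by (auto simp: Hom_mat_def)
    \<comment> \<open>Injectivity of \<open>corner_map\<close> makes \<phi> the only map behind
      \<Omega>, so membership in the matrix set can be read off from \<phi>.\<close>
    have "\<Omega> \<in> ZR_mat A B M n \<longleftrightarrow> \<phi> \<in> ZR A B M n"
      by (auto simp: ZR_mat_def \<Omega> corner_map_inject)
    moreover have "\<forall>a\<in>carr A. \<forall>m\<in>carr M. \<forall>b\<in>carr B.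
        Delta A B M \<Omega> (a, m, b) = \<Omega> (0, m, 0) \<and> \<Omega> (0, m, 0) = (0, \<phi> m, 0)"
      by (simp add: \<Omega> Delta_corner_map) (simp add: corner_map_def)
    ultimately show ?thesis
      using Delta_Z1[OF \<phi>] Delta_N1_iff[OF \<phi>] \<phi> by (auto simp: \<Omega>)
  qed
  then show ?thesis
    using ZR_subset_Hom quotients_isomorphic_Hom_mat quotients_isomorphic_Hom by blast
qed

end
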